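(* Assume (L1), (L2), (F1), (F2), (F3) and (PD) from the context. Let $\{\varepsilon_k\}$ be a sequence of positive numbers with $\varepsilon_k\to 0$, and for each $k$ let $x^k=(x^{k,1},\dots,x^{k,N})\in X$ be a stationary Nash equilibrium of $\mathrm{NEP}(X,\{\Theta^\nu_{\varepsilon_k}\}_{\nu=1}^N)$, i.e. for all $\nu\in\{1,\dots,N\}$, $$\langle\nabla_{x^\nu}\Theta^\nu_{\varepsilon_k}(x^{k,\nu},x^{k,-\nu}),d^\nu\rangle\ge 0\quad\forall d^\nu\in\mathcal T_{X^\nu}(x^{k,\nu}).$$ Assume that $X^\nu$ is regular for all $\nu$. Let $x^*$ be any accumulation point of $\{x^k\}$, and assume that, along a subsequence with $x^k\to x^*$, for all $\nu\in\{1,\dots,N\}$ the limit of $\nabla_{x^\nu}y_{\varepsilon_k}(x^{k,\nu},x^{k,-\nu})$ exists and $$\lim_{k\to\infty}\nabla_{x^\nu}y_{\varepsilon_k}(x^{k,\nu},x^{k,-\nu})\in\partial_{x^\nu}y(x^{*,\nu},x^{*,-\nu}).$$ Then $x^*$ is a C-stationary Nash equilibrium of $\mathrm{NEP}(X,\{\Theta^\nu\}_{\nu=1}^N)$. Moreover, if in addition, for all $\nu$, the function $x^\nu\mapsto\Theta^\nu(x^\nu,x^{*,-\nu})$ is regular (in Clarke's sense) at $x^{*,\nu}$, then $x^*$ is a B-stationary Nash equilibrium of $\mathrm{NEP}(X,\{\Theta^\nu\}_{\nu=1}^N)$.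
   Context: Setting. There are $N$ leaders and $M$ followers. Leader $\nu$ chooses $x^\nu\in X^\nu\subset\mathbb R^{n_\nu}$; $n=\sum_\nu n_\nu$, $x=(x^1,\dots,x^N)\in X:=X^1\times\dots\times X^N\subset\mathbb{R}^n$, and $x^{-\nu}$ is the tuple of all leaders' strategies except $x^\nu$. Follower $\omega$ chooses $y^\omega\in\mathbb R^{m_\omega}$; $m=\sum_\omega m_\omega$, $y=(y^1,\dots,y^M)\in\mathbb R^m$. Leaders' costs are $\theta^\nu:\mathbb R^{n+m}\to\mathbb R$. Given $x$ and $y^{-\omega}$ (the tuple of the other followers' strategies), follower $\omega$ minimizes $\gamma^\omega(x,y^\omega,y^{-\omega})$ over $y^\omega\in Y^\omega(x):=\{y^\omega\in\mathbb R^{m_\omega}\mid g^\omega(x,y^\omega)\le 0\}$, with $g^\omega:\mathbb R^n\times\mathbb R^{m_\omega}\to\mathbb R^{l_\omega}$, $l=\sum_\omega l_\omega$. Put $G(x,y)=(\nabla_{y^\omega}\gamma^\omega(x,y^\omega,y^{-\omega}))_{\omega=1}^M\in\mathbb R^m$ and $g(x,y)=(g^\omega(x,y^\omega))_{\omega=1}^M\in\mathbb R^l$. For differentiable $F:\mathbb R^p\to\mathbb R^q$, $\nabla F(x)=[\nabla F_1(x),\dots,\nabla F_q(x)]\in\mathbb R^{p\times q}$ is the transposed Jacobian. Assumptions, for all $\nu,\omega$: (L1) $\theta^\nu$ is continuously differentiable. (L2) $X^\nu$ is nonempty and compact. (F1) $\gamma^\omega$ and $g^\omega$ are sufficiently smooth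 (as many times continuously differentiable as needed), and $\gamma^\omega(x,\cdot,y^{-\omega})$ is convex for all $x,y^{-\omega}$. (F2) $Y^\omega(x)$ is nonempty, convex and compact for every $x$. (F3) For every $x\in X$ and $y^\omega\in Y^\omega(x)$, the gradients $\nabla_{y^\omega}g^\omega_i(x,y^\omega)$ over all $i$ with $g_i^\omega(x,y^\omega)=0$ are linearly independent (LICQ). (PD) For every $x$ and $y$, the Jacobian of $G(x,\cdot)$ at $y$ is positive definite (not necessarily symmetric). Response function and smoothing. For $\varepsilon\ge0$ let $\phi_\varepsilon(a,b)=\sqrt{a^2+b^2+2\varepsilon^2}-(a+b)$ and, for $w=(y,z,\lambda)\in\mathbb R^m\times\mathbb R^l\times\mathbb R^l$, $$H_\varepsilon(x,w)=\begin{bmatrix}G(x,y)+\nabla_yg(x,y)\lambda\\ g(x,y)+z\\ (\phi_\varepsilon(\lambda_i,z_i))_{i=1}^l\end{bmatrix}.$$ For $x\in X$ and $\varepsilon\ge0$, $w_\varepsilon(x)=(y_\varepsilon(x),z_\varepsilon(x),\lambda_\varepsilon(x))$ denotes the solution of $H_\varepsilon(x,w)=0$. The same work states, under the assumptions above, that this solution exists and is unique, and that near each $x\in X$ it extends to a neighbourhood in $\mathbb R^n$ as a locally Lipschitz function of $(\varepsilon,x)$ solving the equation, continuously differentiable in $x$ for fixed $\varepsilon>0$; derivatives refer to this extension. Write $y(x):=y_0(x)$; it is the unique Nash equilibrium of the followers' game for given $x$. Reduced games. $\Theta^\nu(x^\nu,x^{-\nu}):=\theta^\nu(x^\nu,x^{-\nu},y(x^\nu,x^{-\nu}))$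 and $\Theta^\nu_\varepsilon(x^\nu,x^{-\nu}):=\theta^\nu(x^\nu,x^{-\nu},y_\varepsilon(x^\nu,x^{-\nu}))$. $\mathrm{NEP}(X,\{\Theta^\nu\})$ (resp. $\mathrm{NEP}(X,\{\Theta^\nu_\varepsilon\})$) is the game in which each leader $\nu$ minimizes $\Theta^\nu(\cdot,x^{-\nu})$ (resp. $\Theta^\nu_\varepsilon(\cdot,x^{-\nu})$) over $X^\nu$. Variational notions. $\partial F(x)$ is the Clarke generalized Jacobian: the convex hull of all limits of $\nabla F(x^j)$ with $x^j\to x$, $F$ differentiable at $x^j$. $\partial_{x^\nu}$ denotes the generalized Jacobian/gradient of the function of $x^\nu$ obtained by freezing $x^{-\nu}$. $\psi:\mathbb R^p\to\mathbb R$ is regular at $x$ if for all $d$ the one-sided directional derivative $\psi'(x;d)=\lim_{\tau\downarrow0}(\psi(x+\tau d)-\psi(x))/\tau$ exists and equals $\psi^\circ(x;d)=\limsup_{y\to x,\tau\downarrow0}(\psi(y+\tau d)-\psi(y))/\tau$. For a set $C\subset\mathbb R^p$ and $x\in C$: $\mathcal T_C(x)=\{d\mid d=\lim_j\alpha_j(x^j-x),\ x^j\to x,\ x^j\in C,\ \alpha_j\ge0\}$; $K^\circ=\{v\mid\langle v,d\rangle\le0\ \forall d\in K\}$; $\mathcal N_C(x)$ is the set of $v$ for which there are $x^j\in C$, $x^j\to x$, $v^j\to v$ with $v^j\in\mathcal T_C(x^j)^\circ$. $C$ is regular if $\mathcal N_C(x)=\mathcal T_C(x)^\circ$ for all $x\in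 C$. $x^*\in X$ is a C-stationary Nash equilibrium of $\mathrm{NEP}(X,\{\Theta^\nu\})$ if $0\in\partial_{x^\nu}\Theta^\nu(x^{*,\nu},x^{*,-\nu})+\mathcal T_{X^\nu}(x^{*,\nu})^\circ$ for every $\nu$. It is a B-stationary Nash equilibrium if, for every $\nu$, the directional derivative of $\Theta^\nu(\cdot,x^{*,-\nu})$ at $x^{*,\nu}$ satisfies $(\Theta^\nu)'(x^{*,\nu},x^{*,-\nu};d^\nu)\ge0$ for all $d^\nu\in\mathcal T_{X^\nu}(x^{*,\nu})$ (when $y$ has a partial directional derivative $y'_{x^\nu}$, this quantity is $\nabla_{x^\nu}\theta^{\nu\top}d^\nu+y'_{x^\nu}(x^{*};d^\nu)^\top\nabla_y\theta^\nu$, evaluated at $(x^*,y(x^* ))$). *)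

theory Defs
  imports "HOL-Analysis.Analysis"
begin

section \<open>Smoothness and gradients\<close>

primrec Ck :: "nat \<Rightarrow> ('a::euclidean_space \<Rightarrow> real) \<Rightarrow> bool" where
  "Ck 0 f \<longleftrightarrow> continuous_on UNIV f"
| "Ck (Suc k) f \<longleftrightarrow> (\<forall>x. f differentiable (at x)) \<and>
     (\<forall>b\<in>Basis. Ck k (\<lambda>x. frechet_derivative f (at x) b))"

definition grad :: "(real^'p \<Rightarrow> real) \<Rightarrow> real^'p \<Rightarrow> real^'p" where
  "grad f x = (\<chi> i. frechet_derivative f (at x) (axis i 1))"

definition tjac :: "(real^'p \<Rightarrow> real^'q) \<Rightarrow> real^'p \<Rightarrow> real^'q^'p" where
  "tjac F x = transpose (jacobian F (at x))"


section \<open>Block structure\<close>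

text \<open>
  The space \<open>R^p\<close> with \<open>p\<close> the sum of the dimensions \<open>p_k\<close> of the players \<open>k\<close> is \<open>real^'p\<close> together
  with a map \<open>own\<close> that sends each coordinate to the player owning it; \<open>p_k\<close> is the number of
  coordinates owned by \<open>k\<close>. The factor \<open>R^(p_k)\<close> is \<open>blkspace own k\<close>, the vectors vanishing outside
  block \<open>k\<close>. A function of the \<open>k\<close>-th block with the other blocks frozen at \<open>x\<close> is
  \<open>\<lambda>u. f (upd own k x u)\<close>; it ignores the remaining coordinates of \<open>u\<close>, so its gradients and
  (transposed) Jacobians are those of the function on \<open>R^(p_k)\<close>, padded with zero rows.
\<close>

definition blkspace :: "('p \<Rightarrow> 'k) \<Rightarrow> 'k \<Rightarrow> (real^'p) set" where
  "blkspace own k = {u. \<forall>i. own i \<noteq> k \<longrightarrow> u $ i = 0}"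

definition blk :: "('p \<Rightarrow> 'k) \<Rightarrow> 'k \<Rightarrow> real^'p \<Rightarrow> real^'p" where
  "blk own k u = (\<chi> i. if own i = k then u $ i else 0)"

definition upd :: "('p \<Rightarrow> 'k) \<Rightarrow> 'k \<Rightarrow> real^'p \<Rightarrow> real^'p \<Rightarrow> real^'p" where
  "upd own k x u = (\<chi> i. if own i = k then u $ i else x $ i)"

definition pgrad :: "('p \<Rightarrow> 'k) \<Rightarrow> 'k \<Rightarrow> (real^'p \<Rightarrow> real) \<Rightarrow> real^'p \<Rightarrow> real^'p" where
  "pgrad own k f x = grad (\<lambda>u. f (upd own k x u)) x"

definition ptjac :: "('p \<Rightarrow> 'k) \<Rightarrow> 'k \<Rightarrow> (real^'p \<Rightarrow> real^'q) \<Rightarrow> real^'p \<Rightarrow> real^'q^'p" where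
  "ptjac own k F x = tjac (\<lambda>u. F (upd own k x u)) x"


section \<open>Variational notions\<close>

definition clarke_jac :: "(real^'p \<Rightarrow> real^'q) \<Rightarrow> real^'p \<Rightarrow> (real^'q^'p) set" where
  "clarke_jac F x = convex hull {J. \<exists>u. u \<longlonglongrightarrow> x \<and> (\<forall>j. F differentiable (at (u j))) \<and>
     (\<lambda>j. tjac F (u j)) \<longlonglongrightarrow> J}"

text \<open>The case of scalar functions, with \<open>real^'p\<close> in place of matrices with one column.\<close>

definition clarke_grad :: "(real^'p \<Rightarrow> real) \<Rightarrow> real^'p \<Rightarrow> (real^'p) set" where
  "clarke_grad f x = convex hull {v. \<exists>u. u \<longlonglongrightarrow> x \<and> (\<forall>j. f differentiable (at (u j))) \<and>
     (\<lambda>j. grad f (u j)) \<longlonglongrightarrow> v}"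

definition has_dir_deriv :: "('a::real_normed_vector \<Rightarrow> real) \<Rightarrow> 'a \<Rightarrow> 'a \<Rightarrow> real \<Rightarrow> bool" where
  "has_dir_deriv f x d D \<longleftrightarrow> ((\<lambda>t. (f (x + t *\<^sub>R d) - f x) / t) \<longlongrightarrow> D) (at_right 0)"

definition clarke_dd :: "('a::real_normed_vector \<Rightarrow> real) \<Rightarrow> 'a \<Rightarrow> 'a \<Rightarrow> ereal" where
  "clarke_dd f x d =
     Limsup (nhds x \<times>\<^sub>F at_right 0) (\<lambda>(u, t). ereal ((f (u + t *\<^sub>R d) - f u) / t))"

definition clarke_regular :: "('a::real_normed_vector \<Rightarrow> real) \<Rightarrow> 'a \<Rightarrow> bool" where
  "clarke_regular f x \<longleftrightarrow> (\<forall>d. \<exists>D. has_dir_deriv f x d D \<and> ereal D = clarke_dd f x d)"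

definition tangent_cone :: "'a::real_normed_vector set \<Rightarrow> 'a \<Rightarrow> 'a set" where
  "tangent_cone C x = {d. \<exists>\<alpha> u. u \<longlonglongrightarrow> x \<and> (\<forall>j. u j \<in> C \<and> \<alpha> j \<ge> (0::real)) \<and>
     (\<lambda>j. \<alpha> j *\<^sub>R (u j - x)) \<longlonglongrightarrow> d}"

text \<open>
  For subsets of a factor \<open>R^(p_k)\<close>, polar and normal cones are taken inside that factor; this is
  the subspace \<open>E\<close>.
\<close>

definition polar_in :: "'a::real_inner set \<Rightarrow> 'a set \<Rightarrow> 'a set" where
  "polar_in E K = {v \<in> E. \<forall>d\<in>K. v \<bullet> d \<le> 0}"

definition normal_cone_in :: "'a::real_inner set \<Rightarrow> 'a set \<Rightarrow> 'a \<Rightarrow> 'a set" where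
  "normal_cone_in E C x = {v. \<exists>u w. (\<forall>j. u j \<in> C \<and> w j \<in> polar_in E (tangent_cone C (u j))) \<and>
     u \<longlonglongrightarrow> x \<and> w \<longlonglongrightarrow> v}"

definition regular_set_in :: "'a::real_inner set \<Rightarrow> 'a set \<Rightarrow> bool" where
  "regular_set_in E C \<longleftrightarrow> (\<forall>x\<in>C. normal_cone_in E C x = polar_in E (tangent_cone C x))"


section \<open>Multi-leader-follower games\<close>

text \<open>
  \<open>'N\<close> and \<open>'M\<close> index leaders and followers; \<open>'n\<close>, \<open>'m\<close>, \<open>'l\<close> index the coordinates of \<open>x\<close>, of \<open>y\<close>
  and the follower constraints. \<open>constr i\<close> is a component of \<open>g^\<omega>\<close> for \<open>\<omega> = cown i\<close>; its second
  argument is meant to range over the factor \<open>blkspace fown (cown i)\<close> only.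
\<close>

record ('N, 'M, 'n::finite, 'm::finite, 'l) mlf_game =
  lown :: "'n \<Rightarrow> 'N"
  fown :: "'m \<Rightarrow> 'M"
  cown :: "'l \<Rightarrow> 'M"
  strat :: "'N \<Rightarrow> (real^'n) set"
  lcost :: "'N \<Rightarrow> (real^'n) \<times> (real^'m) \<Rightarrow> real"
  fcost :: "'M \<Rightarrow> (real^'n) \<times> (real^'m) \<Rightarrow> real"
  constr :: "'l \<Rightarrow> (real^'n) \<times> (real^'m) \<Rightarrow> real"

definition profiles :: "('N, 'M, 'n::finite, 'm::finite, 'l) mlf_game \<Rightarrow> (real^'n) set" where
  "profiles P = {x. \<forall>\<nu>. blk (lown P) \<nu> x \<in> strat P \<nu>}"

definition feas ::
  "('N, 'M, 'n::finite, 'm::finite, 'l) mlf_game \<Rightarrow> 'M \<Rightarrow> real^'n \<Rightarrow> (real^'m) set" where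
  "feas P \<omega> x = {v \<in> blkspace (fown P) \<omega>. \<forall>i. cown P i = \<omega> \<longrightarrow> constr P i (x, v) \<le> 0}"

definition Gmap ::
  "('N, 'M, 'n::finite, 'm::finite, 'l) mlf_game \<Rightarrow> real^'n \<Rightarrow> real^'m \<Rightarrow> real^'m" where
  "Gmap P x y = (\<chi> j. pgrad (fown P) (fown P j) (\<lambda>v. fcost P (fown P j) (x, v)) y $ j)"

definition gmap ::
  "('N, 'M, 'n::finite, 'm::finite, 'l::finite) mlf_game \<Rightarrow> real^'n \<Rightarrow> real^'m \<Rightarrow> real^'l" where
  "gmap P x y = (\<chi> i. constr P i (x, blk (fown P) (cown P i) y))"

definition licq ::
  "('N, 'M, 'n::finite, 'm::finite, 'l::finite) mlf_game \<Rightarrow> 'M \<Rightarrow> real^'n \<Rightarrow> real^'m \<Rightarrow> bool" where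
  "licq P \<omega> x v \<longleftrightarrow> (let A = {i. cown P i = \<omega> \<and> constr P i (x, v) = 0} in
     \<forall>c :: 'l \<Rightarrow> real. (\<Sum>i\<in>A. c i *\<^sub>R pgrad (fown P) \<omega> (\<lambda>u. constr P i (x, u)) v) = 0 \<longrightarrow>
       (\<forall>i\<in>A. c i = 0))"


section \<open>Smoothed response functions\<close>

definition phi :: "real \<Rightarrow> real \<Rightarrow> real \<Rightarrow> real" where
  "phi \<epsilon> a b = sqrt (a\<^sup>2 + b\<^sup>2 + 2 * \<epsilon>\<^sup>2) - (a + b)"

definition Hmap ::
  "('N, 'M, 'n::finite, 'm::finite, 'l::finite) mlf_game \<Rightarrow> real \<Rightarrow> real^'n \<Rightarrow>
    (real^'m) \<times> (real^'l) \<times> (real^'l) \<Rightarrow> (real^'m) \<times> (real^'l) \<times> (real^'l)" where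
  "Hmap P \<epsilon> x = (\<lambda>(y, z, \<mu>).
     (Gmap P x y + tjac (gmap P x) y *v \<mu>,
      gmap P x y + z,
      \<chi> i. phi \<epsilon> (\<mu> $ i) (z $ i)))"

definition wsol ::
  "('N, 'M, 'n::finite, 'm::finite, 'l::finite) mlf_game \<Rightarrow> real \<Rightarrow> real^'n \<Rightarrow>
    (real^'m) \<times> (real^'l) \<times> (real^'l)" where
  "wsol P \<epsilon> x = (THE w. Hmap P \<epsilon> x w = 0)"

text \<open>
  \<open>v\<close> extends \<open>wsol\<close>, which is meant on \<open>profiles P\<close> only, to a neighbourhood of \<open>(\<epsilon>0, x0)\<close> in
  \<open>[0, \<infinity>) \<times> R^n\<close> as a Lipschitz solution of the equation.
\<close>

definition wext_at ::
  "('N, 'M, 'n::finite, 'm::finite, 'l::finite) mlf_game \<Rightarrow> real \<Rightarrow> real^'n \<Rightarrow>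
    (real \<Rightarrow> real^'n \<Rightarrow> (real^'m) \<times> (real^'l) \<times> (real^'l)) \<Rightarrow> bool" where
  "wext_at P \<epsilon>0 x0 v \<longleftrightarrow> (\<exists>U L. open U \<and> (\<epsilon>0, x0) \<in> U \<and>
     L-lipschitz_on (U \<inter> {0..} \<times> UNIV) (\<lambda>(\<epsilon>, x). v \<epsilon> x) \<and>
     (\<forall>\<epsilon> x. (\<epsilon>, x) \<in> U \<and> \<epsilon> \<ge> 0 \<longrightarrow>
        Hmap P \<epsilon> x (v \<epsilon> x) = 0 \<and> (x \<in> profiles P \<longrightarrow> v \<epsilon> x = wsol P \<epsilon> x)))"

text \<open>
  \<open>yext P \<epsilon> x0\<close> is the function \<open>y_\<epsilon>\<close> near \<open>x0\<close>. Only its germ at \<open>x0\<close> is meaningful; since the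
  equation is locally uniquely solvable, the germ does not depend on the chosen extension.
  Derivatives of \<open>y_\<epsilon>\<close> and \<open>\<Theta>_\<epsilon>\<close> at \<open>x0\<close> are those of \<open>yext P \<epsilon> x0\<close> and \<open>lead_obj P \<epsilon> x0\<close> at \<open>x0\<close>.
\<close>

definition yext ::
  "('N, 'M, 'n::finite, 'm::finite, 'l::finite) mlf_game \<Rightarrow> real \<Rightarrow> real^'n \<Rightarrow> real^'n \<Rightarrow> real^'m"
  where "yext P \<epsilon> x0 x = fst ((SOME v. wext_at P \<epsilon> x0 v) \<epsilon> x)"

definition lead_obj ::
  "('N, 'M, 'n::finite, 'm::finite, 'l::finite) mlf_game \<Rightarrow> real \<Rightarrow> real^'n \<Rightarrow> 'N \<Rightarrow> real^'n \<Rightarrow> real"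
  where "lead_obj P \<epsilon> x0 \<nu> x = lcost P \<nu> (x, yext P \<epsilon> x0 x)"


section \<open>Stationary Nash equilibria\<close>

definition stationary_NE ::
  "('N, 'M, 'n::finite, 'm::finite, 'l::finite) mlf_game \<Rightarrow> real \<Rightarrow> real^'n \<Rightarrow> bool" where
  "stationary_NE P \<epsilon> x \<longleftrightarrow> x \<in> profiles P \<and>
     (\<forall>\<nu>. \<forall>d \<in> tangent_cone (strat P \<nu>) (blk (lown P) \<nu> x).
        pgrad (lown P) \<nu> (lead_obj P \<epsilon> x \<nu>) x \<bullet> d \<ge> 0)"

text \<open>\<open>\<Theta>^\<nu>\<close> as a function of the \<open>\<nu>\<close>-th block, the others frozen at \<open>x\<close>.\<close>

definition reduced_obj ::
  "('N, 'M, 'n::finite, 'm::finite, 'l::finite) mlf_game \<Rightarrow> real^'n \<Rightarrow> 'N \<Rightarrow> real^'n \<Rightarrow> real" where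
  "reduced_obj P x \<nu> u = lead_obj P 0 x \<nu> (upd (lown P) \<nu> x u)"

definition C_stationary_NE ::
  "('N, 'M, 'n::finite, 'm::finite, 'l::finite) mlf_game \<Rightarrow> real^'n \<Rightarrow> bool" where
  "C_stationary_NE P x \<longleftrightarrow> x \<in> profiles P \<and>
     (\<forall>\<nu>. 0 \<in> {\<xi> + \<eta> | \<xi> \<eta>. \<xi> \<in> clarke_grad (reduced_obj P x \<nu>) x \<and>
        \<eta> \<in> polar_in (blkspace (lown P) \<nu>) (tangent_cone (strat P \<nu>) (blk (lown P) \<nu> x))})"

definition B_stationary_NE ::
  "('N, 'M, 'n::finite, 'm::finite, 'l::finite) mlf_game \<Rightarrow> real^'n \<Rightarrow> bool" where
  "B_stationary_NE P x \<longleftrightarrow> x \<in> profiles P \<and>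
     (\<forall>\<nu>. \<forall>d \<in> tangent_cone (strat P \<nu>) (blk (lown P) \<nu> x).
        \<exists>D. has_dir_deriv (reduced_obj P x \<nu>) x d D \<and> D \<ge> 0)"

end

theory Submission
  imports Defs
begin

text \<open>
  Let \<open>F(\<epsilon>, x, w) = (\<epsilon>, x, H\<^sub>\<epsilon>(x, w))\<close>, with \<open>w\<^sub>*\<close> the solution at \<open>(0, x\<^sub>*)\<close>: the variational
  inequality of the followers is solvable by Brouwer, it has one solution because \<open>G\<close> is strictly
  monotone, and LICQ gives unique multipliers. Near \<open>(0, x\<^sub>*, w\<^sub>*)\<close> the map \<open>F\<close> is expansive,
  \<open>|F u - F v| \<ge> \<delta> |u - v|\<close>: otherwise a limit of normalized differences would be a nonzero solution
  \<open>(dy, dz, d\<mu>)\<close> of the linearized system, and testing it with \<open>dy\<close> contradicts positive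
  definiteness. Invariance of domain turns this into a Lipschitz local inverse, differentiable where
  \<open>\<epsilon> \<noteq> 0\<close>. By compactness all solutions of \<open>H\<^sub>\<epsilon>(x, w) = 0\<close> with \<open>(\<epsilon>, x)\<close> near \<open>(0, x\<^sub>*)\<close> lie near
  \<open>w\<^sub>*\<close>, so the inverse is the solution map there. For larger \<open>\<epsilon>\<close> solutions need not be unique,
  since only the feasible sets, not the constraint functions, are convex; but only the tail of the
  sequence matters. Along it the chain rule expresses \<open>\<nabla>\<Theta>\<^sub>\<epsilon>\<close> through \<open>\<nabla>y\<^sub>\<epsilon>\<close>, and its limit lies in
  the Clarke gradient of \<open>\<Theta>\<close>, while the negative of the limit lies in the normal cone, which is the
  polar of the tangent cone. B-stationarity follows because \<open>\<Theta>\<^sup>\<circ>(x; d) \<ge> \<xi> \<bullet> d\<close> for \<open>\<xi>\<close> in the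
  Clarke gradient.
\<close>

section \<open>Strict derivatives and local inverses\<close>

text \<open>Expansiveness takes the place of an invertible derivative: it can be tested on
  difference quotients, and at the kink only the signs of their limits are needed. The quotients
  have two moving endpoints, which is why the smooth data enter through strict derivatives.

  The delicate sign is that of the constraint curvature. Testing with \<open>dy\<close> leaves the
  terms \<open>\<mu> $ i * (a' i (x, y) (0, dy) \<bullet> dy)\<close>, which have to be nonnegative.
  Convex constraint functions would give this at once; convexity of the feasible set gives it only
  for an active constraint, with independent active gradients, and in directions tangent to it.
  Linearized complementarity supplies the tangency whenever the multiplier is positive.\<close>

definition strict_derivative ::
  "('a::real_normed_vector \<Rightarrow> 'b::real_normed_vector) \<Rightarrow> ('a \<Rightarrow> 'b) \<Rightarrow> 'a \<Rightarrow> bool" where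
  "strict_derivative F F' p \<longleftrightarrow> bounded_linear F' \<and>
     (\<forall>e>0. \<exists>d>0. \<forall>u\<in>ball p d. \<forall>v\<in>ball p d. norm (F u - F v - F' (u - v)) \<le> e * norm (u - v))"

lemma strict_derivative_bounded_linear: "strict_derivative F F' p \<Longrightarrow> bounded_linear F'"
  by (simp add: strict_derivative_def)

lemma strict_derivative_imp_has_derivative:
  assumes "strict_derivative F F' p"
  shows "(F has_derivative F') (at p)"
  unfolding has_derivative_at_alt
proof (intro conjI allI impI)
  show "bounded_linear F'" using assms by (simp add: strict_derivative_def)
  fix e :: real assume "e > 0"
  then obtain d where d: "d > 0"
    "\<And>u v. u \<in> ball p d \<Longrightarrow> v \<in> ball p d \<Longrightarrow> norm (F u - F v - F' (u - v)) \<le> e * norm (u - v)"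
    using assms unfolding strict_derivative_def by meson
  then show "\<exists>d>0. \<forall>y. norm (y - p) < d \<longrightarrow> norm (F y - F p - F' (y - p)) \<le> e * norm (y - p)"
    by (intro exI[of _ d]) (auto simp: dist_norm norm_minus_commute)
qed

lemma strict_derivative_imp_isCont: "strict_derivative F F' p \<Longrightarrow> isCont F p"
  using strict_derivative_imp_has_derivative has_derivative_continuous by blast

text \<open>Both endpoints move with \<open>k\<close>, so a derivative at \<open>p\<close> alone
  would leave the remainder uncontrolled. Strictness bounds it by a small multiple of
  \<open>norm (u k - v k)\<close>, which division by \<open>s k\<close> keeps bounded.\<close>

lemma strict_derivative_quotient_tendsto:
  fixes s :: "nat \<Rightarrow> real"
  assumes F: "strict_derivative F F' p"
    and u: "u \<longlonglongrightarrow> p" and v: "v \<longlonglongrightarrow> p" and s: "\<And>k. s k > 0"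
    and d: "(\<lambda>k. (u k - v k) /\<^sub>R s k) \<longlonglongrightarrow> d"
  shows "(\<lambda>k. (F (u k) - F (v k)) /\<^sub>R s k) \<longlonglongrightarrow> F' d"
proof -
  interpret bounded_linear F' using F by (simp add: strict_derivative_def)
  define R where "R k = (F (u k) - F (v k) - F' (u k - v k)) /\<^sub>R s k" for k
  have "R \<longlonglongrightarrow> 0"
  proof (rule tendstoI)
    fix e :: real assume "e > 0"
    \<comment> \<open>The normalized differences are eventually shorter than
      \<open>norm d + 1\<close>, so this slope keeps the remainder below \<open>e\<close>.\<close>
    define e' where "e' = e / (norm d + 1)"
    have nd: "norm d + 1 > 0" by (simp add: add_nonneg_pos)
    then have e': "e' > 0" using \<open>e > 0\<close> by (simp add: e'_def)
    then obtain \<delta> where \<delta>: "\<delta> > 0"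
      "\<And>u v. u \<in> ball p \<delta> \<Longrightarrow> v \<in> ball p \<delta> \<Longrightarrow> norm (F u - F v - F' (u - v)) \<le> e' * norm (u - v)"
      using F unfolding strict_derivative_def by meson
    have "eventually (\<lambda>k. dist (u k) p < \<delta>) sequentially" "eventually (\<lambda>k. dist (v k) p < \<delta>) sequentially"
      using u v \<open>\<delta> > 0\<close> by (auto dest: tendstoD)
    moreover have "eventually (\<lambda>k. norm ((u k - v k) /\<^sub>R s k) < norm d + 1) sequentially"
      using tendsto_norm[OF d] by (rule order_tendstoD) simp
    ultimately show "eventually (\<lambda>k. dist (R k) 0 < e) sequentially"
    proof eventually_elim
      case (elim k)
      then have "norm (F (u k) - F (v k) - F' (u k - v k)) \<le> e' * norm (u k - v k)"
        by (intro \<delta>) (auto simp: dist_commute)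
      then have "norm (R k) \<le> e' * norm ((u k - v k) /\<^sub>R s k)"
        using divide_right_mono[of _ _ "s k"] s[of k]
        by (simp add: R_def divide_inverse mult.commute mult.assoc)
      also have "\<dots> < e' * (norm d + 1)" using elim e' by simp
      also have "\<dots> = e" using nd by (simp add: e'_def)
      finally show ?case by simp
    qed
  qed
  from tendsto_add[OF this tendsto[OF d]] show ?thesis
    by (simp add: R_def scaleR_right_diff_distrib scaleR diff)
qed

text \<open>The lower bound yields injectivity and the Lipschitz constant of the inverse; openness
  of the image comes from topology alone, because source and target are the same space.\<close>

lemma local_inverse_of_expansive:
  fixes F :: "'a::euclidean_space \<Rightarrow> 'a"
  assumes cont: "continuous_on UNIV F" and "r > 0" "\<delta> > 0"
    and low: "\<And>u v. u \<in> ball p r \<Longrightarrow> v \<in> ball p r \<Longrightarrow> \<delta> * norm (u - v) \<le> norm (F u - F v)"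
  obtains V h where "open V" "F p \<in> V" "\<And>q. q \<in> V \<Longrightarrow> h q \<in> ball p r" "\<And>q. q \<in> V \<Longrightarrow> F (h q) = q"
    "(1/\<delta>)-lipschitz_on V h"
proof -
  have inj: "inj_on F (ball p r)"
  proof (rule inj_onI)
    fix u v assume "u \<in> ball p r" "v \<in> ball p r" "F u = F v"
    with low[of u v] have "\<delta> * norm (u - v) \<le> 0" by simp
    with \<open>\<delta> > 0\<close> show "u = v" by (simp add: mult_le_0_iff)
  qed
  define V where "V = F ` ball p r"
  define h where "h = inv_into (ball p r) F"
  have h: "h q \<in> ball p r" "F (h q) = q" if "q \<in> V" for q
    using that inv_into_into[of q F "ball p r"] f_inv_into_f[of q F "ball p r"]
    unfolding h_def V_def by auto
  show thesis
  proof
    show "open V" unfolding V_def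
      by (rule invariance_of_domain[OF _ open_ball inj]) (use cont continuous_on_subset in blast)
    show "F p \<in> V" using \<open>r > 0\<close> by (simp add: V_def)
    show "(1/\<delta>)-lipschitz_on V h"
    proof (rule lipschitz_onI)
      fix x y assume "x \<in> V" "y \<in> V"
      then show "dist (h x) (h y) \<le> 1 / \<delta> * dist x y"
        using low[of "h x" "h y"] h[of x] h[of y] \<open>\<delta> > 0\<close> by (simp add: dist_norm field_simps)
    qed (use \<open>\<delta> > 0\<close> in simp)
  qed (use h in auto)
qed

text \<open>Evaluating the bound at \<open>u + t *\<^sub>R h\<close> and letting the remainder
  become small relative to \<open>t\<close> passes the lower bound to the derivative, which is
  thereby injective when \<open>\<delta> > 0\<close>.\<close>

lemma has_derivative_expansive:
  assumes F: "(F has_derivative F') (at u)"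
    and S: "open S" "u \<in> S" and low: "\<And>v. v \<in> S \<Longrightarrow> \<delta> * norm (v - u) \<le> norm (F v - F u)"
  shows "\<delta> * norm h \<le> norm (F' h)"
proof (rule field_le_epsilon)
  fix e :: real assume "e > 0"
  have bl: "bounded_linear F'" using F by (rule has_derivative_bounded_linear)
  show "\<delta> * norm h \<le> norm (F' h) + e"
  proof (cases "h = 0")
    case True then show ?thesis using \<open>e > 0\<close> by simp
  next
    case False
    then have nh: "norm h > 0" by simp
    have "e / norm h > 0" using nh \<open>e > 0\<close> by simp
    then obtain d where d: "d > 0"
      "\<And>y. norm (y - u) < d \<Longrightarrow> norm (F y - F u - F' (y - u)) \<le> (e / norm h) * norm (y - u)"
      using F unfolding has_derivative_at_alt by meson
    obtain \<rho> where \<rho>: "\<rho> > 0" "ball u \<rho> \<subseteq> S" using S by (meson open_contains_ball)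
    \<comment> \<open>Half of the smaller radius, measured in units of \<open>norm h\<close>, keeps
      the increment inside both neighbourhoods.\<close>
    define t where "t = min d \<rho> / (2 * norm h)"
    have t: "t > 0" using d \<rho> nh by (simp add: t_def)
    have "t * norm h = min d \<rho> / 2" using nh by (simp add: t_def)
    then have tn: "t * norm h < d" "t * norm h < \<rho>" using d(1) \<rho>(1) by linarith+
    have "u + t *\<^sub>R h \<in> S" using tn \<rho> t by (auto simp: subset_iff dist_norm)
    from low[OF this] have 1: "\<delta> * (t * norm h) \<le> norm (F (u + t *\<^sub>R h) - F u)" using t by simp
    have 2: "norm (F (u + t *\<^sub>R h) - F u - F' (t *\<^sub>R h)) \<le> (e / norm h) * (t * norm h)"
      using d(2)[of "u + t *\<^sub>R h"] tn t by simp
    have 3: "norm (F' (t *\<^sub>R h)) = t * norm (F' h)" using t bl by (simp add: linear_simps)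
    have "norm (F (u + t *\<^sub>R h) - F u) \<le> norm (F' (t *\<^sub>R h)) + norm (F (u + t *\<^sub>R h) - F u - F' (t *\<^sub>R h))"
      by (metis add.commute diff_add_cancel norm_triangle_ineq)
    with 1 2 3 nh have "t * (\<delta> * norm h) \<le> t * (norm (F' h) + e)" by (simp add: algebra_simps)
    then show ?thesis using t by simp
  qed
qed

section \<open>Strict differentiability of continuously differentiable functions\<close>

lemma Ck_Suc_imp_Ck: "Ck (Suc k) f \<Longrightarrow> Ck k f"
  by (induction k arbitrary: f)
     (auto intro!: continuous_at_imp_continuous_on differentiable_imp_continuous_within)

lemma Ck_2_imp_Ck_1: "Ck 2 f \<Longrightarrow> Ck 1 f"
  using Ck_Suc_imp_Ck[of 1 f] by (simp only: Suc_1)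

lemma linear_eq_sum_Basis:
  fixes f :: "'a::euclidean_space \<Rightarrow> real"
  assumes "linear f" shows "f h = (\<Sum>b\<in>Basis. (h \<bullet> b) * f b)"
proof -
  have "f h = f (\<Sum>b\<in>Basis. (h \<bullet> b) *\<^sub>R b)" by (simp add: euclidean_representation)
  also have "\<dots> = (\<Sum>b\<in>Basis. (h \<bullet> b) * f b)"
    by (simp add: linear_sum[OF assms] linear_scale[OF assms])
  finally show ?thesis .
qed

lemma Ck_1_has_derivative: "Ck 1 f \<Longrightarrow> (f has_derivative frechet_derivative f (at p)) (at p)"
  by (simp add: frechet_derivative_works)

lemma Ck_1_isCont_derivative:
  assumes "Ck 1 f" shows "isCont (\<lambda>p. frechet_derivative f (at p) h) p"
proof -
  have "linear (frechet_derivative f (at q))" for q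
    using Ck_1_has_derivative[OF assms] has_derivative_linear by blast
  from linear_eq_sum_Basis[OF this]
  have "(\<lambda>p. frechet_derivative f (at p) h) = (\<lambda>p. \<Sum>b\<in>Basis. (h \<bullet> b) * frechet_derivative f (at p) b)"
    by blast
  moreover have "isCont (\<lambda>p. frechet_derivative f (at p) b) p" if "b \<in> Basis" for b
    using assms that by (simp add: continuous_on_eq_continuous_at)
  ultimately show ?thesis by (auto intro!: continuous_intros)
qed

text \<open>The mean value inequality is applied to \<open>f\<close> minus its derivative at
  \<open>p\<close>; the derivative of this difference is small near \<open>p\<close> because the
  finitely many partial derivatives are continuous.\<close>

lemma Ck_1_strict_derivative:
  assumes f: "Ck 1 f"
  shows "strict_derivative f (frechet_derivative f (at p)) p"
  unfolding strict_derivative_def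
proof (intro conjI allI impI)
  define f' where "f' q = frechet_derivative f (at q)" for q
  have D: "(f has_derivative f' q) (at q)" for q unfolding f'_def by (rule Ck_1_has_derivative[OF f])
  then have lin: "linear (f' q)" for q using has_derivative_linear by blast
  show "bounded_linear (frechet_derivative f (at p))" using D has_derivative_bounded_linear f'_def by metis
  fix e :: real assume e: "e > 0"
  \<comment> \<open>The operator norm is bounded by a sum over \<open>DIM('a)\<close> basis
    directions, each contributing at most \<open>e1\<close>.\<close>
  define e1 where "e1 = e / DIM('a)"
  have e1: "e1 > 0" using e by (simp add: e1_def)
  have "((\<lambda>q. f' q b) \<longlongrightarrow> f' p b) (nhds p)" for b
    using Ck_1_isCont_derivative[OF f, of p b] unfolding isCont_def f'_def
    by (rule tendsto_at_iff_tendsto_nhds[THEN iffD1])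
  from tendstoD[OF this e1] have "eventually (\<lambda>q. dist (f' q b) (f' p b) < e1) (nhds p)" for b .
  then have "eventually (\<lambda>q. \<forall>b\<in>Basis. dist (f' q b) (f' p b) < e1) (nhds p)"
    by (intro eventually_ball_finite) auto
  then obtain d where d: "d > 0" "\<And>q b. dist q p < d \<Longrightarrow> b \<in> Basis \<Longrightarrow> dist (f' q b) (f' p b) < e1"
    unfolding eventually_nhds_metric by blast
  have "norm (f u - f v - f' p (u - v)) \<le> e * norm (u - v)" if "u \<in> ball p d" "v \<in> ball p d" for u v
  proof -
    have "norm ((f u - f' p u) - (f v - f' p v)) \<le> e * norm (u - v)"
    proof (rule differentiable_bound[where S = "ball p d" and f' = "\<lambda>q h. f' q h - f' p h"])
      fix q assume q: "q \<in> ball p d"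
      have "(f' p has_derivative f' p) (at q within ball p d)"
        using D has_derivative_bounded_linear bounded_linear_imp_has_derivative by blast
      then show "((\<lambda>q. f q - f' p q) has_derivative (\<lambda>h. f' q h - f' p h)) (at q within ball p d)"
        using has_derivative_at_withinI[OF D] by (intro has_derivative_diff)
      show "onorm (\<lambda>h. f' q h - f' p h) \<le> e"
      proof (rule onorm_le)
        fix h
        have "f' q h - f' p h = (\<Sum>b\<in>Basis. (h \<bullet> b) * (f' q b - f' p b))"
          by (simp add: linear_eq_sum_Basis[OF lin, of _ h] right_diff_distrib sum_subtractf)
        also have "norm \<dots> \<le> (\<Sum>b\<in>(Basis::'a set). norm h * e1)"
        proof (rule sum_norm_le)
          fix b :: 'a assume b: "b \<in> Basis"
          have "\<bar>f' q b - f' p b\<bar> \<le> e1" using d(2)[OF _ b, of q] q by (simp add: dist_commute dist_real_def)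
          then show "norm ((h \<bullet> b) * (f' q b - f' p b)) \<le> norm h * e1"
            unfolding real_norm_def abs_mult by (intro mult_mono Basis_le_norm b) auto
        qed
        also have "\<dots> = e * norm h" by (simp add: e1_def)
        finally show "norm (f' q h - f' p h) \<le> e * norm h" .
      qed
    qed (use that in auto)
    then show ?thesis by (simp add: linear_diff[OF lin] algebra_simps)
  qed
  then show "\<exists>d>0. \<forall>u\<in>ball p d. \<forall>v\<in>ball p d. norm (f u - f v - frechet_derivative f (at p) (u - v)) \<le> e * norm (u - v)"
    using d(1) unfolding f'_def by blast
qed

lemma strict_derivative_vec:
  fixes F :: "'a::real_normed_vector \<Rightarrow> real^'m::finite"
  assumes "\<And>j. strict_derivative (\<lambda>u. F u $ j) (F' j) p"
  shows "strict_derivative F (\<lambda>h. \<chi> j. F' j h) p"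
  unfolding strict_derivative_def
proof (intro conjI allI impI)
  have bl: "bounded_linear (F' j)" for j using assms by (simp add: strict_derivative_def)
  show "bounded_linear (\<lambda>h. \<chi> j. F' j h)"
  proof -
    have "bounded_linear (\<lambda>h. \<Sum>j\<in>UNIV. F' j h *\<^sub>R (axis j 1 :: real^'m))"
      by (intro bounded_linear_sum bounded_linear_scaleR_const bl)
    moreover have "(\<Sum>j\<in>UNIV. F' j h *\<^sub>R (axis j 1 :: real^'m)) = (\<chi> j. F' j h)" for h
      using basis_expansion[of "\<chi> j. F' j h"] by (simp add: scalar_mult_eq_scaleR)
    ultimately show ?thesis by simp
  qed
  fix e :: real assume e: "e > 0"
  then have "e / CARD('m) > 0" by simp
  then have "\<forall>j. \<exists>d>0. \<forall>u\<in>ball p d. \<forall>v\<in>ball p d. norm (F u $ j - F v $ j - F' j (u - v)) \<le> e / CARD('m) * norm (u - v)"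
    using assms unfolding strict_derivative_def by blast
  from choice[OF this] obtain d where d: "\<And>j. d j > 0"
    "\<And>j u v. u \<in> ball p (d j) \<Longrightarrow> v \<in> ball p (d j) \<Longrightarrow> norm (F u $ j - F v $ j - F' j (u - v)) \<le> e / CARD('m) * norm (u - v)"
    by blast
  define \<delta> where "\<delta> = Min (range d)"
  have \<delta>: "\<delta> > 0" "\<And>j. \<delta> \<le> d j" using d(1) by (auto simp: \<delta>_def)
  have "norm (F u - F v - (\<chi> j. F' j (u - v))) \<le> e * norm (u - v)" if uv: "u \<in> ball p \<delta>" "v \<in> ball p \<delta>" for u v
  proof -
    have "norm (F u - F v - (\<chi> j. F' j (u - v))) \<le> (\<Sum>j\<in>UNIV. \<bar>(F u - F v - (\<chi> j. F' j (u - v))) $ j\<bar>)"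
      by (rule norm_le_l1_cart)
    also have "\<dots> \<le> (\<Sum>j\<in>(UNIV::'m set). e / CARD('m) * norm (u - v))"
    proof (rule sum_mono)
      fix j
      have "u \<in> ball p (d j)" "v \<in> ball p (d j)" using uv \<delta>(2)[of j] by auto
      from d(2)[OF this] show "\<bar>(F u - F v - (\<chi> j. F' j (u - v))) $ j\<bar> \<le> e / CARD('m) * norm (u - v)" by simp
    qed
    also have "\<dots> = e * norm (u - v)" by simp
    finally show ?thesis .
  qed
  then show "\<exists>d>0. \<forall>u\<in>ball p d. \<forall>v\<in>ball p d. norm (F u - F v - (\<chi> j. F' j (u - v))) \<le> e * norm (u - v)"
    using \<delta>(1) by blast
qed

lemma strict_derivative_frechet:
  assumes "strict_derivative F F' p" shows "strict_derivative F (frechet_derivative F (at p)) p"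
  using frechet_derivative_at[OF strict_derivative_imp_has_derivative[OF assms]] assms by simp

lemma linear_inner_vec:
  fixes f :: "real^'p \<Rightarrow> real"
  assumes "linear f" shows "f h = (\<chi> j. f (axis j 1)) \<bullet> h"
proof -
  have "f h = f (\<Sum>j\<in>UNIV. (h $ j) *\<^sub>R axis j 1)" using basis_expansion[of h] by (simp add: scalar_mult_eq_scaleR)
  also have "\<dots> = (\<Sum>j\<in>UNIV. h $ j * f (axis j 1))"
    by (simp add: linear_sum[OF assms] linear_scale[OF assms])
  finally show ?thesis by (simp add: inner_vec_def mult.commute)
qed

lemma has_derivative_vec_lambda:
  assumes "\<And>i. (f i has_derivative f' i) (at p)"
  shows "((\<lambda>u. \<chi> i. (f i u :: real)) has_derivative (\<lambda>h. \<chi> i. f' i h)) (at p)"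
  by (subst has_derivative_componentwise_within)
     (auto simp: Basis_vec_def inner_axis intro: assms)

lemma differentiable_vec_lambda:
  assumes "\<And>i. (\<lambda>u. f i u :: real) differentiable (at p)"
  shows "(\<lambda>u. \<chi> i. f i u) differentiable (at p)"
proof -
  have "\<forall>i. \<exists>D. (f i has_derivative D) (at p)" using assms unfolding differentiable_def by blast
  from choice[OF this] obtain f' where "\<And>i. (f i has_derivative f' i) (at p)" by blast
  then have "((\<lambda>u. \<chi> i. f i u) has_derivative (\<lambda>h. \<chi> i. f' i h)) (at p)"
    by (rule has_derivative_vec_lambda)
  then show ?thesis by (rule differentiableI)
qed

lemma differentiable_Pair:
  assumes "f differentiable (at p within S)" "f2 differentiable (at p within S)"
  shows "(\<lambda>u. (f u, f2 u)) differentiable (at p within S)"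
proof -
  obtain D D2 where "(f has_derivative D) (at p within S)" "(f2 has_derivative D2) (at p within S)"
    using assms unfolding differentiable_def by blast
  then have "((\<lambda>u. (f u, f2 u)) has_derivative (\<lambda>h. (D h, D2 h))) (at p within S)"
    by (rule has_derivative_Pair)
  then show ?thesis by (rule differentiableI)
qed

lemma differentiable_bounded_linear_compose:
  assumes "bounded_linear T" "f differentiable F"
  shows "(\<lambda>u. T (f u)) differentiable F"
proof -
  obtain D where "(f has_derivative D) F" using assms(2) unfolding differentiable_def by blast
  from bounded_linear.has_derivative[OF assms(1) this] show ?thesis by (rule differentiableI)
qed

section \<open>The smoothed complementarity function\<close>

text \<open>Squaring the root equation cancels the squares and leaves the product. The root also
  forces \<open>a + b\<close> to be nonnegative, and two reals with nonnegative sum and product have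
  no negative member.\<close>

lemma phi_eq_0_iff: "phi e a b = 0 \<longleftrightarrow> a \<ge> 0 \<and> b \<ge> 0 \<and> a * b = e\<^sup>2"
proof
  assume "phi e a b = 0"
  then have s: "sqrt (a\<^sup>2 + b\<^sup>2 + 2 * e\<^sup>2) = a + b" by (simp add: phi_def)
  then have "a + b \<ge> 0" by (metis real_sqrt_ge_zero add_nonneg_nonneg zero_le_power2 mult_nonneg_nonneg zero_le_numeral)
  moreover have "a\<^sup>2 + b\<^sup>2 + 2 * e\<^sup>2 = (a + b)\<^sup>2"
    using s by (metis real_sqrt_pow2 add_nonneg_nonneg zero_le_power2 mult_nonneg_nonneg zero_le_numeral)
  then have ab: "a * b = e\<^sup>2" by (simp add: power2_eq_square algebra_simps)
  ultimately have "a \<ge> 0 \<and> b \<ge> 0"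
    by (smt (verit) mult_nonneg_nonpos2 mult_nonneg_nonpos mult_pos_neg mult_neg_pos zero_le_power2)
  with ab show "a \<ge> 0 \<and> b \<ge> 0 \<and> a * b = e\<^sup>2" by simp
next
  assume h: "a \<ge> 0 \<and> b \<ge> 0 \<and> a * b = e\<^sup>2"
  then have "a\<^sup>2 + b\<^sup>2 + 2 * e\<^sup>2 = (a + b)\<^sup>2" by (simp add: power2_eq_square algebra_simps)
  then show "phi e a b = 0" using h by (simp add: phi_def)
qed

lemma abs_le_phi_root: "\<bar>a\<bar> \<le> sqrt (a\<^sup>2 + b\<^sup>2 + 2 * e\<^sup>2)" "\<bar>b\<bar> \<le> sqrt (a\<^sup>2 + b\<^sup>2 + 2 * e\<^sup>2)"
  "\<bar>e\<bar> \<le> sqrt (a\<^sup>2 + b\<^sup>2 + 2 * e\<^sup>2)"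
  by (auto intro!: real_le_rsqrt)

text \<open>The best factor is the square root of 2. The rational value 3/2 is still below 2, and
  this gap keeps the two slopes of \<open>phi\<close> from approaching 0 together.\<close>

lemma sum_le_phi_root: "a + b \<le> 3/2 * sqrt (a\<^sup>2 + b\<^sup>2 + 2 * e\<^sup>2)"
proof -
  have "0 \<le> (1/9) * (a\<^sup>2 + b\<^sup>2) + (4/9) * (a - b)\<^sup>2 + 2 * e\<^sup>2" by simp
  also have "\<dots> = (a\<^sup>2 + b\<^sup>2 + 2 * e\<^sup>2) - (2/3 * (a + b))\<^sup>2"
    by (simp add: power2_eq_square field_simps)
  finally have "2/3 * (a + b) \<le> sqrt (a\<^sup>2 + b\<^sup>2 + 2 * e\<^sup>2)" by (intro real_le_rsqrt) simp
  then show ?thesis by simp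
qed

text \<open>Rationalizing the difference of the two roots gives an exact mean value formula that
  survives the kink. Its coefficients are secant slopes in \<open>a\<close>, \<open>b\<close> and
  the smoothing parameter.\<close>

lemma phi_difference:
  fixes e e' a a' b b' :: real
  obtains A B C where "phi e a b - phi e' a' b' = A * (a - a') + B * (b - b') + C * (e - e')"
    "A \<le> 0" "B \<le> 0" "A + B \<le> -1/2" "\<bar>C\<bar> \<le> 2"
    "A = (a + a') / (sqrt (a\<^sup>2 + b\<^sup>2 + 2 * e\<^sup>2) + sqrt (a'\<^sup>2 + b'\<^sup>2 + 2 * e'\<^sup>2)) - 1"
    "B = (b + b') / (sqrt (a\<^sup>2 + b\<^sup>2 + 2 * e\<^sup>2) + sqrt (a'\<^sup>2 + b'\<^sup>2 + 2 * e'\<^sup>2)) - 1"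
proof -
  define s where "s = sqrt (a\<^sup>2 + b\<^sup>2 + 2 * e\<^sup>2)"
  define s' where "s' = sqrt (a'\<^sup>2 + b'\<^sup>2 + 2 * e'\<^sup>2)"
  have s2: "s\<^sup>2 = a\<^sup>2 + b\<^sup>2 + 2 * e\<^sup>2" "s'\<^sup>2 = a'\<^sup>2 + b'\<^sup>2 + 2 * e'\<^sup>2" by (simp_all add: s_def s'_def)
  have pos: "s \<ge> 0" "s' \<ge> 0" by (simp_all add: s_def s'_def)
  have le: "\<bar>a\<bar> \<le> s" "\<bar>b\<bar> \<le> s" "\<bar>e\<bar> \<le> s" "\<bar>a'\<bar> \<le> s'" "\<bar>b'\<bar> \<le> s'" "\<bar>e'\<bar> \<le> s'"
    using abs_le_phi_root unfolding s_def s'_def by auto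
  have ab: "a + b \<le> 3/2 * s" "a' + b' \<le> 3/2 * s'"
    unfolding s_def s'_def by (rule sum_le_phi_root)+
  define A where "A = (a + a') / (s + s') - 1"
  define B where "B = (b + b') / (s + s') - 1"
  define C where "C = 2 * (e + e') / (s + s')"
  show thesis
  proof (rule that[of A B C])
    show "A = (a + a') / (sqrt (a\<^sup>2 + b\<^sup>2 + 2 * e\<^sup>2) + sqrt (a'\<^sup>2 + b'\<^sup>2 + 2 * e'\<^sup>2)) - 1"
      "B = (b + b') / (sqrt (a\<^sup>2 + b\<^sup>2 + 2 * e\<^sup>2) + sqrt (a'\<^sup>2 + b'\<^sup>2 + 2 * e'\<^sup>2)) - 1"
      unfolding A_def B_def s_def s'_def by simp_all
    have "phi e a b - phi e' a' b' = A * (a - a') + B * (b - b') + C * (e - e') \<and> A \<le> 0 \<and> B \<le> 0 \<and> A + B \<le> -1/2 \<and> \<bar>C\<bar> \<le> 2"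
    proof (cases "s + s' = 0")
      \<comment> \<open>By the convention \<open>x / 0 = 0\<close> the coefficients are -1, -1 and
        0, and all six arguments vanish here.\<close>
      case True
      with pos have "s = 0" "s' = 0" by auto
      then show ?thesis using le by (simp add: A_def B_def C_def phi_def flip: s_def s'_def)
    next
      case False
      with pos have p: "s + s' > 0" by linarith
      have "s - s' = (s\<^sup>2 - s'\<^sup>2) / (s + s')" using p by (simp add: field_simps power2_eq_square)
      also have "\<dots> = ((a + a') * (a - a') + (b + b') * (b - b') + 2 * (e + e') * (e - e')) / (s + s')"
        unfolding s2 by (simp add: algebra_simps power2_eq_square)
      also have "\<dots> = (A + 1) * (a - a') + (B + 1) * (b - b') + C * (e - e')"
        by (simp only: A_def B_def C_def diff_add_cancel add_divide_distrib [of "_ * _"]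
            add_divide_distrib [of "_ + _"] times_divide_eq_left)
      finally have "phi e a b - phi e' a' b' = A * (a - a') + B * (b - b') + C * (e - e')"
        unfolding phi_def s_def [symmetric] s'_def [symmetric] by (simp add: algebra_simps)
      moreover have "A \<le> 0" "B \<le> 0" unfolding A_def B_def using le p by (auto simp: field_simps)
      moreover have "A + B + 2 \<le> 3/2"
      proof -
        have "A + B + 2 = ((a + b) + (a' + b')) / (s + s')" by (simp add: A_def B_def add_divide_distrib)
        also have "\<dots> \<le> 3/2" using ab p by (simp add: field_simps)
        finally show ?thesis .
      qed
      moreover have "\<bar>C\<bar> \<le> 2"
      proof -
        have "\<bar>e + e'\<bar> \<le> s + s'" using abs_triangle_ineq[of e e'] le(3,6) by (rule order_trans[OF _ add_mono])
        then have "\<bar>2 * (e + e')\<bar> \<le> 2 * (s + s')" by (simp only: abs_mult abs_numeral mult_left_mono zero_le_numeral)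
        then show ?thesis using p by (simp add: C_def field_simps abs_le_iff)
      qed
      ultimately show ?thesis by simp
    qed
    then show "phi e a b - phi e' a' b' = A * (a - a') + B * (b - b') + C * (e - e')"
      "A \<le> 0" "B \<le> 0" "A + B \<le> -1/2" "\<bar>C\<bar> \<le> 2" by auto
  qed
qed

text \<open>After division by \<open>s k\<close> the secant formula says that a combination of the
  two quotients tends to 0. If \<alpha> or \<beta> is positive, the coefficients converge to 0 and
  -1 in the corresponding order, which annihilates one limit. If both are 0 the coefficients may
  oscillate, but their signs and the bound -1/2 on their sum still exclude limits of equal strict
  sign.\<close>

lemma phi_quotient_limit:
  fixes a a' b b' e e' s :: "nat \<Rightarrow> real"
  assumes s: "\<And>k. s k > 0" and e: "e \<longlonglongrightarrow> 0" "e' \<longlonglongrightarrow> 0"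
    and a: "a \<longlonglongrightarrow> \<alpha>" "a' \<longlonglongrightarrow> \<alpha>" and b: "b \<longlonglongrightarrow> \<beta>" "b' \<longlonglongrightarrow> \<beta>"
    and da: "(\<lambda>k. (a k - a' k) / s k) \<longlonglongrightarrow> da" and db: "(\<lambda>k. (b k - b' k) / s k) \<longlonglongrightarrow> db"
    and de: "(\<lambda>k. (e k - e' k) / s k) \<longlonglongrightarrow> 0"
    and phi: "(\<lambda>k. (phi (e k) (a k) (b k) - phi (e' k) (a' k) (b' k)) / s k) \<longlonglongrightarrow> 0"
    and sol: "\<alpha> \<ge> 0" "\<beta> \<ge> 0" "\<alpha> * \<beta> = 0"
  shows "da * db \<le> 0" "\<alpha> > 0 \<Longrightarrow> db = 0" "\<beta> > 0 \<Longrightarrow> da = 0"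
proof -
  define S where "S k = sqrt ((a k)\<^sup>2 + (b k)\<^sup>2 + 2 * (e k)\<^sup>2) + sqrt ((a' k)\<^sup>2 + (b' k)\<^sup>2 + 2 * (e' k)\<^sup>2)" for k
  define Q where "Q k A B C \<longleftrightarrow> phi (e k) (a k) (b k) - phi (e' k) (a' k) (b' k)
        = A * (a k - a' k) + B * (b k - b' k) + C * (e k - e' k) \<and> A \<le> 0 \<and> B \<le> 0 \<and> A + B \<le> -1/2
        \<and> \<bar>C\<bar> \<le> 2 \<and> A = (a k + a' k) / S k - 1 \<and> B = (b k + b' k) / S k - 1" for k A B C
  have "\<exists>A B C. Q k A B C" for k
    unfolding Q_def S_def by (rule phi_difference[of "e k" "a k" "b k" "e' k" "a' k" "b' k"]) blast
  then have "\<forall>k. \<exists>t. Q k (fst t) (fst (snd t)) (snd (snd t))" by simp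
  from choice[OF this] obtain t where "\<And>k. Q k (fst (t k)) (fst (snd (t k))) (snd (snd (t k)))" by blast
  then obtain A B C where "\<And>k. Q k (A k) (B k) (C k)"
    by (rule that[of "\<lambda>k. fst (t k)" "\<lambda>k. fst (snd (t k))" "\<lambda>k. snd (snd (t k))"])
  then have ABC: "\<And>k. phi (e k) (a k) (b k) - phi (e' k) (a' k) (b' k)
        = A k * (a k - a' k) + B k * (b k - b' k) + C k * (e k - e' k)"
      "\<And>k. A k \<le> 0" "\<And>k. B k \<le> 0" "\<And>k. A k + B k \<le> -1/2" "\<And>k. \<bar>C k\<bar> \<le> 2"
      "\<And>k. A k = (a k + a' k) / S k - 1" "\<And>k. B k = (b k + b' k) / S k - 1"
    unfolding Q_def by blast+
  define x where "x k = (a k - a' k) / s k" for k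
  define y where "y k = (b k - b' k) / s k" for k
  have x: "x \<longlonglongrightarrow> da" and y: "y \<longlonglongrightarrow> db" using da db by (simp_all add: x_def[abs_def] y_def[abs_def])
  have "(\<lambda>k. C k * ((e k - e' k) / s k)) \<longlonglongrightarrow> 0"
  proof (rule Lim_null_comparison)
    show "eventually (\<lambda>k. norm (C k * ((e k - e' k) / s k)) \<le> 2 * \<bar>(e k - e' k) / s k\<bar>) sequentially"
      using ABC(5) by (intro always_eventually) (auto simp only: real_norm_def abs_mult intro!: mult_right_mono)
    show "(\<lambda>k. 2 * \<bar>(e k - e' k) / s k\<bar>) \<longlonglongrightarrow> 0"
      using tendsto_mult_right_zero[OF tendsto_rabs_zero[OF de]] by simp
  qed
  from tendsto_diff[OF phi this]
  have lim: "(\<lambda>k. A k * x k + B k * y k) \<longlonglongrightarrow> 0"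
    by (simp add: ABC(1) x_def y_def add_divide_distrib)
  have SL: "S \<longlonglongrightarrow> 2 * (\<alpha> + \<beta>)"
  proof -
    have "S \<longlonglongrightarrow> sqrt (\<alpha>\<^sup>2 + \<beta>\<^sup>2 + 2 * 0\<^sup>2) + sqrt (\<alpha>\<^sup>2 + \<beta>\<^sup>2 + 2 * 0\<^sup>2)"
      unfolding S_def[abs_def] by (intro tendsto_intros a b e)
    moreover have "\<alpha>\<^sup>2 + \<beta>\<^sup>2 + 2 * 0\<^sup>2 = (\<alpha> + \<beta>)\<^sup>2" using sol(3) by (simp add: power2_eq_square algebra_simps)
    ultimately show ?thesis using sol by simp
  qed
  show "db = 0" if "\<alpha> > 0"
  proof -
    have \<beta>: "\<beta> = 0" using that sol by simp
    have "A \<longlonglongrightarrow> (\<alpha> + \<alpha>) / (2 * (\<alpha> + \<beta>)) - 1" unfolding ABC(6)[abs_def]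
      by (intro tendsto_intros a SL) (use that \<beta> in auto)
    moreover have "B \<longlonglongrightarrow> (\<beta> + \<beta>) / (2 * (\<alpha> + \<beta>)) - 1" unfolding ABC(7)[abs_def]
      by (intro tendsto_intros b SL) (use that \<beta> in auto)
    ultimately have "(\<lambda>k. A k * x k + B k * y k) \<longlonglongrightarrow> 0 * da + (-1) * db"
      using that \<beta> by (intro tendsto_intros x y) auto
    with lim LIMSEQ_unique show "db = 0" by fastforce
  qed
  show "da = 0" if "\<beta> > 0"
  proof -
    have \<alpha>: "\<alpha> = 0" using that sol by simp
    have "A \<longlonglongrightarrow> (\<alpha> + \<alpha>) / (2 * (\<alpha> + \<beta>)) - 1" unfolding ABC(6)[abs_def]
      by (intro tendsto_intros a SL) (use that \<alpha> in auto)
    moreover have "B \<longlonglongrightarrow> (\<beta> + \<beta>) / (2 * (\<alpha> + \<beta>)) - 1" unfolding ABC(7)[abs_def]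
      by (intro tendsto_intros b SL) (use that \<alpha> in auto)
    ultimately have "(\<lambda>k. A k * x k + B k * y k) \<longlonglongrightarrow> (-1) * da + 0 * db"
      using that \<alpha> by (intro tendsto_intros x y) auto
    with lim LIMSEQ_unique show "da = 0" by fastforce
  qed
  show "da * db \<le> 0"
  proof (rule ccontr)
    assume "\<not> da * db \<le> 0"
    then have "0 < da * db" by simp
    then consider "da > 0" "db > 0" | "da < 0" "db < 0" by (auto simp: zero_less_mult_iff)
    then show False
    proof cases
      case 1
      \<comment> \<open>Both quotients eventually exceed half of the smaller limit. As the
        coefficients are nonpositive with sum at most -1/2, the combination then stays below
        \<open>- c / 2\<close>.\<close>
      define c where "c = min da db / 2"
      have c: "c > 0" "c < da" "c < db" using 1 by (auto simp: c_def min_def)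
      have "eventually (\<lambda>k. c < x k) sequentially" "eventually (\<lambda>k. c < y k) sequentially"
        using order_tendstoD(1)[OF x] order_tendstoD(1)[OF y] c by auto
      then have "eventually (\<lambda>k. A k * x k + B k * y k \<le> - c / 2) sequentially"
      proof eventually_elim
        case (elim k)
        have "A k * x k \<le> A k * c" "B k * y k \<le> B k * c"
          using elim ABC(2,3)[of k] by (auto intro!: mult_left_mono_neg)
        moreover have "(A k + B k) * c \<le> (-1/2) * c" using ABC(4)[of k] c by (intro mult_right_mono) auto
        ultimately show ?case by (simp add: algebra_simps)
      qed
      from tendsto_upperbound[OF lim this] c show False by simp
    next
      case 2
      define c where "c = max da db / 2"
      have c: "c < 0" "da < c" "db < c" using 2 by (auto simp: c_def max_def)
      have "eventually (\<lambda>k. x k < c) sequentially" "eventually (\<lambda>k. y k < c) sequentially"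
        using order_tendstoD(2)[OF x] order_tendstoD(2)[OF y] c by auto
      then have "eventually (\<lambda>k. - c / 2 \<le> A k * x k + B k * y k) sequentially"
      proof eventually_elim
        case (elim k)
        have "A k * c \<le> A k * x k" "B k * c \<le> B k * y k"
          using elim ABC(2,3)[of k] by (auto intro!: mult_left_mono_neg)
        moreover have "(-1/2) * c \<le> (A k + B k) * c" using ABC(4)[of k] c by (intro mult_right_mono_neg) auto
        ultimately show ?case by (simp add: algebra_simps)
      qed
      from tendsto_lowerbound[OF lim this] c show False by simp
    qed
  qed
qed

section \<open>Variational inequalities over convex sets with nonconvex constraints\<close>

text \<open>The vector is sought in the span of the \<open>a i\<close>; its coefficients then solve
  the Gram system, which is nonsingular by independence.\<close>

lemma dual_vector_exists:
  fixes a :: "'l::finite \<Rightarrow> 'y::euclidean_space" and t :: "'l \<Rightarrow> real"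
  assumes ind: "\<And>c :: 'l \<Rightarrow> real. (\<Sum>i\<in>A. c i *\<^sub>R a i) = 0 \<Longrightarrow> \<forall>i\<in>A. c i = 0"
  obtains b where "\<And>i. i \<in> A \<Longrightarrow> a i \<bullet> b = t i"
proof -
  define L where "L c = (\<Sum>i\<in>A. c $ i *\<^sub>R a i)" for c :: "real^'l"
  \<comment> \<open>Filling in the identity outside \<open>A\<close> makes the Gram map an
    endomorphism of the whole space, so that injectivity implies surjectivity.\<close>
  define M where "M c = (\<chi> i. if i \<in> A then a i \<bullet> L c else c $ i)" for c :: "real^'l"
  have linL: "linear L" unfolding L_def
    by (intro linearI) (auto simp: scaleR_add_left sum.distrib scaleR_sum_right)
  have linM: "linear M" unfolding M_def
    by (intro linearI) (auto simp: vec_eq_iff linear_add[OF linL] linear_scale[OF linL] inner_add_right)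
  have "inj M" unfolding linear_injective_0[OF linM]
  proof (intro allI impI)
    fix c assume M0: "M c = 0"
    have 1: "a i \<bullet> L c = 0" if "i \<in> A" for i
      using arg_cong[OF M0, of "\<lambda>x. x $ i"] that by (simp add: M_def)
    have 2: "c $ i = 0" if "i \<notin> A" for i
      using arg_cong[OF M0, of "\<lambda>x. x $ i"] that by (simp add: M_def)
    have "L c \<bullet> L c = (\<Sum>i\<in>A. c $ i * (a i \<bullet> L c))" by (simp add: L_def inner_sum_left)
    also have "\<dots> = 0" using 1 by simp
    finally have "(\<Sum>i\<in>A. c $ i *\<^sub>R a i) = 0" by (simp add: L_def)
    from ind[OF this] 2 show "c = 0" by (auto simp: vec_eq_iff)
  qed
  then have "surj M" using linear_injective_imp_surjective[OF linM] by simp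
  then obtain c where c: "M c = (\<chi> i. t i)" by (metis surjD)
  show thesis
  proof (rule that[of "L c"])
    show "a i \<bullet> L c = t i" if "i \<in> A" for i
      using arg_cong[OF c, of "\<lambda>x. x $ i"] that by (simp add: M_def)
  qed
qed

text \<open>The derivative starts at 0 with negative slope, hence is negative just to the right, and
  the mean value theorem hands this sign on to \<open>f\<close>.\<close>

lemma eventually_neg_at_right_second_order:
  fixes f f' :: "real \<Rightarrow> real"
  assumes f: "\<And>s. (f has_real_derivative f' s) (at s)" and f0: "f 0 = 0" "f' 0 = 0"
    and q: "(f' has_real_derivative q) (at 0)" "q < 0"
  shows "eventually (\<lambda>s. f s < 0) (at_right 0)"
proof -
  obtain d where d: "d > 0" "\<And>h. h > 0 \<Longrightarrow> h < d \<Longrightarrow> f' (0 + h) < f' 0"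
    using DERIV_neg_dec_right[OF q] by auto
  have "f s < 0" if s: "0 < s" "s < d" for s
  proof -
    obtain z where z: "z > 0" "z < s" "f s - f 0 = (s - 0) * f' z"
      using MVT2[of 0 s f f'] f s by auto
    then have "f' z < 0" using d(2)[of z] s f0 by simp
    then have "s * f' z < 0" using s by (simp add: mult_pos_neg)
    then show ?thesis using z f0 by simp
  qed
  then show ?thesis using d(1) unfolding eventually_at_right_field by blast
qed

lemma eventually_neg_at_right:
  fixes f :: "real \<Rightarrow> real"
  assumes "(f has_real_derivative q) (at 0)" "q < 0" "f 0 \<le> 0"
  shows "eventually (\<lambda>s. f s < 0) (at_right 0)"
proof -
  obtain d where "d > 0" "\<And>h. h > 0 \<Longrightarrow> h < d \<Longrightarrow> f (0 + h) < f 0"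
    using DERIV_neg_dec_right[OF assms(1,2)] by auto
  then show ?thesis using assms(3) unfolding eventually_at_right_field
    by (intro exI[of _ d]) (auto intro: less_le_trans)
qed

text \<open>
  The individual constraints need not be convex, only the set \<open>K\<close> they cut out. If \<open>f i\<close> curved
  downwards in a direction \<open>d\<close> tangent to its level set, then two points
  \<open>y + s b \<plusminus> s \<kappa> d\<close>, corrected to second order in \<open>s\<close>, would lie in \<open>K\<close>
  while their midpoint would not.
\<close>

lemma convex_constraint_curvature:
  fixes f :: "'l::finite \<Rightarrow> 'y::euclidean_space \<Rightarrow> real" and a :: "'l \<Rightarrow> 'y \<Rightarrow> 'y"
  assumes conv: "convex {y. \<forall>i. f i y \<le> 0}"
    and y: "\<And>j. f j y \<le> 0"
    and fd: "\<And>i v. (f i has_derivative (\<lambda>h. a i v \<bullet> h)) (at v)"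
    and i: "f i y = 0"
    and ad: "(a i has_derivative a') (at y)"
    and ind: "\<And>c :: 'l \<Rightarrow> real. (\<Sum>i | f i y = 0. c i *\<^sub>R a i y) = 0 \<Longrightarrow> \<forall>i\<in>{i. f i y = 0}. c i = 0"
    and d: "a i y \<bullet> d = 0"
  shows "a' d \<bullet> d \<ge> 0"
proof (rule ccontr)
  assume "\<not> a' d \<bullet> d \<ge> 0"
  then have neg: "a' d \<bullet> d < 0" by simp
  interpret a': bounded_linear a' using ad by (rule has_derivative_bounded_linear)
  \<comment> \<open>To first order \<open>b\<close> keeps constraint \<open>i\<close> at its level
    and pushes every other active constraint strictly inside.\<close>
  obtain b where b: "\<And>j. j \<in> {j. f j y = 0} \<Longrightarrow> a j y \<bullet> b = (if j = i then 0 else -1)"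
    using dual_vector_exists[where A = "{i. f i y = 0}" and a = "\<lambda>i. a i y", OF ind, where t = "\<lambda>j. if j = i then 0 else -1"] by auto
  \<comment> \<open>The unit slope of \<open>c\<close> against \<open>a i y\<close> lets the
    coefficient of \<open>s\<^sup>2\<close> adjust the second derivative of \<open>f i\<close> at
    will.\<close>
  obtain c where c: "\<And>j. j \<in> {j. f j y = 0} \<Longrightarrow> a j y \<bullet> c = 1"
    using dual_vector_exists[where A = "{i. f i y = 0}" and a = "\<lambda>i. a i y", OF ind, where t = "\<lambda>j. 1"] by auto
  \<comment> \<open>Small enough that moving by \<open>\<kappa> *\<^sub>R d\<close> in either
    direction cannot undo the unit decrease along \<open>b\<close> of another active
    constraint.\<close>
  define \<kappa> where "\<kappa> = 1 / (2 * (1 + (\<Sum>j\<in>UNIV. \<bar>a j y \<bullet> d\<bar>)))"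
  have S0: "(\<Sum>j\<in>UNIV. \<bar>a j y \<bullet> d\<bar>) \<ge> 0" by (simp add: sum_nonneg)
  have \<kappa>: "\<kappa> > 0" unfolding \<kappa>_def using add_pos_nonneg[OF zero_less_one S0] by simp
  have \<kappa>d: "\<kappa> * \<bar>a j y \<bullet> d\<bar> < 1" for j
  proof -
    have "\<bar>a j y \<bullet> d\<bar> \<le> (\<Sum>j\<in>UNIV. \<bar>a j y \<bullet> d\<bar>)" by (intro member_le_sum) auto
    with S0 show ?thesis by (simp add: \<kappa>_def field_simps)
  qed
  \<comment> \<open>\<eta> cancels the mixed terms, which are odd in \<sigma>, and \<beta> cancels
    the pure \<open>b\<close> term. What remains of the second derivative is
    \<open>\<sigma>\<^sup>2 - 1/2\<close> times a negative number: negative at the endpoints,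
    positive at the midpoint.\<close>
  define \<eta> where "\<eta> = - \<kappa> * (a' b \<bullet> d + a' d \<bullet> b) / 2"
  define \<beta> where "\<beta> = - (a' b \<bullet> b) / 2 - \<kappa>\<^sup>2 * (a' d \<bullet> d) / 4"
  define p where "p \<sigma> s = y + s *\<^sub>R (b + (\<sigma> * \<kappa>) *\<^sub>R d) + s\<^sup>2 *\<^sub>R ((\<beta> + \<sigma> * \<eta>) *\<^sub>R c)" for \<sigma> s :: real
  define p' where "p' \<sigma> s = (b + (\<sigma> * \<kappa>) *\<^sub>R d) + (2 * s) *\<^sub>R ((\<beta> + \<sigma> * \<eta>) *\<^sub>R c)" for \<sigma> s :: real
  have pd: "(p \<sigma> has_vector_derivative p' \<sigma> s) (at s)" for \<sigma> s
    unfolding p_def p'_def by (auto intro!: derivative_eq_intros simp: algebra_simps)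
  have p0: "p \<sigma> 0 = y" for \<sigma> by (simp add: p_def)
  have fp: "((\<lambda>s. f j (p \<sigma> s)) has_real_derivative (a j (p \<sigma> s) \<bullet> p' \<sigma> s)) (at s)" for j \<sigma> s
  proof -
    have "((\<lambda>s. f j (p \<sigma> s)) has_vector_derivative a j (p \<sigma> s) \<bullet> p' \<sigma> s) (at s)"
      using vector_derivative_diff_chain_within[OF pd[of \<sigma> s], of "f j"] fd[of j "p \<sigma> s"]
      by (simp add: o_def has_derivative_at_withinI)
    then show ?thesis by (simp add: has_real_derivative_iff_has_vector_derivative)
  qed
  define q where "q \<sigma> = a' (b + (\<sigma> * \<kappa>) *\<^sub>R d) \<bullet> (b + (\<sigma> * \<kappa>) *\<^sub>R d) + 2 * (\<beta> + \<sigma> * \<eta>)" for \<sigma>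
  have ap: "((\<lambda>s. a i (p \<sigma> s) \<bullet> p' \<sigma> s) has_real_derivative q \<sigma>) (at 0)" for \<sigma>
  proof -
    have "((\<lambda>s. a i (p \<sigma> s)) has_vector_derivative a' (p' \<sigma> 0)) (at 0)"
      using vector_derivative_diff_chain_within[OF pd[of \<sigma> 0], of "a i" a'] ad
      by (simp add: o_def p0 has_derivative_at_withinI)
    moreover have "(p' \<sigma> has_vector_derivative (2 * (\<beta> + \<sigma> * \<eta>)) *\<^sub>R c) (at 0)"
      unfolding p'_def by (auto intro!: derivative_eq_intros)
    ultimately have "((\<lambda>s. a i (p \<sigma> s) \<bullet> p' \<sigma> s) has_vector_derivative
        a i (p \<sigma> 0) \<bullet> ((2 * (\<beta> + \<sigma> * \<eta>)) *\<^sub>R c) + a' (p' \<sigma> 0) \<bullet> p' \<sigma> 0) (at 0)"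
      by (rule bounded_bilinear.has_vector_derivative[OF bounded_bilinear_inner])
    moreover have "p' \<sigma> 0 = b + (\<sigma> * \<kappa>) *\<^sub>R d" by (simp add: p'_def)
    ultimately show ?thesis using c[of i] i
      by (simp add: has_real_derivative_iff_has_vector_derivative q_def p0 add.commute)
  qed
  have q_eq: "q \<sigma> = \<sigma>\<^sup>2 * (\<kappa>\<^sup>2 * (a' d \<bullet> d)) - \<kappa>\<^sup>2 * (a' d \<bullet> d) / 2" for \<sigma>
    unfolding q_def \<eta>_def \<beta>_def
    by (simp add: a'.add a'.scaleR inner_add_left inner_add_right power2_eq_square field_simps)
  have z: "a i (p \<sigma> 0) \<bullet> p' \<sigma> 0 = 0" for \<sigma>
    using b[of i] i d by (simp add: p0 p'_def inner_add_right)
  have kneg: "\<kappa>\<^sup>2 * (a' d \<bullet> d) < 0" using neg \<kappa> by (simp add: mult_pos_neg)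
  have ev: "eventually (\<lambda>s. f j (p \<sigma> s) < 0) (at_right 0)" if \<sigma>: "\<sigma> \<in> {-1, 1}" for \<sigma> j
  proof -
    consider "j = i" | "j \<noteq> i" "f j y = 0" | "f j y < 0" using y[of j] by linarith
    then show ?thesis
    proof cases
      case 1
      have "q \<sigma> < 0" using \<sigma> kneg by (auto simp: q_eq mult.commute)
      then show ?thesis unfolding 1
        by (intro eventually_neg_at_right_second_order[OF fp _ z ap]) (simp_all add: p0 i)
    next
      case 2
      have "\<sigma> * \<kappa> * (a j y \<bullet> d) \<le> \<kappa> * \<bar>a j y \<bullet> d\<bar>" using \<sigma> \<kappa>
        by (auto simp: mult_left_mono minus_mult_right simp del: mult_minus_right)
      then have "a j (p \<sigma> 0) \<bullet> p' \<sigma> 0 < 0"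
        using b[of j] 2 \<kappa>d[of j] by (simp add: p0 p'_def inner_add_right)
      then show ?thesis
        by (intro eventually_neg_at_right[OF fp]) (simp_all add: p0 2)
    next
      case 3
      have "isCont (\<lambda>s. f j (p \<sigma> s)) 0" using fp by (rule DERIV_isCont)
      then have "((\<lambda>s. f j (p \<sigma> s)) \<longlongrightarrow> f j y) (at_right 0)"
        unfolding isCont_def p0 by (rule tendsto_mono[OF at_le, rotated]) auto
      then show ?thesis using 3 by (rule order_tendstoD)
    qed
  qed
  have ev0: "eventually (\<lambda>s. - f i (p 0 s) < 0) (at_right 0)"
  proof (rule eventually_neg_at_right_second_order)
    show "((\<lambda>s. - f i (p 0 s)) has_real_derivative - (a i (p 0 s) \<bullet> p' 0 s)) (at s)" for s
      by (rule DERIV_minus[OF fp])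
    show "((\<lambda>s. - (a i (p 0 s) \<bullet> p' 0 s)) has_real_derivative - q 0) (at 0)"
      by (rule DERIV_minus[OF ap])
    show "- q 0 < 0" using kneg by (simp add: q_eq mult.commute)
  qed (use i z in \<open>simp_all add: p0\<close>)
  have "eventually (\<lambda>s. (\<forall>j. f j (p 1 s) < 0) \<and> (\<forall>j. f j (p (-1) s) < 0) \<and> - f i (p 0 s) < 0) (at_right (0::real))"
    using ev ev0 by (auto intro!: eventually_conj eventually_all_finite)
  then obtain s where s: "\<forall>j. f j (p 1 s) < 0" "\<forall>j. f j (p (-1) s) < 0" "- f i (p 0 s) < 0"
    using eventually_happens'[of "at_right (0::real)"] trivial_limit_at_right_real by blast
  have "p 0 s = (1/2) *\<^sub>R p 1 s + (1/2) *\<^sub>R p (-1) s"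
    unfolding p_def by (simp add: algebra_simps flip: scaleR_add_left)
  also have "\<dots> \<in> {y. \<forall>i. f i y \<le> 0}"
    by (rule convexD[OF conv]) (use s in \<open>auto intro: less_imp_le\<close>)
  finally have "f i (p 0 s) \<le> 0" by simp
  with s(3) show False by linarith
qed

text \<open>The solutions are the fixed points of projecting \<open>y - G y\<close> onto
  \<open>K\<close>, since the residual at a closest point makes no acute angle with a direction into
  \<open>K\<close>.\<close>

lemma variational_inequality_exists:
  fixes G :: "'y::euclidean_space \<Rightarrow> 'y"
  assumes K: "compact K" "convex K" "K \<noteq> {}" and G: "continuous_on K G"
  obtains y where "y \<in> K" "\<And>v. v \<in> K \<Longrightarrow> G y \<bullet> (v - y) \<ge> 0"
proof -
  have cl: "closed K" using K by (simp add: compact_imp_closed)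
  obtain y where y: "y \<in> K" "closest_point K (y - G y) = y"
  proof (rule brouwer[of K "\<lambda>y. closest_point K (y - G y)"])
    show "continuous_on K (\<lambda>y. closest_point K (y - G y))"
      by (rule continuous_on_compose2[OF continuous_on_closest_point[OF K(2) cl K(3), of UNIV]])
         (auto intro!: continuous_intros G)
  qed (use K cl closest_point_in_set in auto)
  show thesis
  proof (rule that[OF y(1)])
    fix v assume "v \<in> K"
    from closest_point_dot[OF K(2) cl this, of "y - G y"] y(2) show "G y \<bullet> (v - y) \<ge> 0"
      by (simp add: inner_diff_left)
  qed
qed

text \<open>The inequality is known at feasible points only, so it is first obtained for directions
  strictly decreasing all active constraints, along which short steps stay feasible. A perturbation
  extends it to the linearized cone, and duality to that cone yields the multipliers.\<close>

lemma kkt_multipliers_exist: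
  fixes f :: "'l::finite \<Rightarrow> 'y::euclidean_space \<Rightarrow> real" and a :: "'l \<Rightarrow> 'y"
  assumes vi: "\<And>v. (\<And>i. f i v \<le> 0) \<Longrightarrow> w \<bullet> (v - y) \<ge> 0"
    and y: "\<And>i. f i y \<le> 0"
    and fd: "\<And>i. (f i has_derivative (\<lambda>h. a i \<bullet> h)) (at y)"
    and ind: "\<And>c :: 'l \<Rightarrow> real. (\<Sum>i | f i y = 0. c i *\<^sub>R a i) = 0 \<Longrightarrow> \<forall>i\<in>{i. f i y = 0}. c i = 0"
  obtains \<mu> :: "'l \<Rightarrow> real" where "\<And>i. \<mu> i \<ge> 0" "\<And>i. f i y < 0 \<Longrightarrow> \<mu> i = 0" "w + (\<Sum>i\<in>UNIV. \<mu> i *\<^sub>R a i) = 0"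
proof -
  define A where "A = {i. f i y = 0}"
  have ind: "\<And>c :: 'l \<Rightarrow> real. (\<Sum>i\<in>A. c i *\<^sub>R a i) = 0 \<Longrightarrow> \<forall>i\<in>A. c i = 0"
    unfolding A_def by (rule ind)
  have strict: "w \<bullet> d \<ge> 0" if d: "\<And>i. i \<in> A \<Longrightarrow> a i \<bullet> d < 0" for d
  proof -
    have "eventually (\<lambda>s. f i (y + s *\<^sub>R d) < 0) (at_right 0)" for i
    proof -
      have D: "((\<lambda>s. f i (y + s *\<^sub>R d)) has_real_derivative a i \<bullet> d) (at 0)"
      proof -
        have "((\<lambda>s. y + s *\<^sub>R d) has_vector_derivative d) (at 0)"
          by (auto intro!: derivative_eq_intros)
        from vector_derivative_diff_chain_within[OF this, of "f i" "\<lambda>h. a i \<bullet> h"] fd[of i]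
        show ?thesis
          by (simp add: has_real_derivative_iff_has_vector_derivative o_def has_derivative_at_withinI)
      qed
      show ?thesis
      proof (cases "i \<in> A")
        case True
        then show ?thesis using d[OF True]
          by (intro eventually_neg_at_right[OF D]) (auto simp: A_def)
      next
        case False
        then have "f i (y + 0 *\<^sub>R d) < 0" using y[of i] by (simp add: A_def)
        moreover have "((\<lambda>s. f i (y + s *\<^sub>R d)) \<longlongrightarrow> f i (y + 0 *\<^sub>R d)) (at_right 0)"
          using DERIV_isCont[OF D] unfolding isCont_def by (rule tendsto_mono[OF at_le, rotated]) auto
        ultimately show ?thesis by (metis order_tendstoD(2))
      qed
    qed
    then have "eventually (\<lambda>s. (\<forall>i. f i (y + s *\<^sub>R d) < 0) \<and> s > 0) (at_right (0::real))"
      by (intro eventually_conj eventually_all_finite eventually_at_right_less) auto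
    then obtain s where s: "\<forall>i. f i (y + s *\<^sub>R d) < 0" "s > 0"
      using eventually_happens'[of "at_right (0::real)"] trivial_limit_at_right_real by blast
    have "w \<bullet> (y + s *\<^sub>R d - y) \<ge> 0" by (rule vi) (use s in \<open>auto intro: less_imp_le\<close>)
    then show ?thesis using s by (simp add: zero_le_mult_iff)
  qed
  \<comment> \<open>Independence provides a direction strictly into all active constraints at once,
    as in the Mangasarian-Fromovitz condition.\<close>
  obtain b where b: "\<And>i. i \<in> A \<Longrightarrow> a i \<bullet> b = -1"
    using dual_vector_exists[where A = A and a = a and t = "\<lambda>_. -1"] ind by metis
  have weak: "w \<bullet> d \<ge> 0" if d: "\<And>i. i \<in> A \<Longrightarrow> a i \<bullet> d \<le> 0" for d
  proof (rule ccontr)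
    assume "\<not> w \<bullet> d \<ge> 0"
    \<comment> \<open>Adding \<open>s *\<^sub>R b\<close> makes \<open>d\<close> strictly admissible
      and raises \<open>w \<bullet> d\<close> by at most half of its absolute value, so it stays
      negative.\<close>
    define s where "s = - (w \<bullet> d) / (2 * (1 + \<bar>w \<bullet> b\<bar>))"
    have s: "s > 0" unfolding s_def using \<open>\<not> w \<bullet> d \<ge> 0\<close>
      by (intro divide_pos_pos) auto
    have "w \<bullet> (d + s *\<^sub>R b) \<ge> 0"
      by (rule strict) (use d b s in \<open>auto simp: inner_add_right intro: le_less_trans\<close>)
    moreover have "s * (w \<bullet> b) \<le> s * (1 + \<bar>w \<bullet> b\<bar>)" using s by (intro mult_left_mono) auto
    moreover have "s * (1 + \<bar>w \<bullet> b\<bar>) = - (w \<bullet> d) / 2" by (simp add: s_def field_simps)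
    ultimately show False using \<open>\<not> w \<bullet> d \<ge> 0\<close> by (simp add: inner_add_right)
  qed
  have "w \<in> span (a ` A)"
  proof -
    obtain u v where uv: "u \<in> span (a ` A)" "\<And>x. x \<in> span (a ` A) \<Longrightarrow> orthogonal v x" "w = u + v"
      using orthogonal_subspace_decomp_exists[of "a ` A" w] by metis
    \<comment> \<open>\<open>v\<close> is the part of \<open>w\<close> orthogonal to all active
      gradients, so \<open>- v\<close> is admissible and the inequality forces
      \<open>v = 0\<close>.\<close>
    have v0: "a i \<bullet> v = 0" if "i \<in> A" for i
      using uv(2)[of "a i"] that by (simp add: orthogonal_def span_base inner_commute)
    have "w \<bullet> (- v) \<ge> 0" by (rule weak) (simp add: v0)
    moreover have "u \<bullet> v = 0" using uv(2)[OF uv(1)] by (simp add: orthogonal_def inner_commute)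
    ultimately have "v \<bullet> v \<le> 0" using uv(3) by (simp add: inner_add_left)
    then have "v = 0" by (metis inner_gt_zero_iff not_less)
    with uv show ?thesis by simp
  qed
  then have "- w \<in> span (a ` A)" by (rule span_neg)
  then obtain u where u: "- w = (\<Sum>i\<in>A. u i *\<^sub>R a i)"
  proof -
    assume *: "\<And>u. - w = (\<Sum>i\<in>A. u i *\<^sub>R a i) \<Longrightarrow> thesis"
    \<comment> \<open>Elements of the span come with coefficients on vectors rather than on indices;
      independence rules out repeated vectors, so the sum can be reindexed.\<close>
    have inj: "inj_on a A"
    proof (rule inj_onI, rule ccontr)
      fix i j assume ij: "i \<in> A" "j \<in> A" "a i = a j" "i \<noteq> j"
      define c where "c k = (if k = i then 1 else if k = j then -1 else (0::real))" for k
      have "(\<Sum>k\<in>A. c k *\<^sub>R a k) = (\<Sum>k\<in>{i,j}. c k *\<^sub>R a k)"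
        by (rule sum.mono_neutral_right) (use ij in \<open>auto simp: c_def\<close>)
      also have "\<dots> = 0" using ij by (simp add: c_def)
      finally have "c i = 0" using ind[of c] ij by blast
      then show False by (simp add: c_def)
    qed
    from \<open>- w \<in> span (a ` A)\<close> obtain r where "- w = (\<Sum>v\<in>a ` A. r v *\<^sub>R v)"
      by (auto simp: span_finite)
    also have "\<dots> = (\<Sum>i\<in>A. r (a i) *\<^sub>R a i)" using inj by (simp add: sum.reindex)
    finally show thesis by (rule *)
  qed
  have u0: "u i \<ge> 0" if i: "i \<in> A" for i
  proof -
    \<comment> \<open>Dual to the active gradients, \<open>c\<close> isolates one coefficient:
      \<open>w \<bullet> c = u i\<close>.\<close>
    obtain c where c: "\<And>j. j \<in> A \<Longrightarrow> a j \<bullet> c = (if j = i then -1 else 0)"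
      using dual_vector_exists[where A = A and a = a and t = "\<lambda>j. if j = i then -1 else 0"] ind by metis
    have "w \<bullet> c \<ge> 0" by (rule weak) (simp add: c)
    moreover have "- w \<bullet> c = (\<Sum>j\<in>A. u j * (if j = i then -1 else 0))"
      unfolding u inner_sum_left by (rule sum.cong) (auto simp: c)
    moreover have "\<dots> = - u i" using i by (simp add: if_distrib[of "\<lambda>x. _ * x"] cong: if_cong)
    ultimately show ?thesis by simp
  qed
  show thesis
  proof (rule that[of "\<lambda>i. if i \<in> A then u i else 0"])
    have "(\<Sum>i\<in>UNIV. (if i \<in> A then u i else 0) *\<^sub>R a i) = (\<Sum>i\<in>A. u i *\<^sub>R a i)"
      by (rule sum.mono_neutral_cong_right) auto
    then show "w + (\<Sum>i\<in>UNIV. (if i \<in> A then u i else 0) *\<^sub>R a i) = 0" using u by (metis add.right_inverse)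
  qed (use u0 in \<open>auto simp: A_def\<close>)
qed

section \<open>The solution map of the smoothed system\<close>

text \<open>One system for all followers together. Convexity and compactness are required for every
  parameter because the solution map lives on a full neighbourhood of a point of \<open>X\<close>,
  which may reach outside \<open>X\<close>; \<open>independent\<close> is applied at that point
  itself.\<close>

locale follower_system =
  fixes G :: "'x::euclidean_space \<times> 'y::euclidean_space \<Rightarrow> 'y"
    and g :: "'l::finite \<Rightarrow> 'x \<times> 'y \<Rightarrow> real"
    and a :: "'l \<Rightarrow> 'x \<times> 'y \<Rightarrow> 'y"
    and G' :: "'x \<times> 'y \<Rightarrow> 'x \<times> 'y \<Rightarrow> 'y"
    and g' :: "'l \<Rightarrow> 'x \<times> 'y \<Rightarrow> 'x \<times> 'y \<Rightarrow> real"
    and a' :: "'l \<Rightarrow> 'x \<times> 'y \<Rightarrow> 'x \<times> 'y \<Rightarrow> 'y"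
    and X :: "'x set"
  assumes G_strict: "strict_derivative G (G' p) p"
    and g_strict: "strict_derivative (g i) (g' i p) p"
    and a_strict: "strict_derivative (a i) (a' i p) p"
    and g'_eq: "g' i p (0, h) = a i p \<bullet> h"
    and pos_def: "h \<noteq> 0 \<Longrightarrow> h \<bullet> G' p (0, h) > 0"
    and feasible_nonempty: "{y. \<forall>i. g i (x, y) \<le> 0} \<noteq> {}"
    and feasible_convex: "convex {y. \<forall>i. g i (x, y) \<le> 0}"
    and feasible_compact: "compact {y. \<forall>i. g i (x, y) \<le> 0}"
    and independent: "x \<in> X \<Longrightarrow> \<forall>i. g i (x, y) \<le> 0 \<Longrightarrow>
      (\<Sum>i | g i (x, y) = 0. c i *\<^sub>R a i (x, y)) = 0 \<Longrightarrow> \<forall>i\<in>{i. g i (x, y) = 0}. c i = 0"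
begin

definition residual :: "real \<Rightarrow> 'x \<Rightarrow> 'y \<times> (real^'l) \<times> (real^'l) \<Rightarrow> 'y \<times> (real^'l) \<times> (real^'l)" where
  "residual \<epsilon> x = (\<lambda>(y, z, \<mu>). (G (x, y) + (\<Sum>i\<in>UNIV. \<mu> $ i *\<^sub>R a i (x, y)),
     (\<chi> i. g i (x, y)) + z, \<chi> i. phi \<epsilon> (\<mu> $ i) (z $ i)))"

definition lifted :: "real \<times> 'x \<times> 'y \<times> (real^'l) \<times> (real^'l) \<Rightarrow> real \<times> 'x \<times> 'y \<times> (real^'l) \<times> (real^'l)" where
  "lifted = (\<lambda>(\<epsilon>, x, w). (\<epsilon>, x, residual \<epsilon> x w))"

lemma residual_eq_0_iff:
  "residual \<epsilon> x (y, z, \<mu>) = 0 \<longleftrightarrow> G (x, y) + (\<Sum>i\<in>UNIV. \<mu> $ i *\<^sub>R a i (x, y)) = 0 \<and>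
     (\<forall>i. z $ i = - g i (x, y)) \<and> (\<forall>i. \<mu> $ i \<ge> 0 \<and> z $ i \<ge> 0 \<and> \<mu> $ i * z $ i = \<epsilon>\<^sup>2)"
proof -
  have "u + v = 0 \<longleftrightarrow> v = - u" for u v :: real by linarith
  then have "(\<chi> i. g i (x, y)) + z = 0 \<longleftrightarrow> (\<forall>i. z $ i = - g i (x, y))" by (simp add: vec_eq_iff)
  moreover have "(\<chi> i. phi \<epsilon> (\<mu> $ i) (z $ i)) = 0 \<longleftrightarrow> (\<forall>i. \<mu> $ i \<ge> 0 \<and> z $ i \<ge> 0 \<and> \<mu> $ i * z $ i = \<epsilon>\<^sup>2)"
    by (simp add: vec_eq_iff phi_eq_0_iff)
  ultimately show ?thesis by (simp only: residual_def zero_prod_def prod.case prod.inject)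
qed

section \<open>Existence and uniqueness at smoothing parameter 0\<close>

lemma isCont_G: "isCont G p" and isCont_g: "isCont (g i) p" and isCont_a: "isCont (a i) p"
  using G_strict g_strict a_strict strict_derivative_imp_isCont by blast+

lemma partial_derivative:
  assumes "(F has_derivative F') (at (x, y))"
  shows "((\<lambda>y. F (x, y)) has_derivative (\<lambda>h. F' (0, h))) (at y)"
proof -
  have "((\<lambda>y. (x, y)) has_derivative (\<lambda>h. (0, h))) (at y)"
    by (auto intro!: derivative_eq_intros)
  from has_derivative_compose[OF this, of F F'] assms show ?thesis by simp
qed

lemma g_partial: "((\<lambda>y. g i (x, y)) has_derivative (\<lambda>h. a i (x, y) \<bullet> h)) (at y)"
  using partial_derivative[OF strict_derivative_imp_has_derivative[OF g_strict]] by (simp add: g'_eq)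

lemma G_strictly_monotone:
  assumes "y \<noteq> v" shows "(G (x, y) - G (x, v)) \<bullet> (y - v) > 0"
proof -
  define h where "h = y - v"
  have h: "h \<noteq> 0" using assms by (simp add: h_def)
  have D: "((\<lambda>t. G (x, v + t *\<^sub>R h) \<bullet> h) has_real_derivative (G' (x, v + t *\<^sub>R h) (0, h) \<bullet> h)) (at t)" for t
  proof -
    have "((\<lambda>t. v + t *\<^sub>R h) has_vector_derivative h) (at t)"
      by (auto intro!: derivative_eq_intros)
    from vector_derivative_diff_chain_within[OF this has_derivative_at_withinI
        [OF partial_derivative[OF strict_derivative_imp_has_derivative[OF G_strict]]]]
    have "((\<lambda>t. G (x, v + t *\<^sub>R h)) has_vector_derivative G' (x, v + t *\<^sub>R h) (0, h)) (at t)"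
      by (simp add: o_def)
    from bounded_linear.has_vector_derivative[OF bounded_linear_inner_left this]
    show ?thesis by (simp add: has_real_derivative_iff_has_vector_derivative)
  qed
  obtain z where "G (x, v + 1 *\<^sub>R h) \<bullet> h - G (x, v + 0 *\<^sub>R h) \<bullet> h = (1 - 0) * (G' (x, v + z *\<^sub>R h) (0, h) \<bullet> h)"
    using MVT2[OF zero_less_one, of "\<lambda>t. G (x, v + t *\<^sub>R h) \<bullet> h" "\<lambda>t. G' (x, v + t *\<^sub>R h) (0, h) \<bullet> h"] D
    by blast
  moreover have "v + h = y" by (simp add: h_def)
  ultimately have "(G (x, y) - G (x, v)) \<bullet> h = h \<bullet> G' (x, v + z *\<^sub>R h) (0, h)"
    by (simp add: inner_diff_left inner_diff_right inner_commute)
  with pos_def[OF h] show ?thesis by (simp add: h_def)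
qed

lemma residual_0_exists:
  assumes "x \<in> X" obtains w where "residual 0 x w = 0"
proof -
  have "continuous_on UNIV (\<lambda>y. G (x, y))"
    by (rule continuous_on_compose2[of UNIV G])
       (auto intro!: continuous_intros continuous_at_imp_continuous_on isCont_G)
  then have cont: "continuous_on {y. \<forall>i. g i (x, y) \<le> 0} (\<lambda>y. G (x, y))"
    by (rule continuous_on_subset) simp
  obtain y where y: "\<forall>i. g i (x, y) \<le> 0" "\<And>v. \<forall>i. g i (x, v) \<le> 0 \<Longrightarrow> G (x, y) \<bullet> (v - y) \<ge> 0"
    by (rule variational_inequality_exists[OF feasible_compact feasible_convex feasible_nonempty cont]) blast
  obtain \<mu> where \<mu>: "\<And>i. \<mu> i \<ge> 0" "\<And>i. g i (x, y) < 0 \<Longrightarrow> \<mu> i = 0"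
      "G (x, y) + (\<Sum>i\<in>UNIV. \<mu> i *\<^sub>R a i (x, y)) = 0"
  proof (rule kkt_multipliers_exist[of "\<lambda>i y. g i (x, y)" "G (x, y)" y "\<lambda>i. a i (x, y)"])
    show "\<forall>i\<in>{i. g i (x, y) = 0}. c i = 0" if "(\<Sum>i | g i (x, y) = 0. c i *\<^sub>R a i (x, y)) = 0" for c
      using independent[OF assms y(1) that] .
  qed (use y g_partial in blast)+
  have "\<mu> i * g i (x, y) = 0" for i using \<mu>(2)[of i] y(1) by (metis less_eq_real_def mult_eq_0_iff)
  then have "residual 0 x (y, (\<chi> i. - g i (x, y)), (\<chi> i. \<mu> i)) = 0"
    unfolding residual_eq_0_iff using \<mu> y by auto
  then show thesis by (rule that)
qed

text \<open>An active constraint cannot grow from \<open>y\<close> towards a feasible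
  \<open>v\<close>: it would become positive at once, although the segment lies in the convex
  feasible set. This takes the place of the gradient inequality for convex functions.\<close>

lemma residual_0_imp_variational_inequality:
  assumes sol: "residual 0 x (y, z, \<mu>) = 0" and v: "\<forall>i. g i (x, v) \<le> 0"
  shows "G (x, y) \<bullet> (v - y) \<ge> 0"
proof -
  note s = sol[unfolded residual_eq_0_iff]
  have gy: "g i (x, y) \<le> 0" for i using s by (metis neg_0_le_iff_le)
  have neg: "\<mu> $ i * (a i (x, y) \<bullet> (v - y)) \<le> 0" for i
  proof (cases "\<mu> $ i = 0")
    case False
    then have gi: "g i (x, y) = 0" using s by (metis mult_eq_0_iff neg_equal_0_iff_equal power_zero_numeral)
    have "a i (x, y) \<bullet> (v - y) \<le> 0"
    proof (rule ccontr)
      assume "\<not> ?thesis"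
      moreover have D: "((\<lambda>t. - g i (x, y + t *\<^sub>R (v - y))) has_real_derivative - (a i (x, y) \<bullet> (v - y))) (at 0)"
      proof (rule DERIV_minus)
        have "((\<lambda>t. y + t *\<^sub>R (v - y)) has_vector_derivative (v - y)) (at 0)"
          by (auto intro!: derivative_eq_intros)
        from vector_derivative_diff_chain_within[OF this, of "\<lambda>y. g i (x, y)" "\<lambda>h. a i (x, y) \<bullet> h"]
        show "((\<lambda>t. g i (x, y + t *\<^sub>R (v - y))) has_real_derivative a i (x, y) \<bullet> (v - y)) (at 0)"
          using g_partial[of i x y]
          by (simp add: o_def has_derivative_at_withinI has_real_derivative_iff_has_vector_derivative)
      qed
      ultimately have "eventually (\<lambda>t. - g i (x, y + t *\<^sub>R (v - y)) < 0) (at_right 0)"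
        by (intro eventually_neg_at_right[OF D]) (simp_all add: gi)
      moreover have "eventually (\<lambda>t. t > 0 \<and> t < 1) (at_right (0::real))"
        by (rule eventually_conj) (auto intro: eventually_at_right_less eventually_at_right_real[of 0 1, simplified] 
           eventually_mono[OF eventually_at_right_real[of 0 1]])
      ultimately have "eventually (\<lambda>t. - g i (x, y + t *\<^sub>R (v - y)) < 0 \<and> t > 0 \<and> t < 1) (at_right (0::real))"
        by (rule eventually_conj)
      then obtain t where t: "- g i (x, y + t *\<^sub>R (v - y)) < 0" "t > 0" "t < 1"
        using eventually_happens'[of "at_right (0::real)"] trivial_limit_at_right_real by blast
      have "(1 - t) *\<^sub>R y + t *\<^sub>R v \<in> {y. \<forall>i. g i (x, y) \<le> 0}"
        by (rule convexD[OF feasible_convex]) (use t v gy in auto)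
      moreover have "(1 - t) *\<^sub>R y + t *\<^sub>R v = y + t *\<^sub>R (v - y)" by (simp add: algebra_simps)
      ultimately have "g i (x, y + t *\<^sub>R (v - y)) \<le> 0" by simp
      with t(1) show False by linarith
    qed
    then show ?thesis using s by (simp add: mult_nonneg_nonpos)
  qed simp
  have "G (x, y) = - (\<Sum>i\<in>UNIV. \<mu> $ i *\<^sub>R a i (x, y))" using s by (simp add: eq_neg_iff_add_eq_0)
  then have "G (x, y) \<bullet> (v - y) = - (\<Sum>i\<in>UNIV. \<mu> $ i * (a i (x, y) \<bullet> (v - y)))"
    by (simp add: inner_sum_left)
  with neg show ?thesis by (simp add: sum_nonpos)
qed

lemma residual_0_unique:
  assumes x: "x \<in> X" and sol: "residual 0 x w = 0" "residual 0 x w' = 0"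
  shows "w = w'"
proof -
  obtain y z \<mu> y' z' \<mu>' where w: "w = (y, z, \<mu>)" "w' = (y', z', \<mu>')" by (metis prod.exhaust)
  note s = sol[unfolded w residual_eq_0_iff]
  have gy: "\<forall>i. g i (x, y) \<le> 0" "\<forall>i. g i (x, y') \<le> 0" using s by (metis neg_0_le_iff_le)+
  have "G (x, y) \<bullet> (y' - y) \<ge> 0" "G (x, y') \<bullet> (y - y') \<ge> 0"
    using residual_0_imp_variational_inequality sol gy unfolding w by blast+
  then have "(G (x, y) - G (x, y')) \<bullet> (y - y') \<le> 0"
    by (simp add: inner_diff_left inner_diff_right)
  then have y: "y = y'" using G_strictly_monotone[of y y' x] by (metis not_less)
  have z: "z = z'" using s y by (simp add: vec_eq_iff)
  have m0: "\<mu> $ i = 0" "\<mu>' $ i = 0" if "g i (x, y) \<noteq> 0" for i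
    using s that y by (metis mult_eq_0_iff neg_equal_0_iff_equal power_zero_numeral)+
  \<comment> \<open>Inactive multipliers vanish by complementarity, so the difference of the
    stationarity equations involves active gradients only.\<close>
  have "(\<Sum>i | g i (x, y) = 0. (\<mu> $ i - \<mu>' $ i) *\<^sub>R a i (x, y)) = (\<Sum>i\<in>UNIV. (\<mu> $ i - \<mu>' $ i) *\<^sub>R a i (x, y))"
    by (rule sum.mono_neutral_left) (use m0 in auto)
  also have "\<dots> = 0" using s unfolding y
    by (simp add: scaleR_left_diff_distrib sum_subtractf) (metis add_left_cancel)
  finally have "\<forall>i\<in>{i. g i (x, y) = 0}. \<mu> $ i - \<mu>' $ i = 0" by (rule independent[OF x gy(1)])
  then have "\<mu> = \<mu>'" using m0 by (force simp: vec_eq_iff)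
  with y z show ?thesis by (simp add: w)
qed

section \<open>Expansiveness of the lifted map\<close>

lemma lifted_continuous: "continuous_on UNIV lifted"
proof -
  have comp: "continuous_on UNIV (\<lambda>u. F (xx u, yy u))"
    if "\<And>p. isCont F p" "continuous_on UNIV xx" "continuous_on UNIV yy"
    for F :: "'x \<times> 'y \<Rightarrow> 'z::topological_space" and xx :: "'w::topological_space \<Rightarrow> 'x" and yy
    by (rule continuous_on_compose2[of UNIV F])
       (use that in \<open>auto intro!: continuous_on_Pair continuous_at_imp_continuous_on\<close>)
  show ?thesis
    unfolding lifted_def residual_def phi_def case_prod_unfold
    by (intro continuous_intros comp isCont_G isCont_g isCont_a continuous_on_vec_lambda)
qed

lemma lifted_expansive_near_solution:
  assumes x: "x \<in> X" and sol: "residual 0 x w = 0"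
  obtains r \<delta> where "r > 0" "\<delta> > 0"
    "\<And>u v. u \<in> ball (0, x, w) r \<Longrightarrow> v \<in> ball (0, x, w) r \<Longrightarrow> \<delta> * norm (u - v) \<le> norm (lifted u - lifted v)"
proof -
  obtain y z \<mu> where w: "w = (y, z, \<mu>)" by (metis prod.exhaust)
  note s = sol[unfolded w residual_eq_0_iff]
  have gy: "\<forall>i. g i (x, y) \<le> 0" using s by (metis neg_0_le_iff_le)
  \<comment> \<open>Failure of expansiveness with constant and radius \<open>1 / Suc k\<close>. If
    it occurs for every \<open>k\<close>, it yields two sequences tending to the solution whose
    normalized image differences tend to 0.\<close>
  define P where "P k u v \<longleftrightarrow> u \<in> ball (0, x, w) (1 / Suc k) \<and> v \<in> ball (0, x, w) (1 / Suc k) \<and>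
    norm (lifted u - lifted v) < (1 / Suc k) * norm (u - v)" for k :: nat and u v
  have "\<exists>k. \<forall>u v. \<not> P k u v"
  proof (rule ccontr)
    assume "\<not> ?thesis"
    then obtain U0 V0 where P0: "P k (U0 k) (V0 k)" for k by metis
    define D0 where "D0 k = (U0 k - V0 k) /\<^sub>R norm (U0 k - V0 k)" for k
    have ne0: "norm (U0 k - V0 k) > 0" for k using P0[of k] unfolding P_def by fastforce
    have "D0 k \<in> sphere 0 1" for k using ne0[of k] by (simp add: D0_def)
    then obtain d \<rho> where d: "d \<in> sphere 0 1" "strict_mono \<rho>" "(D0 \<circ> \<rho>) \<longlonglongrightarrow> d"
      using compact_sphere[of 0 1] unfolding compact_def by metis
    define U where "U k = U0 (\<rho> k)" for k
    define V where "V k = V0 (\<rho> k)" for k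
    define N where "N k = norm (U k - V k)" for k
    have N: "N k > 0" for k using ne0 by (simp add: N_def U_def V_def)
    have inv0: "(\<lambda>k. 1 / real (Suc (\<rho> k))) \<longlonglongrightarrow> 0"
      using LIMSEQ_subseq_LIMSEQ[OF lim_inverse_n' d(2)] LIMSEQ_subseq_LIMSEQ[OF LIMSEQ_Suc[OF lim_inverse_n'] d(2)]
      by (simp add: o_def)
    have Ulim: "U \<longlonglongrightarrow> (0, x, w)" "V \<longlonglongrightarrow> (0, x, w)"
      using P0 unfolding P_def U_def[abs_def] V_def[abs_def]
      by (auto simp: dist_commute intro!: metric_tendsto_imp_tendsto[OF inv0] always_eventually less_imp_le)
    have quot: "(\<lambda>k. (U k - V k) /\<^sub>R N k) \<longlonglongrightarrow> d"
      using d(3) by (simp add: D0_def[abs_def] U_def[abs_def] V_def[abs_def] N_def[abs_def] o_def)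
    have "norm ((lifted (U k) - lifted (V k)) /\<^sub>R N k) \<le> 1 / Suc (\<rho> k)" for k
    proof -
      have "norm ((lifted (U k) - lifted (V k)) /\<^sub>R N k) = norm (lifted (U k) - lifted (V k)) / N k"
        using N[of k] by (simp add: divide_inverse mult.commute)
      also have "\<dots> \<le> 1 / Suc (\<rho> k)" unfolding pos_divide_le_eq[OF N]
        using P0[of "\<rho> k"] unfolding P_def U_def V_def N_def by (simp only: less_imp_le)
      finally show ?thesis .
    qed
    then have L0: "(\<lambda>k. (lifted (U k) - lifted (V k)) /\<^sub>R N k) \<longlonglongrightarrow> 0"
      by (intro Lim_null_comparison[OF always_eventually inv0]) auto
    obtain de dx dy dz dm where dd: "d = (de, dx, dy, dz, dm)" by (metis prod.exhaust)
    define eU where "eU k = fst (U k)" for k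
    define xU where "xU k = fst (snd (U k))" for k
    define yU where "yU k = fst (snd (snd (U k)))" for k
    define zU where "zU k = fst (snd (snd (snd (U k))))" for k
    define mU where "mU k = snd (snd (snd (snd (U k))))" for k
    define eV where "eV k = fst (V k)" for k
    define xV where "xV k = fst (snd (V k))" for k
    define yV where "yV k = fst (snd (snd (V k)))" for k
    define zV where "zV k = fst (snd (snd (snd (V k))))" for k
    define mV where "mV k = snd (snd (snd (snd (V k))))" for k
    have UV: "U k = (eU k, xU k, yU k, zU k, mU k)" "V k = (eV k, xV k, yV k, zV k, mV k)" for k
      by (simp_all add: eU_def xU_def yU_def zU_def mU_def eV_def xV_def yV_def zV_def mV_def)
    have lims: "eU \<longlonglongrightarrow> 0" "xU \<longlonglongrightarrow> x" "yU \<longlonglongrightarrow> y" "zU \<longlonglongrightarrow> z" "mU \<longlonglongrightarrow> \<mu>"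
         "eV \<longlonglongrightarrow> 0" "xV \<longlonglongrightarrow> x" "yV \<longlonglongrightarrow> y" "zV \<longlonglongrightarrow> z" "mV \<longlonglongrightarrow> \<mu>"
      using tendsto_fst[OF Ulim(1)]
        tendsto_fst[OF tendsto_snd[OF Ulim(1)]]
        tendsto_fst[OF tendsto_snd[OF tendsto_snd[OF Ulim(1)]]]
        tendsto_fst[OF tendsto_snd[OF tendsto_snd[OF tendsto_snd[OF Ulim(1)]]]]
        tendsto_snd[OF tendsto_snd[OF tendsto_snd[OF tendsto_snd[OF Ulim(1)]]]]
        tendsto_fst[OF Ulim(2)]
        tendsto_fst[OF tendsto_snd[OF Ulim(2)]]
        tendsto_fst[OF tendsto_snd[OF tendsto_snd[OF Ulim(2)]]]
        tendsto_fst[OF tendsto_snd[OF tendsto_snd[OF tendsto_snd[OF Ulim(2)]]]]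
        tendsto_snd[OF tendsto_snd[OF tendsto_snd[OF tendsto_snd[OF Ulim(2)]]]]
      by (simp_all only: UV fst_conv snd_conv w)
    have q: "(\<lambda>k. (eU k - eV k) /\<^sub>R N k) \<longlonglongrightarrow> de" "(\<lambda>k. (xU k - xV k) /\<^sub>R N k) \<longlonglongrightarrow> dx"
       "(\<lambda>k. (yU k - yV k) /\<^sub>R N k) \<longlonglongrightarrow> dy" "(\<lambda>k. (zU k - zV k) /\<^sub>R N k) \<longlonglongrightarrow> dz"
       "(\<lambda>k. (mU k - mV k) /\<^sub>R N k) \<longlonglongrightarrow> dm"
      using tendsto_fst[OF quot] tendsto_fst[OF tendsto_snd[OF quot]]
        tendsto_fst[OF tendsto_snd[OF tendsto_snd[OF quot]]]
        tendsto_fst[OF tendsto_snd[OF tendsto_snd[OF tendsto_snd[OF quot]]]]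
        tendsto_snd[OF tendsto_snd[OF tendsto_snd[OF tendsto_snd[OF quot]]]]
      unfolding dd by (simp_all add: UV)
    \<comment> \<open>The first two components of \<open>lifted\<close> are the identity, so the
      limit direction has no parameter part.\<close>
    have "(\<lambda>k. (eU k - eV k) /\<^sub>R N k) \<longlonglongrightarrow> 0" using tendsto_fst[OF L0] by (simp add: UV lifted_def)
    with q(1) have de: "de = 0" by (rule LIMSEQ_unique)
    have "(\<lambda>k. (xU k - xV k) /\<^sub>R N k) \<longlonglongrightarrow> 0"
      using tendsto_fst[OF tendsto_snd[OF L0]] by (simp add: UV lifted_def)
    with q(2) have dx: "dx = 0" by (rule LIMSEQ_unique)
    define pU where "pU k = (xU k, yU k)" for k
    define pV where "pV k = (xV k, yV k)" for k
    have pl: "pU \<longlonglongrightarrow> (x, y)" "pV \<longlonglongrightarrow> (x, y)"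
      unfolding pU_def[abs_def] pV_def[abs_def] by (intro tendsto_Pair lims)+
    have pq: "(\<lambda>k. (pU k - pV k) /\<^sub>R N k) \<longlonglongrightarrow> (0, dy)"
      using tendsto_Pair[OF q(2,3)] by (simp add: pU_def pV_def dx)
    have Fq: "(\<lambda>k. (F (pU k) - F (pV k)) /\<^sub>R N k) \<longlonglongrightarrow> F' (0, dy)"
      if "strict_derivative F F' (x, y)" for F :: "'x \<times> 'y \<Rightarrow> 'z::real_normed_vector" and F'
      by (rule strict_derivative_quotient_tendsto[OF that pl N pq])
    have aq: "(\<lambda>k. (mU k $ i *\<^sub>R a i (pU k) - mV k $ i *\<^sub>R a i (pV k)) /\<^sub>R N k)
        \<longlonglongrightarrow> \<mu> $ i *\<^sub>R a' i (x, y) (0, dy) + dm $ i *\<^sub>R a i (x, y)" for i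
    proof -
      \<comment> \<open>Discrete product rule: the gradient varies against the multiplier of
        \<open>U\<close>, the multiplier against the gradient at \<open>V\<close>.\<close>
      have "(\<lambda>k. mU k $ i *\<^sub>R ((a i (pU k) - a i (pV k)) /\<^sub>R N k) + ((mU k - mV k) /\<^sub>R N k) $ i *\<^sub>R a i (pV k))
        \<longlonglongrightarrow> \<mu> $ i *\<^sub>R a' i (x, y) (0, dy) + dm $ i *\<^sub>R a i (x, y)"
        by (intro tendsto_intros Fq a_strict lims q isCont_tendsto_compose[OF isCont_a] pl)
      moreover have "mU k $ i *\<^sub>R ((a i (pU k) - a i (pV k)) /\<^sub>R N k) + ((mU k - mV k) /\<^sub>R N k) $ i *\<^sub>R a i (pV k)
        = (mU k $ i *\<^sub>R a i (pU k) - mV k $ i *\<^sub>R a i (pV k)) /\<^sub>R N k" for k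
        by (simp add: algebra_simps)
      ultimately show ?thesis by simp
    qed
    have stat: "G' (x, y) (0, dy) + (\<Sum>i\<in>UNIV. \<mu> $ i *\<^sub>R a' i (x, y) (0, dy) + dm $ i *\<^sub>R a i (x, y)) = 0"
    proof (rule LIMSEQ_unique)
      show "(\<lambda>k. (G (pU k) - G (pV k)) /\<^sub>R N k + (\<Sum>i\<in>UNIV. (mU k $ i *\<^sub>R a i (pU k) - mV k $ i *\<^sub>R a i (pV k)) /\<^sub>R N k))
        \<longlonglongrightarrow> G' (x, y) (0, dy) + (\<Sum>i\<in>UNIV. \<mu> $ i *\<^sub>R a' i (x, y) (0, dy) + dm $ i *\<^sub>R a i (x, y))"
        by (intro tendsto_intros Fq G_strict aq)
      show "(\<lambda>k. (G (pU k) - G (pV k)) /\<^sub>R N k + (\<Sum>i\<in>UNIV. (mU k $ i *\<^sub>R a i (pU k) - mV k $ i *\<^sub>R a i (pV k)) /\<^sub>R N k))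
        \<longlonglongrightarrow> 0"
        using tendsto_fst[OF tendsto_snd[OF tendsto_snd[OF L0]]]
        by (simp add: UV lifted_def residual_def pU_def pV_def scaleR_right_distrib scaleR_right_diff_distrib
            scaleR_sum_right sum_subtractf algebra_simps)
    qed
    have dz: "dz $ i = - (a i (x, y) \<bullet> dy)" for i
    proof -
      have "(\<lambda>k. (g i (pU k) - g i (pV k)) /\<^sub>R N k + ((zU k - zV k) /\<^sub>R N k) $ i) \<longlonglongrightarrow> g' i (x, y) (0, dy) + dz $ i"
        by (intro tendsto_intros Fq g_strict q)
      moreover have "(\<lambda>k. (g i (pU k) - g i (pV k)) /\<^sub>R N k + ((zU k - zV k) /\<^sub>R N k) $ i) \<longlonglongrightarrow> 0"
        using tendsto_vec_nth[OF tendsto_fst[OF tendsto_snd[OF tendsto_snd[OF tendsto_snd[OF L0]]]], of i]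
        by (simp add: UV lifted_def residual_def pU_def pV_def algebra_simps)
      ultimately have "g' i (x, y) (0, dy) + dz $ i = 0" by (rule LIMSEQ_unique)
      then show ?thesis by (simp add: g'_eq)
    qed
    have comp: "dm $ i * dz $ i \<le> 0" "\<mu> $ i > 0 \<Longrightarrow> dz $ i = 0" "z $ i > 0 \<Longrightarrow> dm $ i = 0" for i
    proof -
      have m: "(\<lambda>k. mU k $ i) \<longlonglongrightarrow> \<mu> $ i" "(\<lambda>k. mV k $ i) \<longlonglongrightarrow> \<mu> $ i"
        and zz: "(\<lambda>k. zU k $ i) \<longlonglongrightarrow> z $ i" "(\<lambda>k. zV k $ i) \<longlonglongrightarrow> z $ i"
        by (intro tendsto_intros lims)+
      have mq: "(\<lambda>k. (mU k $ i - mV k $ i) / N k) \<longlonglongrightarrow> dm $ i"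
        and zq: "(\<lambda>k. (zU k $ i - zV k $ i) / N k) \<longlonglongrightarrow> dz $ i"
        and eq: "(\<lambda>k. (eU k - eV k) / N k) \<longlonglongrightarrow> 0"
        using tendsto_vec_nth[OF q(5), of i] tendsto_vec_nth[OF q(4), of i] q(1)
        by (simp_all add: de divide_inverse mult.commute)
      have pq: "(\<lambda>k. (phi (eU k) (mU k $ i) (zU k $ i) - phi (eV k) (mV k $ i) (zV k $ i)) / N k) \<longlonglongrightarrow> 0"
        using tendsto_vec_nth[OF tendsto_snd[OF tendsto_snd[OF tendsto_snd[OF tendsto_snd[OF L0]]]], of i]
        by (simp add: UV lifted_def residual_def divide_inverse mult.commute)
      have sg: "\<mu> $ i \<ge> 0" "z $ i \<ge> 0" "\<mu> $ i * z $ i = 0" using s by auto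
      note * = phi_quotient_limit[OF N lims(1,6) m zz mq zq eq pq sg]
      show "dm $ i * dz $ i \<le> 0" "\<mu> $ i > 0 \<Longrightarrow> dz $ i = 0" "z $ i > 0 \<Longrightarrow> dm $ i = 0"
        using * by auto
    qed
    \<comment> \<open>For a positive multiplier \<open>dz $ i = 0\<close>, so \<open>dy\<close> is
      tangent to the active constraint, as \<open>convex_constraint_curvature\<close>
      demands.\<close>
    have curv: "\<mu> $ i * (a' i (x, y) (0, dy) \<bullet> dy) \<ge> 0" for i
    proof (cases "\<mu> $ i = 0")
      case False
      then have pos: "\<mu> $ i > 0" using s by (simp add: less_le)
      then have gi: "g i (x, y) = 0" using s by (metis mult_eq_0_iff neg_equal_0_iff_equal power_zero_numeral less_irrefl)
      have ad: "a i (x, y) \<bullet> dy = 0" using comp(2)[OF pos] dz[of i] by simp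
      have "a' i (x, y) (0, dy) \<bullet> dy \<ge> 0"
        by (rule convex_constraint_curvature[where f = "\<lambda>i y. g i (x, y)" and a = "\<lambda>i y. a i (x, y)" and y = y and i = i])
           (use feasible_convex gy g_partial gi partial_derivative[OF strict_derivative_imp_has_derivative[OF a_strict]]
              independent[OF x gy] ad in auto)
      with pos show ?thesis by simp
    qed simp
    \<comment> \<open>Pairing with \<open>dy\<close> turns \<open>a i (x, y) \<bullet> dy\<close>
      into \<open>- dz $ i\<close>, so each summand is a curvature term plus the nonnegative number
      \<open>- dm $ i * dz $ i\<close>.\<close>
    have "dy \<bullet> G' (x, y) (0, dy) + (\<Sum>i\<in>UNIV. \<mu> $ i * (a' i (x, y) (0, dy) \<bullet> dy) - dm $ i * dz $ i) = 0"
      using arg_cong[OF stat, of "\<lambda>t. t \<bullet> dy"] dz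
      by (simp add: inner_add_left inner_add_right inner_sum_left inner_sum_right inner_commute[of _ dy])
    moreover have "(\<Sum>i\<in>UNIV. \<mu> $ i * (a' i (x, y) (0, dy) \<bullet> dy) - dm $ i * dz $ i) \<ge> 0"
      by (rule sum_nonneg) (use curv comp(1) in \<open>smt (verit)\<close>)
    ultimately have "\<not> dy \<bullet> G' (x, y) (0, dy) > 0" by linarith
    with pos_def have dy: "dy = 0" by blast
    have dz0: "dz = 0" using dz dy by (simp add: vec_eq_iff)
    have G0: "G' (x, y) (0, 0) = 0" "a' i (x, y) (0, 0) = 0" for i
      using linear_0[OF bounded_linear.linear[OF strict_derivative_bounded_linear]] G_strict a_strict
      by (metis zero_prod_def)+
    \<comment> \<open>Inactive constraints have positive slack, where linearized complementarity
      gives 0; the active ones are left to independence.\<close>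
    have dm0: "dm $ i = 0" if "g i (x, y) \<noteq> 0" for i
      using comp(3)[of i] s gy that by (metis less_eq_real_def neg_0_less_iff_less)
    have "(\<Sum>i | g i (x, y) = 0. dm $ i *\<^sub>R a i (x, y)) = (\<Sum>i\<in>UNIV. dm $ i *\<^sub>R a i (x, y))"
      by (rule sum.mono_neutral_left) (use dm0 in auto)
    also have "\<dots> = 0" using stat by (simp add: dy G0)
    finally have "\<forall>i\<in>{i. g i (x, y) = 0}. dm $ i = 0" by (rule independent[OF x gy])
    then have "dm = 0" using dm0 by (force simp: vec_eq_iff)
    with de dx dy dz0 have "d = 0" by (simp add: dd zero_prod_def)
    with d(1) show False by simp
  qed
  then obtain k where k: "\<And>u v. \<not> P k u v" by blast
  show thesis
  proof (rule that[of "1 / Suc k" "1 / Suc k"])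
    fix u v assume "u \<in> ball (0::real, x, w) (1 / Suc k)" "v \<in> ball (0::real, x, w) (1 / Suc k)"
    then show "1 / real (Suc k) * norm (u - v) \<le> norm (lifted u - lifted v)"
      using k[of u v] unfolding P_def by linarith
  qed simp_all
qed

section \<open>Confinement of solutions by compactness\<close>

lemma solutions_cluster_if_convergent:
  assumes x: "x \<in> X" and e: "e \<longlonglongrightarrow> 0" and xk: "xk \<longlonglongrightarrow> x" and yk: "yk \<longlonglongrightarrow> y"
    and sol: "\<And>k. residual (e k) (xk k) (yk k, zk k, mk k) = 0"
  obtains \<rho> w where "strict_mono (\<rho> :: nat \<Rightarrow> nat)" "(\<lambda>k. (yk (\<rho> k), zk (\<rho> k), mk (\<rho> k))) \<longlonglongrightarrow> w"
    "residual 0 x w = 0"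
proof -
  note s = sol[unfolded residual_eq_0_iff]
  \<comment> \<open>The multipliers might blow up. Scaling to \<open>n k + norm (h k) = 1\<close>
    keeps the data compact, and \<open>n0 = 0\<close> in the limit is the case of blow-up.\<close>
  define n where "n k = 1 / (1 + norm (mk k))" for k
  define h where "h k = n k *\<^sub>R mk k" for k
  have den: "1 + norm (mk k) > 0" for k by (simp add: add_pos_nonneg)
  have n: "0 < n k" "n k \<le> 1" and nh: "n k + norm (h k) = 1" for k
    using den[of k] by (auto simp: n_def h_def field_simps)
  have nh_in: "\<forall>k. (n k, h k) \<in> cball 0 1 \<times> cball 0 1"
  proof
    fix k show "(n k, h k) \<in> cball 0 1 \<times> cball 0 1" using n[of k] nh[of k] by auto
  qed
  obtain t \<rho> where t: "strict_mono \<rho>" "((\<lambda>k. (n k, h k)) \<circ> \<rho>) \<longlonglongrightarrow> t"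
    using seq_compactE[OF compact_imp_seq_compact[OF compact_Times[OF compact_cball compact_cball]] nh_in] by metis
  obtain n0 h0 where t0: "t = (n0, h0)" by (metis prod.exhaust)
  have nl: "(\<lambda>k. n (\<rho> k)) \<longlonglongrightarrow> n0" and hl: "(\<lambda>k. h (\<rho> k)) \<longlonglongrightarrow> h0"
    using tendsto_fst[OF t(2)] tendsto_snd[OF t(2)] by (simp_all add: t0 o_def)
  have el: "(\<lambda>k. e (\<rho> k)) \<longlonglongrightarrow> 0" and xl: "(\<lambda>k. xk (\<rho> k)) \<longlonglongrightarrow> x" and yl: "(\<lambda>k. yk (\<rho> k)) \<longlonglongrightarrow> y"
    using LIMSEQ_subseq_LIMSEQ[OF _ t(1)] e xk yk by (auto simp: o_def)
  have pl: "(\<lambda>k. (xk (\<rho> k), yk (\<rho> k))) \<longlonglongrightarrow> (x, y)" by (intro tendsto_Pair xl yl)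
  have Gl: "(\<lambda>k. G (xk (\<rho> k), yk (\<rho> k))) \<longlonglongrightarrow> G (x, y)" by (rule isCont_tendsto_compose[OF isCont_G pl])
  have gl: "(\<lambda>k. g i (xk (\<rho> k), yk (\<rho> k))) \<longlonglongrightarrow> g i (x, y)" for i by (rule isCont_tendsto_compose[OF isCont_g pl])
  have al: "(\<lambda>k. a i (xk (\<rho> k), yk (\<rho> k))) \<longlonglongrightarrow> a i (x, y)" for i by (rule isCont_tendsto_compose[OF isCont_a pl])
  have hk: "h k $ i \<ge> 0" "h k $ i * g i (xk k, yk k) = - n k * (e k)\<^sup>2" for k i
  proof -
    show "h k $ i \<ge> 0" using s[of k] n(1)[of k] by (simp add: h_def)
    have "mk k $ i * - g i (xk k, yk k) = (e k)\<^sup>2" using s[of k] by metis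
    then have "mk k $ i * g i (xk k, yk k) = - (e k)\<^sup>2" by simp
    then show "h k $ i * g i (xk k, yk k) = - n k * (e k)\<^sup>2" by (simp add: h_def mult.assoc)
  qed
  have gneg: "g i (x, y) \<le> 0" for i
  proof (rule tendsto_upperbound[OF gl])
    show "eventually (\<lambda>k. g i (xk (\<rho> k), yk (\<rho> k)) \<le> 0) sequentially"
      using s by (intro always_eventually) (metis neg_0_le_iff_le)
  qed simp
  have h0g: "h0 $ i * g i (x, y) = 0" for i
  proof (rule LIMSEQ_unique)
    show "(\<lambda>k. h (\<rho> k) $ i * g i (xk (\<rho> k), yk (\<rho> k))) \<longlonglongrightarrow> h0 $ i * g i (x, y)"
      by (intro tendsto_intros hl gl)
    have "(\<lambda>k. - n (\<rho> k) * (e (\<rho> k))\<^sup>2) \<longlonglongrightarrow> - n0 * 0\<^sup>2" by (intro tendsto_intros nl el)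
    then show "(\<lambda>k. h (\<rho> k) $ i * g i (xk (\<rho> k), yk (\<rho> k))) \<longlonglongrightarrow> 0" by (simp add: hk)
  qed
  have h0: "h0 $ i \<ge> 0" for i
    by (rule tendsto_lowerbound[OF tendsto_vec_nth[OF hl]]) (simp_all add: hk)
  have st: "n0 *\<^sub>R G (x, y) + (\<Sum>i\<in>UNIV. h0 $ i *\<^sub>R a i (x, y)) = 0"
  proof (rule LIMSEQ_unique)
    show "(\<lambda>k. n (\<rho> k) *\<^sub>R G (xk (\<rho> k), yk (\<rho> k)) + (\<Sum>i\<in>UNIV. h (\<rho> k) $ i *\<^sub>R a i (xk (\<rho> k), yk (\<rho> k))))
       \<longlonglongrightarrow> n0 *\<^sub>R G (x, y) + (\<Sum>i\<in>UNIV. h0 $ i *\<^sub>R a i (x, y))"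
      by (intro tendsto_intros nl hl Gl al)
    have "n k *\<^sub>R G (xk k, yk k) + (\<Sum>i\<in>UNIV. h k $ i *\<^sub>R a i (xk k, yk k))
      = n k *\<^sub>R (G (xk k, yk k) + (\<Sum>i\<in>UNIV. mk k $ i *\<^sub>R a i (xk k, yk k)))" for k
      by (simp add: h_def scaleR_right_distrib scaleR_sum_right)
    also have "\<And>k. \<dots> k = 0" using s by simp
    finally show "(\<lambda>k. n (\<rho> k) *\<^sub>R G (xk (\<rho> k), yk (\<rho> k)) + (\<Sum>i\<in>UNIV. h (\<rho> k) $ i *\<^sub>R a i (xk (\<rho> k), yk (\<rho> k)))) \<longlonglongrightarrow> 0"
      by simp
  qed
  have nh0: "n0 + norm h0 = 1"
    by (rule LIMSEQ_unique[OF tendsto_add[OF nl tendsto_norm[OF hl]]]) (simp add: nh)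
  \<comment> \<open>After a blow-up, \<open>h0\<close> would be a unit vector of coefficients
    combining the active gradients to 0, against independence.\<close>
  have "n0 \<noteq> 0"
  proof
    assume n0: "n0 = 0"
    have "(\<Sum>i | g i (x, y) = 0. h0 $ i *\<^sub>R a i (x, y)) = (\<Sum>i\<in>UNIV. h0 $ i *\<^sub>R a i (x, y))"
      by (rule sum.mono_neutral_left) (use h0g in auto)
    also have "\<dots> = 0" using st by (simp add: n0)
    finally have "\<forall>i\<in>{i. g i (x, y) = 0}. h0 $ i = 0" using gneg by (intro independent[OF x]) auto
    then have "h0 = 0" using h0g by (force simp: vec_eq_iff)
    with nh0 n0 show False by simp
  qed
  moreover have "n0 \<ge> 0" by (rule tendsto_lowerbound[OF nl]) (use n in \<open>simp_all add: less_imp_le\<close>)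
  ultimately have n0: "n0 > 0" by simp
  define m0 where "m0 = h0 /\<^sub>R n0"
  have "(\<lambda>k. h (\<rho> k) /\<^sub>R n (\<rho> k)) \<longlonglongrightarrow> m0" unfolding m0_def by (intro tendsto_intros hl nl) (use n0 in simp)
  moreover have "h k /\<^sub>R n k = mk k" for k using n(1)[of k] by (simp add: h_def)
  ultimately have ml: "(\<lambda>k. mk (\<rho> k)) \<longlonglongrightarrow> m0" by simp
  define z0 where "z0 = (\<chi> i. - g i (x, y))"
  have zl: "(\<lambda>k. zk (\<rho> k)) \<longlonglongrightarrow> z0"
  proof (rule vec_tendstoI)
    fix i show "(\<lambda>k. zk (\<rho> k) $ i) \<longlonglongrightarrow> z0 $ i" using tendsto_minus[OF gl[of i]] s by (simp add: z0_def)
  qed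
  show thesis
  proof (rule that[OF t(1)])
    show "(\<lambda>k. (yk (\<rho> k), zk (\<rho> k), mk (\<rho> k))) \<longlonglongrightarrow> (y, z0, m0)" by (intro tendsto_intros yl zl ml)
    have "G (x, y) + (\<Sum>i\<in>UNIV. m0 $ i *\<^sub>R a i (x, y)) = (n0 *\<^sub>R G (x, y) + (\<Sum>i\<in>UNIV. h0 $ i *\<^sub>R a i (x, y))) /\<^sub>R n0"
      using n0 by (simp add: m0_def scaleR_right_distrib scaleR_sum_right)
    then have "G (x, y) + (\<Sum>i\<in>UNIV. m0 $ i *\<^sub>R a i (x, y)) = 0" by (simp add: st)
    then show "residual 0 x (y, z0, m0) = 0"
      unfolding residual_eq_0_iff using n0 h0 h0g gneg by (auto simp: z0_def m0_def mult.assoc)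
  qed
qed

text \<open>Compactness at \<open>x\<close> alone does not bound the neighbouring feasible sets;
  convexity does. A segment from \<open>ck k\<close> to a far point \<open>yk k\<close> crosses the
  sphere of radius \<open>R\<close>, and the crossing points accumulate at a point feasible for
  \<open>x\<close>, whereas all such points lie strictly inside.\<close>

lemma feasible_points_eventually_bounded:
  assumes xk: "xk \<longlonglongrightarrow> x" and c: "ck \<longlonglongrightarrow> c" and f: "\<And>k i. g i (xk k, ck k) \<le> 0" "\<And>k i. g i (xk k, yk k) \<le> 0"
  obtains R where "eventually (\<lambda>k. yk k \<in> cball c R) sequentially"
proof -
  obtain R0 where R0: "{y. \<forall>i. g i (x, y) \<le> 0} \<subseteq> ball c R0"
    using bounded_subset_ballD[OF compact_imp_bounded[OF feasible_compact]] by metis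
  \<comment> \<open>The maximum with 1 makes the radius positive, so that \<open>ck k\<close> is
    eventually inside the ball.\<close>
  define R where "R = max R0 1"
  have R: "R > 0" "\<And>y. \<forall>i. g i (x, y) \<le> 0 \<Longrightarrow> dist c y < R" using R0 by (auto simp: R_def subset_iff)
  have "eventually (\<lambda>k. yk k \<in> cball c R) sequentially"
  proof (rule ccontr)
    assume "\<not> ?thesis"
    from not_eventually_sequentiallyD[OF this]
    obtain \<rho> :: "nat \<Rightarrow> nat" where \<rho>: "strict_mono \<rho>" "\<And>k. yk (\<rho> k) \<notin> cball c R" by blast
    have cl: "(\<lambda>k. ck (\<rho> k)) \<longlonglongrightarrow> c" and xl: "(\<lambda>k. xk (\<rho> k)) \<longlonglongrightarrow> x"
      using LIMSEQ_subseq_LIMSEQ[OF _ \<rho>(1)] c xk by (auto simp: o_def)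
    obtain K where K: "\<And>k. k \<ge> K \<Longrightarrow> dist (ck (\<rho> k)) c < R"
      using tendstoD[OF cl \<open>R > 0\<close>] by (auto simp: eventually_sequentially)
    have "\<exists>q. dist c q = R \<and> (\<forall>i. g i (xk (\<rho> (k + K)), q) \<le> 0)" for k
    proof -
      define j where "j = \<rho> (k + K)"
      define p where "p t = ck j + t *\<^sub>R (yk j - ck j)" for t
      have "\<exists>t\<ge>0. t \<le> 1 \<and> dist c (p t) = R"
      proof (rule IVT')
        show "dist c (p 0) \<le> R" using K[of "k + K"] by (simp add: p_def j_def dist_commute)
        show "R \<le> dist c (p 1)" using \<rho>(2)[of "k + K"] by (simp add: p_def j_def)
        show "continuous_on {0..1} (\<lambda>t. dist c (p t))" unfolding p_def by (intro continuous_intros)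
      qed simp
      then obtain t where t: "0 \<le> t" "t \<le> 1" "dist c (p t) = R" by blast
      have "(1 - t) *\<^sub>R ck j + t *\<^sub>R yk j \<in> {y. \<forall>i. g i (xk j, y) \<le> 0}"
        by (rule convexD[OF feasible_convex]) (use t f in auto)
      moreover have "(1 - t) *\<^sub>R ck j + t *\<^sub>R yk j = p t" by (simp add: p_def algebra_simps)
      ultimately show ?thesis using t(3) by (auto simp: j_def)
    qed
    then obtain q where q: "\<And>k. q k \<in> sphere c R" "\<And>k i. g i (xk (\<rho> (k + K)), q k) \<le> 0"
      unfolding mem_sphere by metis
    obtain l \<sigma> where l: "l \<in> sphere c R" "strict_mono \<sigma>" "(q \<circ> \<sigma>) \<longlonglongrightarrow> l"
      using compact_sphere[of c R] q(1) unfolding compact_def by metis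
    have "(\<lambda>k. (xk (\<rho> (\<sigma> k + K)), q (\<sigma> k))) \<longlonglongrightarrow> (x, l)"
      using LIMSEQ_subseq_LIMSEQ[OF LIMSEQ_ignore_initial_segment[OF xl, of K] l(2)] l(3)
      by (intro tendsto_Pair) (auto simp: o_def)
    then have "(\<lambda>k. g i (xk (\<rho> (\<sigma> k + K)), q (\<sigma> k))) \<longlonglongrightarrow> g i (x, l)" for i
      by (rule isCont_tendsto_compose[OF isCont_g])
    then have "g i (x, l) \<le> 0" for i
      by (rule tendsto_upperbound) (use q(2) in auto)
    with R(2)[of l] l(1) show False by simp
  qed
  then show thesis by (rule that)
qed

text \<open>The reference solutions \<open>ck\<close> provide the convergent feasible points that
  bound the first components of \<open>wk\<close>; slacks and multipliers are then controlled by the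
  convergent case.\<close>

lemma solutions_cluster:
  assumes x: "x \<in> X" and e: "e \<longlonglongrightarrow> 0" and xk: "xk \<longlonglongrightarrow> x"
    and ref: "\<And>k. residual (e k) (xk k) (ck k) = 0" "ck \<longlonglongrightarrow> c"
    and sol: "\<And>k. residual (e k) (xk k) (wk k) = 0"
  obtains \<rho> w where "strict_mono (\<rho> :: nat \<Rightarrow> nat)" "(\<lambda>k. wk (\<rho> k)) \<longlonglongrightarrow> w" "residual 0 x w = 0"
proof -
  have feas: "g i (p, fst w) \<le> 0" if "residual \<epsilon> p w = 0" for i p w \<epsilon>
    using that residual_eq_0_iff[of \<epsilon> p "fst w" "fst (snd w)" "snd (snd w)"] by simp (metis neg_0_le_iff_le)
  obtain R where R: "eventually (\<lambda>k. fst (wk k) \<in> cball (fst c) R) sequentially"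
    using feasible_points_eventually_bounded[OF xk tendsto_fst[OF ref(2)], of "\<lambda>k. fst (wk k)"]
      feas[OF ref(1)] feas[OF sol] by metis
  then obtain K where K: "\<And>k. fst (wk (k + K)) \<in> cball (fst c) R"
    unfolding eventually_sequentially by (metis le_add2)
  then obtain l \<sigma> where l: "strict_mono \<sigma>" "((\<lambda>k. fst (wk (k + K))) \<circ> \<sigma>) \<longlonglongrightarrow> l"
    using compact_cball[of "fst c" R] unfolding compact_def by metis
  define \<tau> where "\<tau> k = \<sigma> k + K" for k
  have \<tau>: "strict_mono \<tau>" using l(1) by (simp add: \<tau>_def strict_mono_def)
  obtain \<rho> w where "strict_mono (\<rho> :: nat \<Rightarrow> nat)"
    "(\<lambda>k. (fst (wk (\<tau> (\<rho> k))), fst (snd (wk (\<tau> (\<rho> k)))), snd (snd (wk (\<tau> (\<rho> k)))))) \<longlonglongrightarrow> w" "residual 0 x w = 0"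
  proof (rule solutions_cluster_if_convergent[OF x, of "\<lambda>k. e (\<tau> k)" "\<lambda>k. xk (\<tau> k)" "\<lambda>k. fst (wk (\<tau> k))" l
        "\<lambda>k. fst (snd (wk (\<tau> k)))" "\<lambda>k. snd (snd (wk (\<tau> k)))"])
    show "(\<lambda>k. e (\<tau> k)) \<longlonglongrightarrow> 0" "(\<lambda>k. xk (\<tau> k)) \<longlonglongrightarrow> x"
      using LIMSEQ_subseq_LIMSEQ[OF _ \<tau>] e xk by (auto simp: o_def)
    show "(\<lambda>k. fst (wk (\<tau> k))) \<longlonglongrightarrow> l" using l(2) by (simp add: o_def \<tau>_def)
  qed (use sol in auto)
  then show thesis using that[of "\<lambda>k. \<tau> (\<rho> k)" w] strict_monoD[OF \<tau>] by (simp add: strict_mono_def)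
qed

section \<open>The solution map on a neighbourhood\<close>

lemma lifted_differentiable:
  assumes "\<epsilon> \<noteq> 0" shows "lifted differentiable (at (\<epsilon>, x, y, z, \<mu>))"
proof -
  define p where "p = (\<epsilon>, x, y, z, \<mu>)"
  have fsum: "(\<lambda>u. \<Sum>i\<in>UNIV. f i u) differentiable (at p)" if "\<And>i. f i differentiable (at p)"
    for f :: "'l \<Rightarrow> real \<times> 'x \<times> 'y \<times> (real^'l) \<times> (real^'l) \<Rightarrow> 'y"
    by (rule differentiable_sum) (use that in auto)
  have proj: "(\<lambda>u. fst (snd u)) differentiable (at p)" "(\<lambda>u. fst (snd (snd u))) differentiable (at p)"
    "(\<lambda>u. fst (snd (snd (snd u)))) differentiable (at p)" "(\<lambda>u. snd (snd (snd (snd u)))) differentiable (at p)"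
    "fst differentiable (at p)" "snd differentiable (at p)"
    for p :: "real \<times> 'x \<times> 'y \<times> (real^'l) \<times> (real^'l)"
    by (auto intro!: bounded_linear_imp_differentiable bounded_linear_fst bounded_linear_snd
       bounded_linear_fst_comp bounded_linear_snd_comp)
  have Q: "(\<lambda>u. (fst (snd u), fst (snd (snd u)))) differentiable (at p)"
    by (intro differentiable_Pair proj)
  have comp: "(\<lambda>u. F (fst (snd u), fst (snd (snd u)))) differentiable (at p)"
    if "\<And>q. \<exists>F'. strict_derivative F F' q" for F :: "'x \<times> 'y \<Rightarrow> 'z::real_normed_vector"
  proof -
    have "F differentiable (at (fst (snd p), fst (snd (snd p))))"
      using that strict_derivative_imp_has_derivative differentiableI by metis
    with differentiable_chain_at[OF Q] show ?thesis by (simp add: o_def)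
  qed
  have nth: "(\<lambda>u. fst (snd (snd (snd u))) $ i) differentiable (at p)" "(\<lambda>u. snd (snd (snd (snd u))) $ i) differentiable (at p)" for i
    by (intro differentiable_bounded_linear_compose[OF bounded_linear_vec_nth] proj)+
  have "(\<lambda>u. phi (fst u) (snd (snd (snd (snd u))) $ i) (fst (snd (snd (snd u))) $ i)) differentiable (at p)" for i
  proof -
    obtain m' z' where m': "((\<lambda>u. snd (snd (snd (snd u))) $ i) has_derivative m') (at p)"
       "((\<lambda>u. fst (snd (snd (snd u))) $ i) has_derivative z') (at p)"
      using nth unfolding differentiable_def by blast
    \<comment> \<open>The root in \<open>phi\<close> is the only source of nonsmoothness, and
      \<epsilon> \<noteq> 0 keeps its radicand positive.\<close>
    have pos: "(snd (snd (snd (snd p))) $ i)\<^sup>2 + (fst (snd (snd (snd p))) $ i)\<^sup>2 + 2 * (fst p)\<^sup>2 > 0"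
      using assms by (simp add: p_def add_nonneg_pos)
    show ?thesis unfolding phi_def
      by (rule differentiableI) (rule derivative_eq_intros m' pos refl)+
  qed
  moreover have "(\<lambda>u. G (fst (snd u), fst (snd (snd u)))) differentiable (at p)" using G_strict by (intro comp) blast
  moreover have "(\<lambda>u. g i (fst (snd u), fst (snd (snd u)))) differentiable (at p)" for i using g_strict by (intro comp) blast
  moreover have "(\<lambda>u. a i (fst (snd u), fst (snd (snd u)))) differentiable (at p)" for i using a_strict by (intro comp) blast
  ultimately have "(\<lambda>u. (fst u, fst (snd u), G (fst (snd u), fst (snd (snd u))) + (\<Sum>i\<in>UNIV. snd (snd (snd (snd u))) $ i *\<^sub>R a i (fst (snd u), fst (snd (snd u)))),
      (\<chi> i. g i (fst (snd u), fst (snd (snd u)))) + fst (snd (snd (snd u))),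
      \<chi> i. phi (fst u) (snd (snd (snd (snd u))) $ i) (fst (snd (snd (snd u))) $ i))) differentiable (at p)"
    by (intro differentiable_Pair proj differentiable_add fsum differentiable_scaleR differentiable_vec_lambda nth finite)
  then show ?thesis unfolding lifted_def residual_def p_def case_prod_unfold by simp
qed

lemma solution_map:
  assumes x: "x \<in> X"
  obtains U v L where "open U" "(0, x) \<in> U" "L-lipschitz_on U (\<lambda>(\<epsilon>, x). v \<epsilon> x)"
    "\<And>\<epsilon> x w. (\<epsilon>, x) \<in> U \<Longrightarrow> residual \<epsilon> x w = 0 \<longleftrightarrow> w = v \<epsilon> x"
    "\<And>\<epsilon> x. (\<epsilon>, x) \<in> U \<Longrightarrow> \<epsilon> \<noteq> 0 \<Longrightarrow> v \<epsilon> differentiable (at x)"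
proof -
  obtain w where w: "residual 0 x w = 0" using residual_0_exists[OF x] .
  obtain r \<delta> where r: "r > 0" "\<delta> > 0" and low:
    "\<And>u v. u \<in> ball (0::real, x, w) r \<Longrightarrow> v \<in> ball (0::real, x, w) r \<Longrightarrow> \<delta> * norm (u - v) \<le> norm (lifted u - lifted v)"
    by (rule lifted_expansive_near_solution[OF x w]) blast
  obtain V h where V: "open V" "lifted (0::real, x, w) \<in> V" and hV: "\<And>q. q \<in> V \<Longrightarrow> h q \<in> ball (0::real, x, w) r"
      "\<And>q. q \<in> V \<Longrightarrow> lifted (h q) = q" and hlip: "(1/\<delta>)-lipschitz_on V h"
  proof (rule local_inverse_of_expansive[OF lifted_continuous r low])
    fix V h assume "open V" "lifted (0, x, w) \<in> V" "\<And>q. q \<in> V \<Longrightarrow> h q \<in> ball (0, x, w) r"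
      "\<And>q. q \<in> V \<Longrightarrow> lifted (h q) = q" "(1/\<delta>)-lipschitz_on V h"
    then show thesis by (rule that)
  qed
  \<comment> \<open>Since \<open>lifted\<close> reproduces the parameters, the preimage of
    \<open>(\<epsilon>, x, 0)\<close> carries a solution at exactly these parameters.\<close>
  define v where "v \<epsilon> x = snd (snd (h (\<epsilon>, x, 0)))" for \<epsilon> x
  define U0 where "U0 = (\<lambda>(\<epsilon>, x). (\<epsilon>, x, 0)) -` V"
  have openU0: "open U0" unfolding U0_def
    by (rule open_vimage[OF V(1)]) (auto simp: case_prod_unfold intro!: continuous_intros)
  have xU0: "(0, x) \<in> U0" using V(2) by (simp add: U0_def lifted_def w)
  have hv: "h (\<epsilon>, x, 0) = (\<epsilon>, x, v \<epsilon> x)" "residual \<epsilon> x (v \<epsilon> x) = 0" if "(\<epsilon>, x) \<in> U0" for \<epsilon> x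
  proof -
    have *: "lifted (h (\<epsilon>, x, 0)) = (\<epsilon>, x, 0)" using that hV(2) by (simp add: U0_def)
    obtain e p q where h: "h (\<epsilon>, x, 0) = (e, p, q)" by (metis prod.exhaust)
    with * show "h (\<epsilon>, x, 0) = (\<epsilon>, x, v \<epsilon> x)" by (simp add: lifted_def v_def)
    with * show "residual \<epsilon> x (v \<epsilon> x) = 0" by (simp add: lifted_def)
  qed
  have inU0: "(\<epsilon>, x) \<in> U0 \<Longrightarrow> (\<epsilon>, x, 0) \<in> V" for \<epsilon> x by (simp add: U0_def)
  have vlip: "(1/\<delta>)-lipschitz_on U0 (\<lambda>(\<epsilon>, x). v \<epsilon> x)"
  proof (rule lipschitz_onI)
    fix p q assume pq: "p \<in> U0" "q \<in> U0"
    obtain e1 x1 e2 x2 where p: "p = (e1, x1)" "q = (e2, x2)" by fastforce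
    have "dist (v e1 x1) (v e2 x2) \<le> dist (h (e1, x1, 0)) (h (e2, x2, 0))"
      unfolding v_def by (rule order_trans[OF dist_snd_le dist_snd_le])
    also have "\<dots> \<le> 1/\<delta> * dist (e1, x1, 0 :: 'y \<times> (real^'l) \<times> (real^'l)) (e2, x2, 0)"
      using lipschitz_onD[OF hlip] inU0 pq p by simp
    also have "dist (e1, x1, 0 :: 'y \<times> (real^'l) \<times> (real^'l)) (e2, x2, 0) = dist p q"
      by (simp add: p dist_Pair_Pair)
    finally show "dist (case p of (\<epsilon>, x) \<Rightarrow> v \<epsilon> x) (case q of (\<epsilon>, x) \<Rightarrow> v \<epsilon> x) \<le> 1/\<delta> * dist p q"
      by (simp add: p)
  qed (use r in simp)
  obtain \<rho>0 where \<rho>0: "\<rho>0 > 0" "ball (0::real, x) \<rho>0 \<subseteq> U0" using openU0 xU0 by (meson open_contains_ball)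
  \<comment> \<open>Solutions escaping from the ball on which \<open>lifted\<close> is expansive.
    The radii stay within \<open>U0\<close>, so \<open>v\<close> is defined along an escaping
    sequence and serves as the reference for \<open>solutions_cluster\<close>.\<close>
  define P where "P k \<epsilon> x' w' \<longleftrightarrow> (\<epsilon>, x') \<in> ball (0::real, x) (\<rho>0 / Suc k) \<and> residual \<epsilon> x' w' = 0 \<and>
     (\<epsilon>, x', w') \<notin> ball (0::real, x, w) r" for k :: nat and \<epsilon> x' w'
  have "\<exists>k. \<forall>\<epsilon> x' w'. \<not> P k \<epsilon> x' w'"
  proof (rule ccontr)
    assume "\<not> ?thesis"
    then have "\<forall>k. \<exists>t. P k (fst t) (fst (snd t)) (snd (snd t))" by simp
    from choice[OF this] obtain t where t: "\<And>k. P k (fst (t k)) (fst (snd (t k))) (snd (snd (t k)))" by blast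
    define e where "e k = fst (t k)" for k
    define xk where "xk k = fst (snd (t k))" for k
    define wk where "wk k = snd (snd (t k))" for k
    have P: "P k (e k) (xk k) (wk k)" for k using t by (simp add: e_def xk_def wk_def)
    have "(\<lambda>k. \<rho>0 / Suc k) \<longlonglongrightarrow> 0" using tendsto_mult[OF tendsto_const[of \<rho>0] LIMSEQ_Suc[OF lim_inverse_n']] by simp
    then have lim: "(\<lambda>k. (e k, xk k)) \<longlonglongrightarrow> (0, x)"
    proof (rule metric_tendsto_imp_tendsto[OF _ always_eventually], intro allI)
      fix k
      have "dist (0, x) (e k, xk k) < \<rho>0 / Suc k" using P[of k] unfolding P_def mem_ball by blast
      then show "dist (e k, xk k) (0, x) \<le> dist (\<rho>0 / Suc k) 0"
        by (simp only: dist_commute[of "(e k, xk k)"] dist_real_def)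
    qed
    have in0: "(e k, xk k) \<in> U0" for k
    proof -
      have "\<rho>0 / Suc k \<le> \<rho>0" using \<rho>0(1) by (simp add: field_simps)
      then show ?thesis using P[of k] \<rho>0(2) unfolding P_def by (auto dest: subsetD)
    qed
    have "(\<lambda>k. (\<lambda>(\<epsilon>, x). v \<epsilon> x) (e k, xk k)) \<longlonglongrightarrow> (\<lambda>(\<epsilon>, x). v \<epsilon> x) (0, x)"
      using lipschitz_on_continuous_on[OF vlip] openU0 xU0 lim
      by (intro isCont_tendsto_compose[of "(0, x)" "\<lambda>(\<epsilon>, x). v \<epsilon> x"]) (auto simp: continuous_on_eq_continuous_at)
    then have vl: "(\<lambda>k. v (e k) (xk k)) \<longlonglongrightarrow> v 0 x" by simp
    obtain \<sigma> w' where \<sigma>: "strict_mono (\<sigma> :: nat \<Rightarrow> nat)" "(\<lambda>k. wk (\<sigma> k)) \<longlonglongrightarrow> w'" "residual 0 x w' = 0"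
      by (rule solutions_cluster[OF x tendsto_fst[OF lim, simplified] tendsto_snd[OF lim, simplified]
          hv(2)[OF in0] vl, of wk]) (use P in \<open>auto simp: P_def\<close>)
    have "w' = w" by (rule residual_0_unique[OF x \<sigma>(3) w])
    then have "(\<lambda>k. (e (\<sigma> k), xk (\<sigma> k), wk (\<sigma> k))) \<longlonglongrightarrow> (0::real, x, w)"
      using \<sigma>(2) LIMSEQ_subseq_LIMSEQ[OF lim \<sigma>(1)]
      by (auto intro!: tendsto_Pair simp: o_def dest: tendsto_fst tendsto_snd)
    from tendstoD[OF this r(1)] obtain k where "dist (e (\<sigma> k), xk (\<sigma> k), wk (\<sigma> k)) (0::real, x, w) < r"
      by (auto simp: eventually_sequentially)
    with P[of "\<sigma> k"] show False by (simp add: P_def dist_commute)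
  qed
  then obtain k where k: "\<And>\<epsilon> x' w'. \<not> P k \<epsilon> x' w'" by blast
  define U where "U = ball (0::real, x) (\<rho>0 / Suc k)"
  have UU0: "U \<subseteq> U0"
  proof -
    have "\<rho>0 / Suc k \<le> \<rho>0" using \<rho>0(1) by (simp add: field_simps)
    then show ?thesis using \<rho>0(2) by (auto simp: U_def dest: subsetD)
  qed
  show thesis
  proof (rule that[of U "1/\<delta>" v])
    show "open U" "(0, x) \<in> U" using \<rho>0 by (auto simp: U_def)
    show "(1/\<delta>)-lipschitz_on U (\<lambda>(\<epsilon>, x). v \<epsilon> x)" by (rule lipschitz_on_subset[OF vlip UU0])
    fix \<epsilon> x' w' assume *: "(\<epsilon>, x') \<in> U"
    then have **: "(\<epsilon>, x') \<in> U0" using UU0 by blast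
    show "residual \<epsilon> x' w' = 0 \<longleftrightarrow> w' = v \<epsilon> x'"
    proof
      assume w': "residual \<epsilon> x' w' = 0"
      \<comment> \<open>Two solutions at the same parameters have the same image under
        \<open>lifted\<close>; inside the expansive ball they must coincide.\<close>
      have "(\<epsilon>, x', w') \<in> ball (0::real, x, w) r" using k[of \<epsilon> x' w'] w' * by (simp add: P_def U_def)
      moreover have "(\<epsilon>, x', v \<epsilon> x') \<in> ball (0::real, x, w) r" using hV(1)[OF inU0[OF **]] hv(1)[OF **] by simp
      ultimately have "\<delta> * norm ((\<epsilon>, x', w') - (\<epsilon>, x', v \<epsilon> x')) \<le> norm (lifted (\<epsilon>, x', w') - lifted (\<epsilon>, x', v \<epsilon> x'))"
        by (rule low)
      also have "\<dots> = 0" using w' hv(2)[OF **] by (simp add: lifted_def)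
      finally have "norm ((\<epsilon>, x', w') - (\<epsilon>, x', v \<epsilon> x')) \<le> 0" using r(2) by (simp add: mult_le_0_iff)
      then show "w' = v \<epsilon> x'" by simp
    qed (use hv(2)[OF **] in simp)
  next
    fix \<epsilon> x' assume *: "(\<epsilon>, x') \<in> U" and "\<epsilon> \<noteq> 0"
    then have **: "(\<epsilon>, x') \<in> U0" using UU0 by blast
    define q where "q = (\<epsilon>, x', 0 :: 'y \<times> (real^'l) \<times> (real^'l))"
    have qV: "q \<in> V" using inU0[OF **] by (simp add: q_def)
    have hq: "h q = (\<epsilon>, x', v \<epsilon> x')" using hv(1)[OF **] by (simp add: q_def)
    obtain F' where F': "(lifted has_derivative F') (at (h q))"
      using lifted_differentiable[OF \<open>\<epsilon> \<noteq> 0\<close>] unfolding differentiable_def hq by (metis prod.exhaust)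
    have lin: "linear F'" using F' by (rule has_derivative_linear)
    \<comment> \<open>The expansive bound makes the derivative injective; its left inverse is the
      derivative of \<open>h\<close>.\<close>
    have "\<delta> * norm t \<le> norm (F' t)" for t
      by (rule has_derivative_expansive[OF F' open_ball hV(1)[OF qV]]) (use low hV(1)[OF qV] in blast)
    then have "F' t = 0 \<Longrightarrow> t = 0" for t using r(2) by (metis mult_le_0_iff norm_le_zero_iff norm_zero not_less)
    then have "inj F'" by (simp add: linear_injective_0[OF lin])
    then obtain g' where g': "linear g'" "g' \<circ> F' = id" using linear_injective_left_inverse[OF lin] by blast
    have "(h has_derivative g') (at q)"
    proof (rule has_derivative_inverse_basic[where f = lifted and f' = F' and T = V])
      show "bounded_linear g'" using g'(1) by (simp add: linear_conv_bounded_linear)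
      show "continuous (at q) h"
        using lipschitz_on_continuous_on[OF hlip] V(1) qV continuous_on_eq_continuous_at by blast
    qed (use F' g' V qV hV(2) in auto)
    then have "h differentiable (at q)" by (rule differentiableI)
    moreover have "(\<lambda>x'. (\<epsilon>, x', 0 :: 'y \<times> (real^'l) \<times> (real^'l))) differentiable (at x')"
      unfolding differentiable_def by (rule exI, (rule derivative_intros)+)
    ultimately have "(\<lambda>x'. h (\<epsilon>, x', 0)) differentiable (at x')"
      using differentiable_chain_at[of "\<lambda>x'. (\<epsilon>, x', 0)" x' h] by (simp add: q_def o_def)
    then show "v \<epsilon> differentiable (at x')"
      unfolding v_def[abs_def]
      by (intro differentiable_bounded_linear_compose[OF bounded_linear_snd])
  qed
qed

end

section \<open>The followers' game\<close>

lemma bounded_linear_blk: "bounded_linear (blk own k :: real^'p \<Rightarrow> real^'p)"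
  unfolding blk_def by (intro linear_conv_bounded_linear[THEN iffD1] linearI) (auto simp: vec_eq_iff)

lemma upd_has_derivative: "(upd own k z has_derivative blk own k) (at p within S)"
proof -
  have "upd own k z = (\<lambda>u. (z - blk own k z) + blk own k u)"
    by (auto simp: upd_def blk_def vec_eq_iff)
  then show ?thesis
    by (auto intro!: derivative_eq_intros bounded_linear_imp_has_derivative[OF bounded_linear_blk])
qed

lemma upd_self [simp]: "upd own k x x = x"
  by (simp add: upd_def vec_eq_iff)

lemma blk_axis: "blk own k (axis j 1) = (if own j = k then axis j (1::real) else 0)"
  by (auto simp: blk_def axis_def vec_eq_iff)

text \<open>\<open>Gmap\<close> collects partial gradients of different functions. Through total
  derivatives its components inherit the smoothness of the costs.\<close>

lemma Gmap_component:
  assumes "\<And>\<omega>. Ck 2 (fcost P \<omega>)"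
  shows "Gmap P x y $ j = frechet_derivative (fcost P (fown P j)) (at (x, y)) (0, axis j 1)"
proof -
  define \<omega> where "\<omega> = fown P j"
  have "Ck 1 (fcost P \<omega>)" using assms by (rule Ck_2_imp_Ck_1)
  then have D: "(fcost P \<omega> has_derivative frechet_derivative (fcost P \<omega>) (at (x, y))) (at (x, upd (fown P) \<omega> y y))"
    using Ck_1_has_derivative by (simp only: upd_self)
  have "((\<lambda>u. (x, upd (fown P) \<omega> y u)) has_derivative (\<lambda>h. (0, blk (fown P) \<omega> h))) (at y)"
    by (intro has_derivative_Pair upd_has_derivative) simp
  from has_derivative_compose[OF this, of "fcost P \<omega>"] D
  have "((\<lambda>u. fcost P \<omega> (x, upd (fown P) \<omega> y u)) has_derivative
      (\<lambda>h. frechet_derivative (fcost P \<omega>) (at (x, y)) (0, blk (fown P) \<omega> h))) (at y)" by simp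
  from frechet_derivative_at[OF this, symmetric]
  show ?thesis by (simp add: Gmap_def pgrad_def grad_def blk_axis flip: \<omega>_def)
qed

text \<open>Projecting on the owner's block places all constraints on one space; the smoothness
  hypothesis concerns this extension.\<close>

definition joint_constr :: "('N, 'M, 'n::finite, 'm::finite, 'l) mlf_game \<Rightarrow> 'l \<Rightarrow> (real^'n) \<times> (real^'m) \<Rightarrow> real" where
  "joint_constr P i = (\<lambda>(x, y). constr P i (x, blk (fown P) (cown P i) y))"

definition constr_grad :: "('N, 'M, 'n::finite, 'm::finite, 'l) mlf_game \<Rightarrow> 'l \<Rightarrow> (real^'n) \<times> (real^'m) \<Rightarrow> real^'m" where
  "constr_grad P i p = (\<chi> j. frechet_derivative (joint_constr P i) (at p) (0, axis j 1))"

lemma gmap_eq: "gmap P x y = (\<chi> i. joint_constr P i (x, y))"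
  by (simp add: gmap_def joint_constr_def)

lemma blk_in_blkspace: "blk own k u \<in> blkspace own k"
  by (simp add: blk_def blkspace_def)

lemma joint_constr_feas:
  "(\<forall>i. joint_constr P i (x, y) \<le> 0) \<longleftrightarrow> (\<forall>\<omega>. blk (fown P) \<omega> y \<in> feas P \<omega> x)"
  by (auto simp: joint_constr_def feas_def blk_in_blkspace)

lemma joint_constr_grad:
  assumes "\<And>i. Ck 2 (joint_constr P i)"
  shows "((\<lambda>y. joint_constr P i (x, y)) has_derivative (\<lambda>h. constr_grad P i (x, y) \<bullet> h)) (at y)"
proof -
  have "Ck 1 (joint_constr P i)" using assms by (rule Ck_2_imp_Ck_1)
  from Ck_1_has_derivative[OF this, of "(x, y)"]
  have D: "(joint_constr P i has_derivative frechet_derivative (joint_constr P i) (at (x, y))) (at (x, y))" .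
  have "((\<lambda>y. (x, y)) has_derivative (\<lambda>h. (0, h))) (at y)" by (auto intro!: derivative_eq_intros)
  from has_derivative_compose[OF this D]
  have *: "((\<lambda>y. joint_constr P i (x, y)) has_derivative (\<lambda>h. frechet_derivative (joint_constr P i) (at (x, y)) (0, h))) (at y)" .
  have "frechet_derivative (joint_constr P i) (at (x, y)) (0, h) = constr_grad P i (x, y) \<bullet> h" for h
    unfolding constr_grad_def by (rule linear_inner_vec[OF has_derivative_linear[OF *]])
  with * show ?thesis by (simp only:)
qed

text \<open>Shifting the blocks of other followers leaves the joint constraint unchanged, so the
  base point can be moved from the projected vector to \<open>y\<close>.\<close>

lemma constr_grad_eq_pgrad:
  assumes "\<And>i. Ck 2 (joint_constr P i)"
  shows "pgrad (fown P) (cown P i) (\<lambda>u. constr P i (x, u)) (blk (fown P) (cown P i) y) = constr_grad P i (x, y)"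
proof -
  define b where "b = blk (fown P) (cown P i)"
  have upd: "upd (fown P) (cown P i) (b y) u = b u" for u
    by (auto simp: b_def upd_def blk_def vec_eq_iff)
  have shift: "joint_constr P i (x, u + (y - b y)) = joint_constr P i (x, u)" for u
  proof -
    have "b (u + (y - b y)) = b u" by (auto simp: b_def blk_def vec_eq_iff)
    then show ?thesis by (simp add: joint_constr_def flip: b_def)
  qed
  have "((\<lambda>u. joint_constr P i (x, u + (y - b y))) has_derivative (\<lambda>h. constr_grad P i (x, y) \<bullet> h)) (at (b y))"
    by (rule has_derivative_compose[where g = "\<lambda>u. joint_constr P i (x, u)" and g' = "\<lambda>h. constr_grad P i (x, y) \<bullet> h" and f' = "\<lambda>h. h"])
       (use joint_constr_grad[OF assms, of i x y] in \<open>auto intro!: derivative_eq_intros\<close>)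
  then have "((\<lambda>u. constr P i (x, b u)) has_derivative (\<lambda>h. constr_grad P i (x, y) \<bullet> h)) (at (b y))"
    unfolding shift by (simp add: joint_constr_def b_def)
  from frechet_derivative_at[OF this, symmetric]
  show ?thesis by (simp add: pgrad_def grad_def upd inner_axis vec_eq_iff flip: b_def)
qed

text \<open>A constraint is constant along every axis owned by another follower, hence has
  derivative 0 there.\<close>

lemma constr_grad_in_blkspace:
  assumes "\<And>i. Ck 2 (joint_constr P i)"
  shows "constr_grad P i p \<in> blkspace (fown P) (cown P i)"
proof -
  obtain x y where p: "p = (x, y)" by fastforce
  have "constr_grad P i (x, y) $ j = 0" if "fown P j \<noteq> cown P i" for j
  proof -
    define b where "b = blk (fown P) (cown P i)"
    have inv: "joint_constr P i (x, y + t *\<^sub>R axis j 1) = joint_constr P i (x, y)" for t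
    proof -
      have "b (y + t *\<^sub>R axis j 1) = b y" using that by (auto simp: b_def blk_def vec_eq_iff axis_def)
      then show ?thesis by (simp add: joint_constr_def flip: b_def)
    qed
    have "((\<lambda>t. y + t *\<^sub>R axis j 1) has_derivative (\<lambda>t. t *\<^sub>R axis j 1)) (at 0)"
      by (auto intro!: derivative_eq_intros)
    moreover have "((\<lambda>u. joint_constr P i (x, u)) has_derivative (\<lambda>h. constr_grad P i (x, y) \<bullet> h))
        (at (y + 0 *\<^sub>R axis j 1))"
      using joint_constr_grad[OF assms, of i x y] by simp
    ultimately have "((\<lambda>t. joint_constr P i (x, y + t *\<^sub>R axis j 1)) has_derivative (\<lambda>t. constr_grad P i (x, y) \<bullet> (t *\<^sub>R axis j 1))) (at 0)"
      by (rule has_derivative_compose)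
    then have "((\<lambda>t::real. joint_constr P i (x, y)) has_derivative (\<lambda>t. constr_grad P i (x, y) \<bullet> (t *\<^sub>R axis j 1))) (at 0)"
      by (simp only: inv)
    from has_derivative_unique[OF this has_derivative_const]
    have "constr_grad P i (x, y) \<bullet> (1 *\<^sub>R axis j 1) = 0" by metis
    then show ?thesis by (simp add: inner_axis)
  qed
  then show ?thesis by (simp add: blkspace_def p)
qed

lemma blk_sum: "(\<Sum>\<omega>\<in>UNIV. blk own (\<omega> :: 'k::finite) y) = y"
  by (simp add: vec_eq_iff blk_def sum.delta)

text \<open>Gradients of different followers are supported on disjoint blocks. Projecting a
  vanishing combination on one block therefore isolates that follower's active gradients.\<close>

lemma licq_imp_independent:
  fixes P :: "('N, 'M::finite, 'n::finite, 'm::finite, 'l::finite) mlf_game" and c :: "'l \<Rightarrow> real"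
  assumes C2: "\<And>i. Ck 2 (joint_constr P i)"
    and licq: "\<And>\<omega>. licq P \<omega> x (blk (fown P) \<omega> y)"
    and c: "(\<Sum>i | joint_constr P i (x, y) = 0. c i *\<^sub>R constr_grad P i (x, y)) = 0"
    and i: "joint_constr P i (x, y) = 0"
  shows "c i = 0"
proof -
  define \<omega> where "\<omega> = cown P i"
  define A where "A = {i. cown P i = \<omega> \<and> constr P i (x, blk (fown P) \<omega> y) = 0}"
  have A: "A = {j. joint_constr P j (x, y) = 0} \<inter> {j. cown P j = \<omega>}"
    by (auto simp: A_def joint_constr_def)
  interpret b: bounded_linear "blk (fown P) \<omega> :: real^'m \<Rightarrow> real^'m" by (rule bounded_linear_blk)
  have blk_grad: "blk (fown P) \<omega> (constr_grad P j (x, y)) = (if cown P j = \<omega> then constr_grad P j (x, y) else 0)" for j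
    using constr_grad_in_blkspace[OF C2, of j "(x, y)"] by (auto simp: blkspace_def blk_def vec_eq_iff)
  have "(\<Sum>j\<in>A. c j *\<^sub>R pgrad (fown P) \<omega> (\<lambda>u. constr P j (x, u)) (blk (fown P) \<omega> y))
      = (\<Sum>j\<in>A. c j *\<^sub>R constr_grad P j (x, y))"
    by (rule sum.cong) (auto simp: A_def constr_grad_eq_pgrad[OF C2, symmetric])
  also have "\<dots> = (\<Sum>j | joint_constr P j (x, y) = 0. c j *\<^sub>R blk (fown P) \<omega> (constr_grad P j (x, y)))"
    unfolding A blk_grad by (rule sum.mono_neutral_cong_left) auto
  also have "\<dots> = blk (fown P) \<omega> (\<Sum>j | joint_constr P j (x, y) = 0. c j *\<^sub>R constr_grad P j (x, y))"
    by (simp add: b.sum b.scaleR)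
  also have "\<dots> = 0" by (simp add: c)
  finally have "\<forall>j\<in>A. c j = 0"
    using licq[of \<omega>] unfolding licq_def Let_def A_def by blast
  moreover have "i \<in> A" using i by (simp add: A \<omega>_def)
  ultimately show ?thesis by blast
qed

lemma linear_pair_snd_vec:
  fixes f :: "'a::euclidean_space \<times> (real^'m) \<Rightarrow> real"
  assumes "linear f" shows "f (0, h) = (\<chi> j. f (0, axis j 1)) \<bullet> h"
proof -
  have "linear (\<lambda>h. f (0, h))"
    by (intro linearI) (metis (no_types) assms linear_add add_Pair add_0, metis (no_types) assms linear_scale scaleR_Pair scaleR_zero_right)
  then show ?thesis by (rule linear_inner_vec)
qed

lemma tjac_nth:
  "tjac F p $ i $ j = frechet_derivative F (at p) (axis i 1) $ j"
  by (simp add: tjac_def jacobian_def matrix_def transpose_def)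

text \<open>The joint feasible set is the product of the individual ones, so the blockwise
  hypotheses turn into those of \<open>follower_system\<close>, and \<open>Hmap\<close> is its
  residual.\<close>

lemma game_solution_map:
  fixes P :: "('N::finite, 'M::finite, 'n::finite, 'm::finite, 'l::finite) mlf_game"
  assumes F1_smooth: "\<And>\<omega>. Ck 2 (fcost P \<omega>)"
      "\<And>i. Ck 2 (\<lambda>(x, y). constr P i (x, blk (fown P) (cown P i) y))"
    and F2: "\<And>\<omega> x. feas P \<omega> x \<noteq> {} \<and> convex (feas P \<omega> x) \<and> compact (feas P \<omega> x)"
    and F3: "\<And>\<omega> x v. x \<in> profiles P \<Longrightarrow> v \<in> feas P \<omega> x \<Longrightarrow> licq P \<omega> x v"
    and PD: "\<And>x y h. h \<noteq> 0 \<Longrightarrow> h \<bullet> (jacobian (Gmap P x) (at y) *v h) > 0"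
    and x0: "x0 \<in> profiles P"
  obtains U v L where "open U" "(0, x0) \<in> U" "L-lipschitz_on U (\<lambda>(\<epsilon>, x). v \<epsilon> x)"
    "\<And>\<epsilon> x w. (\<epsilon>, x) \<in> U \<Longrightarrow> Hmap P \<epsilon> x w = 0 \<longleftrightarrow> w = v \<epsilon> x"
    "\<And>\<epsilon> x. (\<epsilon>, x) \<in> U \<Longrightarrow> \<epsilon> \<noteq> 0 \<Longrightarrow> v \<epsilon> differentiable (at x)"
proof -
  have C2: "Ck 2 (joint_constr P i)" for i unfolding joint_constr_def by (rule F1_smooth)
  define G where "G = (\<lambda>(x, y). Gmap P x y)"
  define G' where "G' p = frechet_derivative G (at p)" for p
  define g' where "g' i p = frechet_derivative (joint_constr P i) (at p)" for i p
  define a' where "a' i p = frechet_derivative (constr_grad P i) (at p)" for i p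
  have sndB: "(0, axis j 1) \<in> (Basis :: ((real^'n) \<times> (real^'m)) set)" for j
    by (simp add: Basis_prod_def axis_in_Basis_iff)
  have Ck1: "Ck 1 (\<lambda>p. frechet_derivative f (at p) (0, axis j 1))"
    if "Ck 2 f" for f :: "(real^'n) \<times> (real^'m) \<Rightarrow> real" and j
  proof -
    have "Ck (Suc 1) f" using that by (simp only: Suc_1)
    then show ?thesis using sndB unfolding Ck.simps(2) by blast
  qed
  have G_strict: "strict_derivative G (G' p) p" for p
  proof -
    have "(\<lambda>p. G p $ j) = (\<lambda>p. frechet_derivative (fcost P (fown P j)) (at p) (0, axis j 1))" for j
      by (auto simp: G_def Gmap_component[OF F1_smooth(1)])
    then have "strict_derivative G (\<lambda>h. \<chi> j. frechet_derivative (\<lambda>p. G p $ j) (at p) h) p"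
      by (intro strict_derivative_vec) (simp only: Ck_1_strict_derivative Ck1 F1_smooth)
    then show ?thesis unfolding G'_def by (rule strict_derivative_frechet)
  qed
  have g_strict: "strict_derivative (joint_constr P i) (g' i p) p" for i p
    unfolding g'_def by (rule Ck_1_strict_derivative[OF Ck_2_imp_Ck_1[OF C2]])
  have a_strict: "strict_derivative (constr_grad P i) (a' i p) p" for i p
  proof -
    have "(\<lambda>p. constr_grad P i p $ j) = (\<lambda>p. frechet_derivative (joint_constr P i) (at p) (0, axis j 1))" for j
      by (simp add: constr_grad_def)
    then have "strict_derivative (constr_grad P i) (\<lambda>h. \<chi> j. frechet_derivative (\<lambda>p. constr_grad P i p $ j) (at p) h) p"
      by (intro strict_derivative_vec) (simp only: Ck_1_strict_derivative Ck1 C2)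
    then show ?thesis unfolding a'_def by (rule strict_derivative_frechet)
  qed
  have feas: "{y. \<forall>i. joint_constr P i (x, y) \<le> 0} = {y. \<forall>\<omega>. blk (fown P) \<omega> y \<in> feas P \<omega> x}" for x
    by (simp only: joint_constr_feas)
  have loc: "follower_system G (joint_constr P) (constr_grad P) G' g' a' (profiles P)"
  proof
    fix i p and h :: "real^'m"
    show "g' i p (0, h) = constr_grad P i p \<bullet> h"
      unfolding g'_def constr_grad_def
      by (rule linear_pair_snd_vec) (use g_strict[of i p] in \<open>simp add: g'_def strict_derivative_bounded_linear bounded_linear.linear\<close>)
  next
    fix p :: "(real^'n) \<times> (real^'m)" and h :: "real^'m" assume h: "h \<noteq> 0"
    obtain x y where p: "p = (x, y)" by fastforce
    have "((\<lambda>y. (x, y)) has_derivative (\<lambda>h. (0, h))) (at y)" by (auto intro!: derivative_eq_intros)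
    from has_derivative_compose[OF this strict_derivative_imp_has_derivative[OF G_strict]]
    have D: "(Gmap P x has_derivative (\<lambda>h. G' (x, y) (0, h))) (at y)" by (simp add: G_def)
    then have "(Gmap P x has_derivative (\<lambda>h. jacobian (Gmap P x) (at y) *v h)) (at y)"
      using jacobian_works differentiableI by blast
    from has_derivative_unique[OF this D] have "jacobian (Gmap P x) (at y) *v h = G' (x, y) (0, h)" by metis
    with PD[OF h, of x y] show "0 < h \<bullet> G' p (0, h)" by (simp add: p)
  next
    fix x
    have "\<forall>\<omega>. \<exists>v. v \<in> feas P \<omega> x" using F2 by blast
    from choice[OF this] obtain v where v: "\<And>\<omega>. v \<omega> \<in> feas P \<omega> x" by blast
    \<comment> \<open>Each coordinate is taken from the feasible strategy of its owner, which glues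
      the strategies into one joint feasible vector.\<close>
    have "blk (fown P) \<omega> (\<chi> j. v (fown P j) $ j) = v \<omega>" for \<omega>
      using v[of \<omega>] by (auto simp: feas_def blkspace_def blk_def vec_eq_iff)
    then have "(\<chi> j. v (fown P j) $ j) \<in> {y. \<forall>\<omega>. blk (fown P) \<omega> y \<in> feas P \<omega> x}"
      using v by simp
    then show "{y. \<forall>i. joint_constr P i (x, y) \<le> 0} \<noteq> {}" unfolding feas by blast
    show "convex {y. \<forall>i. joint_constr P i (x, y) \<le> 0}"
      unfolding feas
    proof (rule convexI, safe)
      fix y z :: "real^'m" and s t :: real and \<omega>
      assume *: "\<forall>\<omega>. blk (fown P) \<omega> y \<in> feas P \<omega> x" "\<forall>\<omega>. blk (fown P) \<omega> z \<in> feas P \<omega> x" "0 \<le> s" "0 \<le> t" "s + t = 1"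
      have "blk (fown P) \<omega> (s *\<^sub>R y + t *\<^sub>R z) = s *\<^sub>R blk (fown P) \<omega> y + t *\<^sub>R blk (fown P) \<omega> z"
        by (simp add: blk_def vec_eq_iff)
      also have "\<dots> \<in> feas P \<omega> x" using * F2 by (intro convexD) auto
      finally show "blk (fown P) \<omega> (s *\<^sub>R y + t *\<^sub>R z) \<in> feas P \<omega> x" .
    qed
    show "compact {y. \<forall>i. joint_constr P i (x, y) \<le> 0}"
      unfolding compact_eq_bounded_closed
    proof
      have "bounded (feas P \<omega> x)" for \<omega> using F2 compact_imp_bounded by blast
      then have "\<forall>\<omega>. \<exists>B. \<forall>v\<in>feas P \<omega> x. norm v \<le> B" by (simp add: bounded_iff)
      from choice[OF this] obtain B where B: "\<And>\<omega> v. v \<in> feas P \<omega> x \<Longrightarrow> norm v \<le> B \<omega>" by blast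
      have "norm y \<le> (\<Sum>\<omega>\<in>UNIV. B \<omega>)" if "\<forall>\<omega>. blk (fown P) \<omega> y \<in> feas P \<omega> x" for y
      proof -
        have "norm (\<Sum>\<omega>\<in>UNIV. blk (fown P) \<omega> y) \<le> (\<Sum>\<omega>\<in>UNIV. B \<omega>)"
          by (rule sum_norm_le) (use that B in blast)
        then show ?thesis by (simp only: blk_sum)
      qed
      then show "bounded {y. \<forall>i. joint_constr P i (x, y) \<le> 0}" unfolding feas bounded_iff by blast
      have "continuous_on UNIV (\<lambda>y. joint_constr P i (x, y))" for i
        using joint_constr_grad[OF C2] has_derivative_continuous by (intro continuous_at_imp_continuous_on) blast
      then show "closed {y. \<forall>i. joint_constr P i (x, y) \<le> 0}"
        by (intro closed_Collect_all closed_Collect_le) (auto intro: continuous_intros)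
    qed
  next
    fix x y and c :: "'l \<Rightarrow> real"
    assume x: "x \<in> profiles P" and f: "\<forall>i. joint_constr P i (x, y) \<le> 0"
      and c: "(\<Sum>i | joint_constr P i (x, y) = 0. c i *\<^sub>R constr_grad P i (x, y)) = 0"
    have "\<forall>\<omega>. blk (fown P) \<omega> y \<in> feas P \<omega> x" using f unfolding joint_constr_feas .
    then have "licq P \<omega> x (blk (fown P) \<omega> y)" for \<omega> by (intro F3[OF x]) blast
    from licq_imp_independent[OF C2 this c]
    show "\<forall>i\<in>{i. joint_constr P i (x, y) = 0}. c i = 0" by blast
  qed (rule G_strict g_strict a_strict)+
  then interpret follower_system G "joint_constr P" "constr_grad P" G' g' a' "profiles P" .
  \<comment> \<open>The columns of the transposed Jacobian are the constraint gradients.\<close>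
  have tj: "tjac (gmap P x) y *v \<mu> = (\<Sum>i\<in>UNIV. \<mu> $ i *\<^sub>R constr_grad P i (x, y))" for x y \<mu>
  proof -
    have D: "(gmap P x has_derivative (\<lambda>h. \<chi> i. constr_grad P i (x, y) \<bullet> h)) (at y)"
      unfolding gmap_eq[abs_def]
      by (intro has_derivative_vec_lambda joint_constr_grad[OF C2])
    have "tjac (gmap P x) y $ j $ i = constr_grad P i (x, y) $ j" for i j
      unfolding tjac_nth frechet_derivative_at[OF D, symmetric] by (simp add: inner_axis)
    then show ?thesis by (simp add: vec_eq_iff matrix_vector_mult_def mult.commute)
  qed
  have H: "Hmap P \<epsilon> x w = residual \<epsilon> x w" for \<epsilon> x w
    unfolding Hmap_def residual_def tj gmap_eq by (simp add: G_def case_prod_unfold)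
  show thesis
  proof (rule solution_map[OF x0])
    fix U v L
    assume "open U" "(0, x0) \<in> U" "L-lipschitz_on U (\<lambda>(\<epsilon>, x). v \<epsilon> x)"
      "\<And>\<epsilon> x w. (\<epsilon>, x) \<in> U \<Longrightarrow> residual \<epsilon> x w = 0 \<longleftrightarrow> w = v \<epsilon> x"
      "\<And>\<epsilon> x. (\<epsilon>, x) \<in> U \<Longrightarrow> \<epsilon> \<noteq> 0 \<Longrightarrow> v \<epsilon> differentiable (at x)"
    then show thesis unfolding H[symmetric] by (rule that)
  qed
qed

section \<open>Germs of the extended response\<close>

lemma wext_at_solution_map:
  assumes U: "open U" "L-lipschitz_on U (\<lambda>(\<epsilon>, x). v \<epsilon> x)"
    and sol: "\<And>\<epsilon> x w. (\<epsilon>, x) \<in> U \<Longrightarrow> Hmap P \<epsilon> x w = 0 \<longleftrightarrow> w = v \<epsilon> x"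
    and p: "(\<epsilon>0, x0) \<in> U"
  shows "wext_at P \<epsilon>0 x0 v"
  unfolding wext_at_def
proof (intro exI[of _ U] exI[of _ L] conjI allI impI)
  show "L-lipschitz_on (U \<inter> {0..} \<times> UNIV) (\<lambda>(\<epsilon>, x). v \<epsilon> x)"
    by (rule lipschitz_on_subset[OF U(2)]) simp
  fix \<epsilon> x assume "(\<epsilon>, x) \<in> U \<and> \<epsilon> \<ge> 0"
  then have *: "(\<epsilon>, x) \<in> U" by simp
  show "Hmap P \<epsilon> x (v \<epsilon> x) = 0" using sol[OF *] by simp
  show "v \<epsilon> x = wsol P \<epsilon> x" unfolding wsol_def using sol[OF *] by simp
qed (use U p in auto)

text \<open>The choice inside \<open>yext\<close> is harmless: any extension solves the equation
  near the point for nonnegative \<epsilon>, and on \<open>U\<close> the equation has exactly one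
  solution.\<close>

lemma eventually_yext_eq:
  assumes U: "open U" "L-lipschitz_on U (\<lambda>(\<epsilon>, x). v \<epsilon> x)"
    and sol: "\<And>\<epsilon> x w. (\<epsilon>, x) \<in> U \<Longrightarrow> Hmap P \<epsilon> x w = 0 \<longleftrightarrow> w = v \<epsilon> x"
    and p: "(\<epsilon>0, x0) \<in> U" "\<epsilon>0 \<ge> 0"
  shows "eventually (\<lambda>x. yext P \<epsilon>0 x0 x = fst (v \<epsilon>0 x)) (nhds x0)"
proof -
  define v' where "v' = (SOME v. wext_at P \<epsilon>0 x0 v)"
  have "wext_at P \<epsilon>0 x0 v" using U sol p(1) by (rule wext_at_solution_map)
  then have "wext_at P \<epsilon>0 x0 v'" unfolding v'_def by (rule someI[of "wext_at P \<epsilon>0 x0"])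
  then obtain U' where U': "open U'" "(\<epsilon>0, x0) \<in> U'"
      "\<And>\<epsilon> x. (\<epsilon>, x) \<in> U' \<Longrightarrow> \<epsilon> \<ge> 0 \<Longrightarrow> Hmap P \<epsilon> x (v' \<epsilon> x) = 0"
    unfolding wext_at_def by blast
  have "open ((\<lambda>x. (\<epsilon>0, x)) -` (U \<inter> U'))"
    by (rule open_vimage) (use U U' in \<open>auto intro!: continuous_intros\<close>)
  then have "eventually (\<lambda>x. x \<in> (\<lambda>x. (\<epsilon>0, x)) -` (U \<inter> U')) (nhds x0)"
    by (rule eventually_nhds_in_open) (use p U' in auto)
  then show ?thesis
  proof eventually_elim
    case (elim x)
    then have "v' \<epsilon>0 x = v \<epsilon>0 x" using sol[of \<epsilon>0 x] U'(3)[of \<epsilon>0 x] p by auto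
    then show ?case by (simp add: yext_def v'_def)
  qed
qed

section \<open>Clarke gradients of the reduced objectives\<close>

text \<open>The vectors obeying the bound form a half-space, everything or nothing, hence a convex
  set; so it suffices to treat limits of gradients.\<close>

lemma clarke_grad_le_clarke_dd:
  fixes f :: "real^'p \<Rightarrow> real"
  assumes "v \<in> clarke_grad f x"
  shows "ereal (v \<bullet> d) \<le> clarke_dd f x d"
proof -
  define A where "A = {v. ereal (v \<bullet> d) \<le> clarke_dd f x d}"
  have "convex A"
  proof (cases "clarke_dd f x d")
    case (real c)
    then have "A = {v. d \<bullet> v \<le> c}" by (simp add: A_def inner_commute)
    then show ?thesis by (simp add: convex_halfspace_le)
  qed (simp_all add: A_def)
  moreover have "v \<in> A" if lim: "u \<longlonglongrightarrow> x" "\<And>j. f differentiable (at (u j))" "(\<lambda>j. grad f (u j)) \<longlonglongrightarrow> v" for u v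
  proof (rule ccontr)
    assume "v \<notin> A"
    then obtain c where c: "clarke_dd f x d < ereal c" "c < v \<bullet> d"
      using ereal_dense2[of "clarke_dd f x d" "ereal (v \<bullet> d)"] by (auto simp: A_def not_le)
    have "eventually (\<lambda>p. (case p of (u, t) \<Rightarrow> ereal ((f (u + t *\<^sub>R d) - f u) / t)) < ereal c) (nhds x \<times>\<^sub>F at_right 0)"
      using c(1) unfolding clarke_dd_def by (rule Limsup_lessD)
    then have "eventually (\<lambda>(u, t). (f (u + t *\<^sub>R d) - f u) / t < c) (nhds x \<times>\<^sub>F at_right 0)"
      by (simp add: case_prod_unfold)
    then obtain Pu Pt where ev: "eventually Pu (nhds x)" "eventually Pt (at_right (0::real))"
        "\<And>u t. Pu u \<Longrightarrow> Pt t \<Longrightarrow> (f (u + t *\<^sub>R d) - f u) / t < c"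
      unfolding eventually_prod_filter by blast
    \<comment> \<open>A late \<open>u j\<close> is itself an admissible base point of the limsup, so
      letting \<open>t\<close> decrease to 0 there bounds the directional derivative by
      \<open>c\<close>.\<close>
    have "eventually (\<lambda>j. Pu (u j)) sequentially" using ev(1) lim(1) by (rule eventually_compose_filterlim)
    then have "eventually (\<lambda>j. grad f (u j) \<bullet> d \<le> c) sequentially"
    proof eventually_elim
      case (elim j)
      define f' where "f' = frechet_derivative f (at (u j))"
      have D: "(f has_derivative f') (at (u j))" using lim(2) unfolding f'_def by (simp add: frechet_derivative_works)
      have g: "grad f (u j) \<bullet> d = f' d" unfolding grad_def f'_def[symmetric]
        by (rule linear_inner_vec[OF has_derivative_linear[OF D], symmetric])
      have "((\<lambda>t. u j + t *\<^sub>R d) has_vector_derivative d) (at 0)" by (auto intro!: derivative_eq_intros)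
      from vector_derivative_diff_chain_within[OF this, of f f'] D
      have "((\<lambda>t. f (u j + t *\<^sub>R d)) has_real_derivative f' d) (at 0)"
        by (simp add: o_def has_derivative_at_withinI has_real_derivative_iff_has_vector_derivative)
      then have "((\<lambda>t. (f (u j + t *\<^sub>R d) - f (u j)) / t) \<longlongrightarrow> f' d) (at 0)"
        by (simp add: DERIV_def)
      then have "((\<lambda>t. (f (u j + t *\<^sub>R d) - f (u j)) / t) \<longlongrightarrow> f' d) (at_right 0)"
        by (rule tendsto_mono[OF at_le, rotated]) simp
      moreover have "eventually (\<lambda>t. (f (u j + t *\<^sub>R d) - f (u j)) / t \<le> c) (at_right 0)"
        using ev(2) by eventually_elim (use ev(3) elim less_imp_le in blast)
      ultimately show ?case unfolding g by (rule tendsto_upperbound) simp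
    qed
    then have "v \<bullet> d \<le> c" using tendsto_inner[OF lim(3) tendsto_const[of d]]
      by (intro tendsto_upperbound[of "\<lambda>j. grad f (u j) \<bullet> d"]) auto
    with c(2) show False by simp
  qed
  ultimately have "clarke_grad f x \<subseteq> A" unfolding clarke_grad_def by (intro hull_minimal) blast+
  with assms show ?thesis by (auto simp: A_def)
qed

text \<open>The chain rule with the response's transposed Jacobian as a free argument, so that it
  can be evaluated at limits and convex combinations of Jacobians.\<close>

definition chain_grad :: "('n \<Rightarrow> 'N) \<Rightarrow> 'N \<Rightarrow> ((real^'n) \<times> (real^'m) \<Rightarrow> real) \<Rightarrow> (real^'n) \<times> (real^'m) \<Rightarrow>
    real^'m^'n \<Rightarrow> real^'n" where
  "chain_grad own \<nu> \<theta> p J = (\<chi> i. (if own i = \<nu> then frechet_derivative \<theta> (at p) (axis i 1, 0) else 0) +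
     (\<Sum>j\<in>UNIV. J $ i $ j * frechet_derivative \<theta> (at p) (0, axis j 1)))"

lemma grad_chain:
  fixes c :: "real^'n \<Rightarrow> real^'m"
  assumes \<theta>: "Ck 1 \<theta>" and c: "c differentiable (at p)"
  shows "(\<lambda>u. \<theta> (upd own \<nu> z u, c u)) differentiable (at p)"
    and "grad (\<lambda>u. \<theta> (upd own \<nu> z u, c u)) p = chain_grad own \<nu> \<theta> (upd own \<nu> z p, c p) (tjac c p)"
proof -
  define \<theta>' where "\<theta>' = frechet_derivative \<theta> (at (upd own \<nu> z p, c p))"
  define c' where "c' = frechet_derivative c (at p)"
  have t: "(\<theta> has_derivative \<theta>') (at (upd own \<nu> z p, c p))"
    unfolding \<theta>'_def by (rule Ck_1_has_derivative[OF \<theta>])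
  have lin: "linear \<theta>'" by (rule has_derivative_linear[OF t])
  have "(c has_derivative c') (at p)" using c by (simp add: c'_def frechet_derivative_works)
  then have "((\<lambda>u. (upd own \<nu> z u, c u)) has_derivative (\<lambda>h. (blk own \<nu> h, c' h))) (at p)"
    by (intro has_derivative_Pair upd_has_derivative)
  from has_derivative_compose[OF this t]
  have D: "((\<lambda>u. \<theta> (upd own \<nu> z u, c u)) has_derivative (\<lambda>h. \<theta>' (blk own \<nu> h, c' h))) (at p)" .
  then show "(\<lambda>u. \<theta> (upd own \<nu> z u, c u)) differentiable (at p)" by (rule differentiableI)
  have split: "\<theta>' (a, b) = \<theta>' (a, 0) + (\<Sum>j\<in>UNIV. b $ j * \<theta>' (0, axis j 1))" for a b
  proof -
    have "\<theta>' (a, b) = \<theta>' (a, 0) + \<theta>' (0, b)" using linear_add[OF lin, of "(a, 0)" "(0, b)"] by simp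
    also have "\<theta>' (0, b) = (\<chi> j. \<theta>' (0, axis j 1)) \<bullet> b" by (rule linear_pair_snd_vec[OF lin])
    finally show ?thesis by (simp add: inner_vec_def mult.commute)
  qed
  have z: "\<theta>' (0, 0) = 0" using linear_0[OF lin] by (simp add: zero_prod_def)
  show "grad (\<lambda>u. \<theta> (upd own \<nu> z u, c u)) p = chain_grad own \<nu> \<theta> (upd own \<nu> z p, c p) (tjac c p)"
    unfolding grad_def chain_grad_def frechet_derivative_at[OF D, symmetric] \<theta>'_def[symmetric]
    by (subst split) (simp add: vec_eq_iff tjac_nth blk_axis z flip: c'_def)
qed

lemma tendsto_chain_grad:
  assumes \<theta>: "Ck 1 \<theta>" and p: "(p \<longlongrightarrow> p0) F" and J: "(J \<longlongrightarrow> J0) F"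
  shows "((\<lambda>k. chain_grad own \<nu> \<theta> (p k) (J k)) \<longlongrightarrow> chain_grad own \<nu> \<theta> p0 J0) F"
proof -
  have D: "((\<lambda>k. frechet_derivative \<theta> (at (p k)) h) \<longlongrightarrow> frechet_derivative \<theta> (at p0) h) F" for h
    by (rule isCont_tendsto_compose[OF Ck_1_isCont_derivative[OF \<theta>] p])
  have "((\<lambda>k. if own i = \<nu> then frechet_derivative \<theta> (at (p k)) (axis i 1, 0) else 0) \<longlongrightarrow>
      (if own i = \<nu> then frechet_derivative \<theta> (at p0) (axis i 1, 0) else 0)) F" for i
    using D by simp
  then show ?thesis unfolding chain_grad_def
    by (intro vec_tendstoI) (auto intro!: tendsto_intros D J)
qed

text \<open>The formula is affine in the Jacobian: the leader's own partial derivatives form its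
  constant part, whence weights of sum 1.\<close>

lemma chain_grad_convex_combination:
  assumes "s + t = 1"
  shows "chain_grad own \<nu> \<theta> p (s *\<^sub>R J + t *\<^sub>R J') = s *\<^sub>R chain_grad own \<nu> \<theta> p J + t *\<^sub>R chain_grad own \<nu> \<theta> p J'"
proof -
  have *: "s * a + t * a = a" for a :: real using assms by (metis distrib_right mult_1)
  show ?thesis unfolding chain_grad_def
    by (simp add: vec_eq_iff distrib_left distrib_right sum.distrib sum_distrib_left mult.assoc *)
qed

text \<open>Every point where \<open>c\<close> is differentiable is one for the composite, so limits
  of Jacobians give limits of gradients; affinity extends this to convex hulls.\<close>

lemma chain_grad_in_clarke_grad:
  assumes \<theta>: "Ck 1 \<theta>" and c: "isCont c x" and J: "J \<in> clarke_jac c x"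
  shows "chain_grad own \<nu> \<theta> (upd own \<nu> z x, c x) J \<in> clarke_grad (\<lambda>u. \<theta> (upd own \<nu> z u, c u)) x"
proof -
  define A where "A = {J. chain_grad own \<nu> \<theta> (upd own \<nu> z x, c x) J \<in> clarke_grad (\<lambda>u. \<theta> (upd own \<nu> z u, c u)) x}"
  have conv: "convex (clarke_grad (\<lambda>u. \<theta> (upd own \<nu> z u, c u)) x)"
    unfolding clarke_grad_def by (rule convex_convex_hull)
  have "convex A"
  proof (rule convexI)
    fix J J' and s t :: real assume "J \<in> A" "J' \<in> A" "0 \<le> s" "0 \<le> t" "s + t = 1"
    then show "s *\<^sub>R J + t *\<^sub>R J' \<in> A"
      using convexD[OF conv] by (simp add: A_def chain_grad_convex_combination)
  qed
  moreover have "J \<in> A" if u: "u \<longlonglongrightarrow> x" "\<And>j. c differentiable (at (u j))" "(\<lambda>j. tjac c (u j)) \<longlonglongrightarrow> J" for u J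
  proof -
    have "isCont (upd own \<nu> z) x" by (rule has_derivative_continuous[OF upd_has_derivative])
    from isCont_tendsto_compose[OF this u(1)] isCont_tendsto_compose[OF c u(1)]
    have "(\<lambda>j. (upd own \<nu> z (u j), c (u j))) \<longlonglongrightarrow> (upd own \<nu> z x, c x)"
      by (rule tendsto_Pair)
    then have "(\<lambda>j. grad (\<lambda>u. \<theta> (upd own \<nu> z u, c u)) (u j)) \<longlonglongrightarrow> chain_grad own \<nu> \<theta> (upd own \<nu> z x, c x) J"
      unfolding grad_chain(2)[OF \<theta> u(2)] by (rule tendsto_chain_grad[OF \<theta> _ u(3)])
    then show ?thesis unfolding A_def clarke_grad_def
      using u(1) grad_chain(1)[OF \<theta> u(2)] by (intro CollectI hull_inc exI[of _ u]) auto
  qed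
  ultimately have "clarke_jac c x \<subseteq> A" unfolding clarke_jac_def by (intro hull_minimal) blast+
  with J show ?thesis by (auto simp: A_def)
qed

lemma pgrad_in_blkspace:
  assumes "(\<lambda>u. f (upd own \<nu> x u)) differentiable (at x)"
  shows "pgrad own \<nu> f x \<in> blkspace own \<nu>"
proof -
  define F where "F u = f (upd own \<nu> x u)" for u
  define F' where "F' = frechet_derivative F (at x)"
  have D: "(F has_derivative F') (at (upd own \<nu> x x))"
    using assms unfolding F'_def F_def[abs_def] by (simp add: frechet_derivative_works)
  have "upd own \<nu> x (upd own \<nu> x u) = upd own \<nu> x u" for u by (simp add: upd_def vec_eq_iff)
  then have "(\<lambda>u. F (upd own \<nu> x u)) = F" by (simp add: F_def[abs_def])
  with has_derivative_compose[OF upd_has_derivative D]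
  have "(F has_derivative (\<lambda>h. F' (blk own \<nu> h))) (at x)" by simp
  with D have "F' = (\<lambda>h. F' (blk own \<nu> h))" by (simp add: has_derivative_unique)
  then have "F' (axis i 1) = 0" if "own i \<noteq> \<nu>" for i
    using that linear_0[OF has_derivative_linear[OF D]] by (metis blk_axis)
  then show ?thesis by (simp add: blkspace_def pgrad_def grad_def F'_def F_def[abs_def])
qed

section \<open>Limits of stationary equilibria\<close>

theorem theorem2:
  fixes P :: "('N::finite, 'M::finite, 'n::finite, 'm::finite, 'l::finite) mlf_game"
    and eps :: "nat \<Rightarrow> real" and xs :: "nat \<Rightarrow> real^'n" and xstar :: "real^'n"
    and r :: "nat \<Rightarrow> nat"
  assumes L1: "\<And>\<nu>. Ck 1 (lcost P \<nu>)"
    and L2: "\<And>\<nu>. strat P \<nu> \<subseteq> blkspace (lown P) \<nu> \<and> strat P \<nu> \<noteq> {} \<and> compact (strat P \<nu>)"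
    and F1_smooth: "\<And>\<omega>. Ck 2 (fcost P \<omega>)"
      "\<And>i. Ck 2 (\<lambda>(x, y). constr P i (x, blk (fown P) (cown P i) y))"
    and F1_convex: "\<And>\<omega> x y.
      convex_on (blkspace (fown P) \<omega>) (\<lambda>v. fcost P \<omega> (x, upd (fown P) \<omega> y v))"
    and F2: "\<And>\<omega> x. feas P \<omega> x \<noteq> {} \<and> convex (feas P \<omega> x) \<and> compact (feas P \<omega> x)"
    and F3: "\<And>\<omega> x v. x \<in> profiles P \<Longrightarrow> v \<in> feas P \<omega> x \<Longrightarrow> licq P \<omega> x v"
    and PD: "\<And>x y h. h \<noteq> 0 \<Longrightarrow> h \<bullet> (jacobian (Gmap P x) (at y) *v h) > 0"
    and eps: "\<And>k. eps k > 0" "eps \<longlonglongrightarrow> 0"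
    and stat: "\<And>k. stationary_NE P (eps k) (xs k)"
    and reg: "\<And>\<nu>. regular_set_in (blkspace (lown P) \<nu>) (strat P \<nu>)"
    and acc: "strict_mono r" "(\<lambda>k. xs (r k)) \<longlonglongrightarrow> xstar"
    and lim: "\<And>\<nu>. \<exists>J. (\<lambda>k. ptjac (lown P) \<nu> (yext P (eps (r k)) (xs (r k))) (xs (r k))) \<longlonglongrightarrow> J \<and>
      J \<in> clarke_jac (\<lambda>u. yext P 0 xstar (upd (lown P) \<nu> xstar u)) xstar"
  shows "C_stationary_NE P xstar \<and>
    ((\<forall>\<nu>. clarke_regular (reduced_obj P xstar \<nu>) xstar) \<longrightarrow> B_stationary_NE P xstar)"
proof -
  have blk_lim: "(\<lambda>k. blk (lown P) \<nu> (xs (r k))) \<longlonglongrightarrow> blk (lown P) \<nu> xstar" for \<nu>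
    using bounded_linear.tendsto[OF bounded_linear_blk acc(2)] .
  have xs_strat: "blk (lown P) \<nu> (xs k) \<in> strat P \<nu>" for \<nu> k
    using stat[of k] by (simp add: stationary_NE_def profiles_def)
  have xstar_strat: "blk (lown P) \<nu> xstar \<in> strat P \<nu>" for \<nu>
    using closed_sequentially[OF compact_imp_closed _ blk_lim] L2 xs_strat by blast
  then have xstar: "xstar \<in> profiles P" by (simp add: profiles_def)
  obtain U v L where U: "open U" "(0, xstar) \<in> U" "L-lipschitz_on U (\<lambda>(\<epsilon>, x). v \<epsilon> x)"
    and sol: "\<And>\<epsilon> x w. (\<epsilon>, x) \<in> U \<Longrightarrow> Hmap P \<epsilon> x w = 0 \<longleftrightarrow> w = v \<epsilon> x"
    and diff: "\<And>\<epsilon> x. (\<epsilon>, x) \<in> U \<Longrightarrow> \<epsilon> \<noteq> 0 \<Longrightarrow> v \<epsilon> differentiable (at x)"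
  proof (rule game_solution_map[OF F1_smooth F2 F3 PD xstar])
    fix U v L
    assume "open U" "(0, xstar) \<in> U" "L-lipschitz_on U (\<lambda>(\<epsilon>, x). v \<epsilon> x)"
      "\<And>\<epsilon> x w. (\<epsilon>, x) \<in> U \<Longrightarrow> Hmap P \<epsilon> x w = 0 \<longleftrightarrow> w = v \<epsilon> x"
      "\<And>\<epsilon> x. (\<epsilon>, x) \<in> U \<Longrightarrow> \<epsilon> \<noteq> 0 \<Longrightarrow> v \<epsilon> differentiable (at x)"
    then show thesis by (rule that)
  qed
  have yext_eq: "eventually (\<lambda>x. yext P \<epsilon>0 x0 x = fst (v \<epsilon>0 x)) (nhds x0)"
    if "(\<epsilon>0, x0) \<in> U" "\<epsilon>0 \<ge> 0" for \<epsilon>0 x0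
    using U(1,3) sol that by (rule eventually_yext_eq)
  have cont: "isCont (\<lambda>(\<epsilon>, x). v \<epsilon> x) p" if "p \<in> U" for p
    using lipschitz_on_continuous_on[OF U(3)] U(1) that by (simp add: continuous_on_eq_continuous_at)
  have ystar: "yext P 0 xstar xstar = fst (v 0 xstar)"
    using yext_eq[OF U(2) order.refl] eventually_nhds_x_imp_x by fastforce
  have ycont: "isCont (yext P 0 xstar) xstar"
  proof -
    have "isCont (\<lambda>x. (0::real, x)) xstar" by (intro continuous_intros)
    from isCont_o2[OF this, of "\<lambda>(\<epsilon>, x). v \<epsilon> x"] cont[OF U(2)]
    have "isCont (\<lambda>x. fst (v 0 x)) xstar" by (intro continuous_intros) simp
    then show ?thesis using isCont_cong[OF yext_eq[OF U(2) order.refl]] by simp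
  qed
  have seq: "(\<lambda>k. (eps (r k), xs (r k))) \<longlonglongrightarrow> (0, xstar)"
    using LIMSEQ_subseq_LIMSEQ[OF eps(2) acc(1)] acc(2) by (auto simp: o_def intro!: tendsto_Pair)
  have "eventually (\<lambda>k. (eps (r k), xs (r k)) \<in> U) sequentially"
    using seq U(1,2) by (rule topological_tendstoD)
  then obtain K where K: "\<And>k. k \<ge> K \<Longrightarrow> (eps (r k), xs (r k)) \<in> U" by (auto simp: eventually_sequentially)
  \<comment> \<open>Dropping \<open>K\<close> terms of the subsequence puts all parameters into
    \<open>U\<close>, where the response is the unique and differentiable solution map.\<close>
  define s where "s k = r (k + K)" for k
  have sU: "(eps (s k), xs (s k)) \<in> U" for k using K[of "k + K"] by (simp add: s_def)
  have slim: "(\<lambda>k. (eps (s k), xs (s k))) \<longlonglongrightarrow> (0, xstar)"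
    unfolding s_def by (rule LIMSEQ_ignore_initial_segment[OF seq])
  have xlim: "(\<lambda>k. xs (s k)) \<longlonglongrightarrow> xstar" using tendsto_snd[OF slim] by simp
  have yk: "yext P (eps (s k)) (xs (s k)) (xs (s k)) = fst (v (eps (s k)) (xs (s k)))" for k
    using eventually_nhds_x_imp_x[OF yext_eq[OF sU]] eps(1) less_imp_le by metis
  have ylim: "(\<lambda>k. yext P (eps (s k)) (xs (s k)) (xs (s k))) \<longlonglongrightarrow> yext P 0 xstar xstar"
    using tendsto_fst[OF isCont_tendsto_compose[OF cont[OF U(2)] slim]] by (simp add: yk ystar)
  have ydiff: "yext P (eps (s k)) (xs (s k)) differentiable (at (xs (s k)))" for k
  proof -
    have e: "eps (s k) > 0" using eps(1) .
    have "(\<lambda>x. fst (v (eps (s k)) x)) differentiable (at (xs (s k)))"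
      using diff[OF sU] e by (intro differentiable_bounded_linear_compose[OF bounded_linear_fst]) simp
    then obtain D where D: "((\<lambda>x. fst (v (eps (s k)) x)) has_derivative D) (at (xs (s k)))"
      unfolding differentiable_def by blast
    have ev: "eventually (\<lambda>x. yext P (eps (s k)) (xs (s k)) x = fst (v (eps (s k)) x)) (nhds (xs (s k)))"
      by (rule yext_eq[OF sU]) (use e in simp)
    have "(yext P (eps (s k)) (xs (s k)) has_derivative D) (at (xs (s k)))"
      using D by (rule has_derivative_transform_eventually)
         (use ev yk in \<open>auto simp: eventually_at_filter elim!: eventually_mono\<close>)
    then show ?thesis by (rule differentiableI)
  qed
  \<comment> \<open>One \<xi> serves both conclusions: C-stationarity uses \<open>- \<xi>\<close> as
    the polar element, B-stationarity tests it with tangent directions.\<close>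
  have main: "\<exists>\<xi>. \<xi> \<in> clarke_grad (reduced_obj P xstar \<nu>) xstar \<and>
    - \<xi> \<in> polar_in (blkspace (lown P) \<nu>) (tangent_cone (strat P \<nu>) (blk (lown P) \<nu> xstar))" for \<nu>
  proof -
    define \<theta> where "\<theta> = lcost P \<nu>"
    have \<theta>: "Ck 1 \<theta>" unfolding \<theta>_def by (rule L1)
    obtain J where J: "(\<lambda>k. ptjac (lown P) \<nu> (yext P (eps (r k)) (xs (r k))) (xs (r k))) \<longlonglongrightarrow> J"
        "J \<in> clarke_jac (\<lambda>u. yext P 0 xstar (upd (lown P) \<nu> xstar u)) xstar"
      using lim by blast
    define Jk where "Jk k = ptjac (lown P) \<nu> (yext P (eps (s k)) (xs (s k))) (xs (s k))" for k
    have Jk: "Jk \<longlonglongrightarrow> J"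
      using LIMSEQ_ignore_initial_segment[OF J(1), of K] by (simp add: Jk_def[abs_def] s_def)
    define \<xi> where "\<xi> = chain_grad (lown P) \<nu> \<theta> (xstar, yext P 0 xstar xstar) J"
    define gk where "gk k = pgrad (lown P) \<nu> (lead_obj P (eps (s k)) (xs (s k)) \<nu>) (xs (s k))" for k
    define ck where "ck k u = yext P (eps (s k)) (xs (s k)) (upd (lown P) \<nu> (xs (s k)) u)" for k u
    have ckd: "ck k differentiable (at (xs (s k)))" for k
    proof -
      have "yext P (eps (s k)) (xs (s k)) differentiable (at (upd (lown P) \<nu> (xs (s k)) (xs (s k))))"
        using ydiff by simp
      from differentiable_chain_at[OF differentiableI[OF upd_has_derivative] this]
      show ?thesis by (simp add: ck_def[abs_def] o_def)
    qed
    have obj: "(\<lambda>u. lead_obj P (eps (s k)) (xs (s k)) \<nu> (upd (lown P) \<nu> (xs (s k)) u)) =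
        (\<lambda>u. \<theta> (upd (lown P) \<nu> (xs (s k)) u, ck k u))" for k
      by (simp add: lead_obj_def \<theta>_def ck_def)
    have gk: "gk k = chain_grad (lown P) \<nu> \<theta> (xs (s k), yext P (eps (s k)) (xs (s k)) (xs (s k))) (Jk k)" for k
      unfolding gk_def pgrad_def obj grad_chain(2)[OF \<theta> ckd]
      by (simp add: Jk_def ptjac_def ck_def[abs_def])
    have gk_lim: "gk \<longlonglongrightarrow> \<xi>"
      unfolding gk[abs_def] \<xi>_def by (intro tendsto_chain_grad[OF \<theta>] tendsto_Pair xlim ylim Jk)
    \<comment> \<open>The polar is taken inside the leader's factor, so membership in the block has
      to be shown besides the sign condition.\<close>
    have gk_blk: "gk k \<in> blkspace (lown P) \<nu>" for k
      unfolding gk_def by (rule pgrad_in_blkspace) (use grad_chain(1)[OF \<theta> ckd] obj in simp)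
    have "- gk k \<in> polar_in (blkspace (lown P) \<nu>) (tangent_cone (strat P \<nu>) (blk (lown P) \<nu> (xs (s k))))" for k
      using stat[of "s k"] gk_blk[of k] unfolding stationary_NE_def polar_in_def gk_def
      by (auto simp: blkspace_def)
    \<comment> \<open>The tangent cones vary with \<open>k\<close>, so the limit lies a priori only
      in the normal cone; regularity of the strategy set closes this gap.\<close>
    then have "- \<xi> \<in> normal_cone_in (blkspace (lown P) \<nu>) (strat P \<nu>) (blk (lown P) \<nu> xstar)"
      unfolding normal_cone_in_def
      by (intro CollectI exI[of _ "\<lambda>k. blk (lown P) \<nu> (xs (s k))"] exI[of _ "\<lambda>k. - gk k"] conjI allI
        xs_strat tendsto_minus[OF gk_lim] bounded_linear.tendsto[OF bounded_linear_blk xlim])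
    then have polar: "- \<xi> \<in> polar_in (blkspace (lown P) \<nu>) (tangent_cone (strat P \<nu>) (blk (lown P) \<nu> xstar))"
      using reg[of \<nu>] xstar_strat[of \<nu>] unfolding regular_set_in_def by blast
    have "isCont (upd (lown P) \<nu> xstar) xstar" by (rule has_derivative_continuous[OF upd_has_derivative])
    then have "isCont (\<lambda>u. yext P 0 xstar (upd (lown P) \<nu> xstar u)) xstar"
      by (rule isCont_o2) (simp add: ycont)
    from chain_grad_in_clarke_grad[OF \<theta> this J(2), of "lown P" \<nu> xstar]
    have "\<xi> \<in> clarke_grad (reduced_obj P xstar \<nu>) xstar"
      by (simp add: \<xi>_def reduced_obj_def[abs_def] lead_obj_def \<theta>_def)
    with polar show ?thesis by blast
  qed
  have "C_stationary_NE P xstar"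
    unfolding C_stationary_NE_def
  proof (intro conjI allI xstar)
    fix \<nu>
    obtain \<xi> where "\<xi> \<in> clarke_grad (reduced_obj P xstar \<nu>) xstar"
      "- \<xi> \<in> polar_in (blkspace (lown P) \<nu>) (tangent_cone (strat P \<nu>) (blk (lown P) \<nu> xstar))" using main by blast
    moreover have "0 = \<xi> + - \<xi>" by simp
    ultimately show "0 \<in> {\<xi> + \<eta> | \<xi> \<eta>. \<xi> \<in> clarke_grad (reduced_obj P xstar \<nu>) xstar \<and>
        \<eta> \<in> polar_in (blkspace (lown P) \<nu>) (tangent_cone (strat P \<nu>) (blk (lown P) \<nu> xstar))}" by blast
  qed
  moreover have "B_stationary_NE P xstar" if R: "\<forall>\<nu>. clarke_regular (reduced_obj P xstar \<nu>) xstar"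
    unfolding B_stationary_NE_def
  proof (intro conjI allI ballI xstar)
    fix \<nu> d assume d: "d \<in> tangent_cone (strat P \<nu>) (blk (lown P) \<nu> xstar)"
    obtain \<xi> where \<xi>: "\<xi> \<in> clarke_grad (reduced_obj P xstar \<nu>) xstar"
      "- \<xi> \<in> polar_in (blkspace (lown P) \<nu>) (tangent_cone (strat P \<nu>) (blk (lown P) \<nu> xstar))" using main by blast
    have "0 \<le> \<xi> \<bullet> d" using \<xi>(2) d by (auto simp: polar_in_def)
    moreover obtain D where D: "has_dir_deriv (reduced_obj P xstar \<nu>) xstar d D"
        "ereal D = clarke_dd (reduced_obj P xstar \<nu>) xstar d"
      using R unfolding clarke_regular_def by blast
    \<comment> \<open>Regularity identifies \<open>D\<close> with Clarke's directional derivative,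
      which dominates the pairing with \<xi>.\<close>
    moreover have "\<xi> \<bullet> d \<le> D" using clarke_grad_le_clarke_dd[OF \<xi>(1), of d] by (simp flip: D(2))
    ultimately have "D \<ge> 0" by linarith
    with D(1) show "\<exists>D. has_dir_deriv (reduced_obj P xstar \<nu>) xstar d D \<and> D \<ge> 0" by blast
  qed
  ultimately show ?thesis by blast
qed

end
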